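(* Let $N \geq 2$ be an integer and let $0 < \alpha < N$. Then there exists a constant $C = C(\alpha, N) > 0$ such that $$\|I_\alpha u\|_{L^{N/(N-\alpha)}(\mathbb{R}^N)} \leq C \,\|Ru\|_{L^1(\mathbb{R}^N;\mathbb{R}^N)}$$ for all $u \in C_c^\infty(\mathbb{R}^N)$ such that $Ru \in L^1(\mathbb{R}^N;\mathbb{R}^N)$, where $I_\alpha u$ is the Riesz potential of order $\alpha$ of $u$ and $Ru$ is the vector-valued Riesz transform of $u$.
   Context: Functions are real-valued. For an integer $N\ge 2$ and $\alpha \in (0,N)$, the Riesz potential of order $\alpha$ of a function $u$ is $$I_\alpha u(x) := \frac{1}{\gamma(\alpha)} \int_{\mathbb{R}^N} \frac{u(y)}{|x-y|^{N-\alpha}} \, dy, \qquad \gamma(\alpha) = \frac{\pi^{N/2}\, 2^\alpha\, \Gamma\left(\frac{\alpha}{2}\right)}{\Gamma\left(\frac{N-\alpha}{2}\right)},$$ whenever it is well-defined. The vector-valued Riesz transform of $u$ is $Ru := D I_1 u$, i.e. the gradient of the Riesz potential of order $1$ of $u$; its components are $R_j u = \partial_{x_j} I_1 u$, $j = 1,\dots,N$. *)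

theory Defs
  imports "HOL-Analysis.Analysis"
begin

definition partial_deriv :: "'n::finite \<Rightarrow> (real ^ 'n \<Rightarrow> real) \<Rightarrow> real ^ 'n \<Rightarrow> real" where
  "partial_deriv j f x = deriv (\<lambda>t. f (x + t *\<^sub>R axis j 1)) 0"

definition gradient :: "(real ^ 'n::finite \<Rightarrow> real) \<Rightarrow> real ^ 'n \<Rightarrow> real ^ 'n" where
  "gradient f x = (\<chi> j. partial_deriv j f x)"

(* Differentiability in the successor case guarantees that the partial derivatives exist
   (deriv is total); together with their continuity this is the usual class C^k. *)
primrec C_k :: "nat \<Rightarrow> (real ^ 'n::finite \<Rightarrow> real) \<Rightarrow> bool" where
  "C_k 0 f \<longleftrightarrow> continuous_on UNIV f"
| "C_k (Suc k) f \<longleftrightarrow> (\<forall>x. f differentiable (at x)) \<and> (\<forall>j. C_k k (partial_deriv j f))"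

definition test_function :: "(real ^ 'n::finite \<Rightarrow> real) \<Rightarrow> bool" where
  "test_function u \<longleftrightarrow> (\<forall>k. C_k k u) \<and> compact (closure {x. u x \<noteq> 0})"

definition riesz_const :: "real \<Rightarrow> real \<Rightarrow> real" where
  "riesz_const N \<alpha> = pi powr (N / 2) * 2 powr \<alpha> * Gamma (\<alpha> / 2) / Gamma ((N - \<alpha>) / 2)"

(* The integrand takes the value 0 at the singularity y = x, a null set. *)
definition riesz_potential :: "real \<Rightarrow> (real ^ 'n::finite \<Rightarrow> real) \<Rightarrow> real ^ 'n \<Rightarrow> real" where
  "riesz_potential \<alpha> u x =
     1 / riesz_const (real CARD('n)) \<alpha> *
     (LINT y|lborel. u y / norm (x - y) powr (real CARD('n) - \<alpha>))"

definition riesz_transform :: "(real ^ 'n::finite \<Rightarrow> real) \<Rightarrow> real ^ 'n \<Rightarrow> real ^ 'n" where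
  "riesz_transform u = gradient (riesz_potential 1 u)"

(* For 0 < p < \<infinity>. The value of Lp_norm is meaningful only for functions satisfying in_Lp,
   since the Bochner integral of a non-integrable function is 0. *)
definition in_Lp :: "real \<Rightarrow> ('a::euclidean_space \<Rightarrow> 'b::euclidean_space) \<Rightarrow> bool" where
  "in_Lp p f \<longleftrightarrow> f \<in> borel_measurable lborel \<and> integrable lborel (\<lambda>x. norm (f x) powr p)"

definition Lp_norm :: "real \<Rightarrow> ('a::euclidean_space \<Rightarrow> 'b::euclidean_space) \<Rightarrow> real" where
  "Lp_norm p f = (LINT x|lborel. norm (f x) powr p) powr (1 / p)"

end

theory Submission
  imports Defs
begin

text \<open>Write \<open>q\<^sub>t\<close> for the time derivative of the heat kernel and \<open>v\<close> for the Riesz potential of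
  order 1 of \<open>u\<close>. Subordination to the heat semigroup and an Abel integral in time give
  \<open>I\<^sub>\<alpha> u = c \<integral> t\<^bsup>(\<alpha> - 1) / 2\<^esup> (q\<^sub>t * v) dt\<close> over \<open>t > 0\<close>, for every \<open>0 < \<alpha> < N\<close>, with no
  distinction between \<open>\<alpha> < 1\<close> and \<open>\<alpha> > 1\<close>. Now cut \<open>v\<close> into its dyadic slices \<open>v\<^sub>k\<close> between the levels
  \<open>\<lambda>\<^sub>k\<^sub>+\<^sub>1\<close> and \<open>\<lambda>\<^sub>k\<close>; let \<open>a\<^sub>k\<close> be the integral of \<open>|Dv|\<close> over the slice and let
  \<open>b\<^sub>k = \<lambda>\<^sub>k |{v > \<lambda>\<^sub>k}|\<^bsup>1 - 1/N\<^esup>\<close>. For a single slice the sup and \<open>L\<^sup>1\<close> bounds on \<open>q\<^sub>t * v\<^sub>k\<close> interpolate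
  to an \<open>L\<^sup>p\<close> bound which is integrable in time, with total at most a multiple of \<open>a\<^sub>k + b\<^sub>k\<^sub>+\<^sub>1\<close>.
  Comparing a slice with its heat flow yields \<open>b\<^sub>k \<le> b\<^sub>k\<^sub>+\<^sub>1 / 2 + C a\<^sub>k\<close>, so that the sum of the \<open>b\<^sub>k\<close> is
  controlled by the sum of the \<open>a\<^sub>k\<close>, that is, by the \<open>L\<^sup>1\<close> norm of \<open>Dv = Ru\<close>. Minkowski's
  inequality sums the slices.\<close>

subsection \<open>Integration on Euclidean space\<close>

text \<open>The obstacle is the exponent 1 on the right-hand side. A single bump of height
  \<open>H\<close> on a set of measure \<open>m\<close> has a natural time \<open>m^(2/N)\<close>:
  before it the mean zero of \<open>q\<^sub>t\<close> brings in the gradient, after it the decay of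
  the kernel in time wins. A general \<open>v\<close> mixes all such scales, so every slice gets its
  own cutting time. For one slice the exponent of time at 0 exceeds -1 by
  \<open>\<alpha> (N - 1) / (2 N)\<close>, positive for every admissible \<alpha>, which is why no
  range of \<alpha> is special. The index shift in the recursion for \<open>b\<^sub>k\<close> arises
  because slice \<open>k\<close> has full height on \<open>{v > \<lambda>\<^sub>k}\<close> but lives
  on the larger set \<open>{v > \<lambda>\<^sub>k\<^sub>+\<^sub>1}\<close>. Absorbing the shifted
  sum requires the \<open>b\<^sub>k\<close> to be bounded beforehand; this comes from the decay
  \<open>|v(x)| \<le> C |x|^(1-N)\<close> for compactly supported \<open>u\<close>. Since the sum
  then converges, its boundary term tends to 0 and this \<open>C\<close>, which depends on
  \<open>u\<close>, disappears from the final constant.\<close>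

lemma nn_integral_lborel_affine:
  fixes f :: "'a::euclidean_space \<Rightarrow> ennreal"
  assumes [measurable]: "f \<in> borel_measurable borel" and "c \<noteq> 0"
  shows "(\<integral>\<^sup>+x. f x \<partial>lborel) = ennreal (\<bar>c\<bar> ^ DIM('a)) * (\<integral>\<^sup>+x. f (a + c *\<^sub>R x) \<partial>lborel)"
  by (subst lborel_affine[OF \<open>c \<noteq> 0\<close>, of a])
     (simp add: nn_integral_density nn_integral_distr nn_integral_cmult)

lemma lborel_distr_affine_isometry:
  fixes a :: "'a::euclidean_space"
  assumes "\<bar>c\<bar> = 1"
  shows "distr lborel borel (\<lambda>x. a + c *\<^sub>R x) = lborel"
  using assms by (subst lborel_affine[of c a]) (auto simp: density_1)

lemma
  fixes f :: "'a::euclidean_space \<Rightarrow> ennreal"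
  assumes [measurable]: "f \<in> borel_measurable borel"
  shows nn_integral_lborel_shift: "(\<integral>\<^sup>+x. f (x + a) \<partial>lborel) = (\<integral>\<^sup>+x. f x \<partial>lborel)"
    and nn_integral_lborel_reflect: "(\<integral>\<^sup>+x. f (a - x) \<partial>lborel) = (\<integral>\<^sup>+x. f x \<partial>lborel)"
  using nn_integral_lborel_affine[of f 1 a] nn_integral_lborel_affine[of f "-1" a]
  by (simp_all add: add.commute)

abbreviation L1_norm :: "('a::euclidean_space \<Rightarrow> real) \<Rightarrow> ennreal" where
  "L1_norm f \<equiv> \<integral>\<^sup>+x. ennreal \<bar>f x\<bar> \<partial>lborel"

lemma
  fixes a :: "'a::euclidean_space"
  shows lborel_distr_shift: "distr lborel borel (\<lambda>x. x + a) = lborel"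
    and lborel_distr_reflect: "distr lborel borel (\<lambda>x. a - x) = lborel"
proof -
  have "(\<lambda>x. x + a) = (\<lambda>x. a + 1 *\<^sub>R x)" "(\<lambda>x. a - x) = (\<lambda>x. a + (-1) *\<^sub>R x)"
    by auto
  then show "distr lborel borel (\<lambda>x. x + a) = lborel" "distr lborel borel (\<lambda>x. a - x) = lborel"
    using lborel_distr_affine_isometry[of 1 a] lborel_distr_affine_isometry[of "-1" a] by simp_all
qed

lemma
  fixes f :: "'a::euclidean_space \<Rightarrow> real"
  assumes [measurable]: "f \<in> borel_measurable borel"
  shows integral_lborel_shift: "(LINT x|lborel. f (x + a)) = (LINT x|lborel. f x)"
    and integral_lborel_reflect: "(LINT x|lborel. f (a - x)) = (LINT x|lborel. f x)"
  using integral_distr[of "\<lambda>x. x + a" lborel borel f]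
    integral_distr[of "\<lambda>x. a - x" lborel borel f]
  by (simp_all add: lborel_distr_shift lborel_distr_reflect)

lemma
  fixes f :: "'a::euclidean_space \<Rightarrow> real"
  assumes "integrable lborel f"
  shows integrable_lborel_shift: "integrable lborel (\<lambda>x. f (x + a))"
    and integrable_lborel_reflect: "integrable lborel (\<lambda>x. f (a - x))"
proof -
  have [measurable]: "f \<in> borel_measurable borel"
    using assms by auto
  show "integrable lborel (\<lambda>x. f (x + a))" "integrable lborel (\<lambda>x. f (a - x))"
    using assms integrable_distr_eq[of "\<lambda>x. x + a" lborel borel f]
      integrable_distr_eq[of "\<lambda>x. a - x" lborel borel f]
    by (simp_all add: lborel_distr_shift lborel_distr_reflect)
qed

text \<open>The circumscribed cube is good enough: what matters is the power of
  \<open>r\<close>.\<close>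

lemma emeasure_cball_le:
  fixes a :: "'a::euclidean_space"
  assumes "0 \<le> r"
  shows "emeasure lborel (cball a r) \<le> ennreal ((2 * r) ^ DIM('a))"
proof -
  let ?s = "\<Sum>i\<in>Basis. r *\<^sub>R i :: 'a"
  have "cball a r \<subseteq> cbox (a - ?s) (a + ?s)"
  proof
    fix x assume "x \<in> cball a r"
    then have "\<bar>(x - a) \<bullet> i\<bar> \<le> r" if "i \<in> Basis" for i
      using Basis_le_norm[OF that, of "x - a"] by (simp add: dist_norm norm_minus_commute)
    then show "x \<in> cbox (a - ?s) (a + ?s)"
      by (auto simp: mem_box inner_diff_left inner_add_left inner_sum_left_Basis abs_le_iff)
        (smt (verit))+
  qed
  then have "emeasure lborel (cball a r) \<le> emeasure lborel (cbox (a - ?s) (a + ?s))"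
    by (intro emeasure_mono) auto
  also have "\<dots> = ennreal ((2 * r) ^ DIM('a))"
    using assms by (subst emeasure_lborel_cbox_eq)
      (auto simp: inner_diff_left inner_add_left inner_sum_left_Basis algebra_simps prod_constant)
  finally show ?thesis .
qed

text \<open>By the mean value inequality a majorant of the derivative on a neighbourhood also
  dominates the difference quotients, so dominated convergence applies along every sequence tending
  to \<open>s0\<close>. The sequence is shifted to its tail inside the neighbourhood.\<close>

lemma deriv_under_integral:
  fixes f :: "real \<Rightarrow> 'b \<Rightarrow> real"
  assumes "0 < \<delta>"
    and int: "\<And>s. \<bar>s - s0\<bar> < \<delta> \<Longrightarrow> integrable M (f s)"
    and deriv: "\<And>s y. \<bar>s - s0\<bar> < \<delta> \<Longrightarrow> y \<in> space M \<Longrightarrow> ((\<lambda>s. f s y) has_real_derivative f' s y) (at s)"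
    and dom: "\<And>s y. \<bar>s - s0\<bar> < \<delta> \<Longrightarrow> y \<in> space M \<Longrightarrow> \<bar>f' s y\<bar> \<le> g y"
    and g: "integrable M g"
    and meas: "f' s0 \<in> borel_measurable M"
  shows "((\<lambda>s. LINT y|M. f s y) has_real_derivative (LINT y|M. f' s0 y)) (at s0)"
proof -
  have lip: "\<bar>f s y - f s0 y\<bar> \<le> g y * \<bar>s - s0\<bar>" if "\<bar>s - s0\<bar> < \<delta>" "y \<in> space M" for s y
  proof -
    have "norm (f s y - f s0 y) \<le> g y * norm (s - s0)"
    proof (rule field_differentiable_bound[where S="{s. \<bar>s - s0\<bar> < \<delta>}" and f'="\<lambda>s. f' s y"])
      have "{s. \<bar>s - s0\<bar> < \<delta>} = ball s0 \<delta>"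
        by (auto simp: dist_real_def)
      then show "convex {s. \<bar>s - s0\<bar> < \<delta>}" by simp
    qed (use that \<open>0 < \<delta>\<close> deriv dom in \<open>auto intro: DERIV_subset\<close>)
    then show ?thesis by simp
  qed
  have "((\<lambda>s. ((LINT y|M. f s y) - (LINT y|M. f s0 y)) / (s - s0)) \<longlongrightarrow> (LINT y|M. f' s0 y)) (at s0)"
  proof (rule tendsto_at_iff_sequentially[THEN iffD2], intro allI impI)
    fix X assume X: "\<forall>i. X i \<in> UNIV - {s0}" "X \<longlonglongrightarrow> s0"
    have "\<forall>\<^sub>F i in sequentially. \<bar>X i - s0\<bar> < \<delta>"
      using tendstoD[OF X(2) \<open>0 < \<delta>\<close>] by (simp add: dist_real_def)
    then obtain n where n: "\<And>i. i \<ge> n \<Longrightarrow> \<bar>X i - s0\<bar> < \<delta>"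
      by (auto simp: eventually_sequentially)
    have ne: "X i \<noteq> s0" for i using X(1) by auto
    have "(\<lambda>i. LINT y|M. (f (X (i + n)) y - f s0 y) / (X (i + n) - s0)) \<longlonglongrightarrow> (LINT y|M. f' s0 y)"
    proof (rule integral_dominated_convergence[where w=g])
      show "f' s0 \<in> borel_measurable M" by fact
      show "(\<lambda>y. (f (X (i + n)) y - f s0 y) / (X (i + n) - s0)) \<in> borel_measurable M" for i
        using int[OF n[of "i + n"]] int[of s0] \<open>0 < \<delta>\<close> by (auto intro!: borel_measurable_divide borel_measurable_diff)
      show "integrable M g" by fact
      show "AE y in M. (\<lambda>i. (f (X (i + n)) y - f s0 y) / (X (i + n) - s0)) \<longlonglongrightarrow> f' s0 y"
      proof (intro AE_I2)
        fix y assume "y \<in> space M"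
        then have "((\<lambda>s. (f s y - f s0 y) / (s - s0)) \<longlongrightarrow> f' s0 y) (at s0)"
          using deriv[of s0 y] \<open>0 < \<delta>\<close> by (auto simp: has_field_derivative_iff)
        then have "(\<lambda>i. (f (X i) y - f s0 y) / (X i - s0)) \<longlonglongrightarrow> f' s0 y"
          using X by (auto simp: tendsto_at_iff_sequentially o_def)
        then show "(\<lambda>i. (f (X (i + n)) y - f s0 y) / (X (i + n) - s0)) \<longlonglongrightarrow> f' s0 y"
          by (rule LIMSEQ_ignore_initial_segment)
      qed
      show "AE y in M. norm ((f (X (i + n)) y - f s0 y) / (X (i + n) - s0)) \<le> g y" for i
        using lip[OF n[of "i + n"]] ne[of "i + n"] by (auto intro!: AE_I2 simp: divide_le_eq)
    qed
    also have "(\<lambda>i. LINT y|M. (f (X (i + n)) y - f s0 y) / (X (i + n) - s0)) =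
      (\<lambda>i. ((LINT y|M. f (X (i + n)) y) - (LINT y|M. f s0 y)) / (X (i + n) - s0))"
      using int n \<open>0 < \<delta>\<close> by (auto simp: fun_eq_iff)
    finally have "(\<lambda>i. ((LINT y|M. f (X i) y) - (LINT y|M. f s0 y)) / (X i - s0)) \<longlonglongrightarrow> (LINT y|M. f' s0 y)"
      by (rule LIMSEQ_offset)
    then show "((\<lambda>s. ((LINT y|M. f s y) - (LINT y|M. f s0 y)) / (s - s0)) \<circ> X) \<longlonglongrightarrow> (LINT y|M. f' s0 y)"
      by (simp add: o_def)
  qed
  then show ?thesis by (simp add: has_field_derivative_iff)
qed

lemma ennreal_le_suminf: "f n \<le> suminf f" for f :: "nat \<Rightarrow> ennreal"
  using sum_le_suminf[of f "{n}"] by simp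

text \<open>The hypothesis holds at every base point, so the base point is moved to
  \<open>x + s *\<^sub>R h\<close>.\<close>

lemma deriv_along_line:
  fixes f :: "'a::real_inner \<Rightarrow> real"
  assumes "\<And>x h. ((\<lambda>s. f (x + s *\<^sub>R h)) has_real_derivative (g x \<bullet> h)) (at 0)"
  shows "((\<lambda>s. f (x + s *\<^sub>R h)) has_real_derivative (g (x + s *\<^sub>R h) \<bullet> h)) (at s)"
proof -
  have "((\<lambda>r. f (x + s *\<^sub>R h + r *\<^sub>R h)) has_real_derivative (g (x + s *\<^sub>R h) \<bullet> h)) (at 0)"
    by (rule assms)
  then have "((\<lambda>r. f (x + (s + r) *\<^sub>R h)) has_real_derivative (g (x + s *\<^sub>R h) \<bullet> h)) (at 0)"
    by (simp add: scaleR_add_left add.assoc)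
  then show ?thesis
    using DERIV_at_within_shift[of "\<lambda>s. f (x + s *\<^sub>R h)" "g (x + s *\<^sub>R h) \<bullet> h" s 0 UNIV] by simp
qed

text \<open>Summation over balls of radius \<open>n + 1\<close> with weight
  \<open>exp (1 - n)\<close>. Their volume grows polynomially and is absorbed by half of the
  exponential, which leaves a geometric series of ratio \<open>exp (- 1 / 2)\<close>.\<close>

lemma integrable_exp_neg_norm: "integrable lborel (\<lambda>x::'a::euclidean_space. exp (- norm x))"
proof (rule integrableI_bounded)
  let ?D = "DIM('a)"
  define c where "c = exp 1 * (fact ?D * 4 ^ ?D * exp (1 / 2) :: real)"
  have pow: "(2 * (real n + 1)) ^ ?D \<le> fact ?D * 4 ^ ?D * exp (1 / 2) * exp (real n / 2)" for n :: nat
  proof -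
    \<comment> \<open>A single term of the exponential series at \<open>?y\<close>, multiplied by
      \<open>4 ^ ?D\<close>, is the required volume bound, since
      \<open>4 * ?y = 2 * (n + 1)\<close>.\<close>
    let ?y = "(real n + 1) / 2"
    have "?y ^ ?D / fact ?D \<le> exp ?y"
    proof -
      have "(\<Sum>k\<in>{?D}. ?y ^ k /\<^sub>R fact k) \<le> suminf (\<lambda>k. ?y ^ k /\<^sub>R fact k)"
        by (intro sum_le_suminf summable_exp_generic) auto
      then have "?y ^ ?D /\<^sub>R fact ?D \<le> exp ?y"
        by (simp only: exp_def sum.insert_if sum.empty finite.emptyI) simp
      then show ?thesis by (simp only: real_scaleR_def divide_inverse mult.commute)
    qed
    then have "4 ^ ?D * ?y ^ ?D \<le> 4 ^ ?D * (fact ?D * exp ?y)"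
      by (intro mult_left_mono) (auto simp: field_simps)
    moreover have "4 ^ ?D * ?y ^ ?D = (2 * (real n + 1)) ^ ?D"
      by (simp flip: power_mult_distrib add: field_simps)
    moreover have "exp ?y = exp (1 / 2) * exp (real n / 2)"
      by (simp flip: exp_add add: field_simps)
    ultimately show ?thesis by (simp add: mult_ac)
  qed
  have le: "ennreal (exp (- norm x)) \<le>
    (\<Sum>n. ennreal (exp 1 * exp (- (real n))) * indicator (cball 0 (real n + 1)) x)" (is "_ \<le> suminf (\<lambda>n. ?F n x)") for x :: 'a
  proof -
    define n where "n = nat \<lfloor>norm x\<rfloor>"
    have n: "real n \<le> norm x" "norm x \<le> real n + 1"
      unfolding n_def by (auto simp: of_nat_nat real_of_int_floor_add_one_ge)
    then have "ennreal (exp (- norm x)) \<le> ?F n x"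
      by (auto simp: exp_minus field_simps simp flip: exp_add exp_diff)
    also have "\<dots> \<le> suminf (\<lambda>n. ?F n x)"
      by (rule ennreal_le_suminf)
    finally show ?thesis .
  qed
  have "(\<integral>\<^sup>+(x::'a). ennreal (norm (exp (- norm x))) \<partial>lborel) \<le>
     (\<integral>\<^sup>+(x::'a). (\<Sum>n. ennreal (exp 1 * exp (- (real n))) * indicator (cball 0 (real n + 1)) x) \<partial>lborel)"
    using le by (auto intro!: nn_integral_mono)
  also have "\<dots> = (\<Sum>n. ennreal (exp 1 * exp (- (real n))) * emeasure lborel (cball (0::'a) (real n + 1)))"
    by (subst nn_integral_suminf)
      (auto simp: nn_integral_cmult_indicator intro!: borel_measurable_times_ennreal borel_measurable_indicator)
  also have "\<dots> \<le> (\<Sum>n. ennreal (c * exp (- (1/2)) ^ n))"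
  proof (intro suminf_le summableI)
    fix n
    have "ennreal (exp 1 * exp (- (real n))) * emeasure lborel (cball (0::'a) (real n + 1)) \<le>
      ennreal (exp 1 * exp (- (real n))) * ennreal ((2 * (real n + 1)) ^ ?D)"
      by (intro mult_left_mono emeasure_cball_le) auto
    also have "\<dots> = ennreal (exp 1 * exp (- (real n)) * (2 * (real n + 1)) ^ ?D)"
      by (simp add: ennreal_mult)
    also have "\<dots> \<le> ennreal (exp 1 * exp (- (real n)) * (fact ?D * 4 ^ ?D * exp (1 / 2) * exp (real n / 2)))"
      by (intro ennreal_leI mult_left_mono pow) auto
    also have "\<dots> = ennreal (c * (exp (- (real n)) * exp (real n / 2)))"
      by (simp add: c_def mult_ac)
    also have "exp (- (real n)) * exp (real n / 2) = exp (- (1/2)) ^ n"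
      by (simp flip: exp_add exp_of_nat_mult)
    finally show "ennreal (exp 1 * exp (- (real n))) * emeasure lborel (cball (0::'a) (real n + 1)) \<le>
      ennreal (c * exp (- (1/2)) ^ n)" .
  qed
  also have "\<dots> < \<infinity>"
  proof -
    have "summable (\<lambda>n. c * exp (- (1/2)) ^ n)"
      by (intro summable_mult summable_geometric) auto
    then have "(\<Sum>n. ennreal (c * exp (- (1/2)) ^ n)) = ennreal (\<Sum>n. c * exp (- (1/2)) ^ n)"
      by (intro suminf_ennreal2) (auto simp: c_def)
    then show ?thesis by simp
  qed
  finally show "(\<integral>\<^sup>+(x::'a). ennreal (norm (exp (- norm x))) \<partial>lborel) < \<infinity>" .
qed auto

subsection \<open>The heat kernel\<close>

text \<open>This is \<open>pi powr (D / 2)\<close> times the standard heat kernel at time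
  \<open>t / 4\<close>. Without the normalisation the value of the Gaussian integral stays a named
  constant, \<open>heat_mass\<close>, which then appears as a factor in the semigroup law.\<close>

definition heat :: "real \<Rightarrow> 'a::euclidean_space \<Rightarrow> real" where
  "heat t x = t powr (- real DIM('a) / 2) * exp (- (norm x)\<^sup>2 / t)"

text \<open>The time derivative of \<open>heat\<close> in closed form, that is, the
  \<open>q\<^sub>t\<close> of the overview.\<close>

definition dheat :: "real \<Rightarrow> 'a::euclidean_space \<Rightarrow> real" where
  "dheat t x = ((norm x)\<^sup>2 / t\<^sup>2 - real DIM('a) / (2 * t)) * heat t x"

definition heat_mass :: "'a::euclidean_space itself \<Rightarrow> real" where
  "heat_mass _ = (LINT x|lborel. heat 1 (x::'a))"

definition dheat_const :: "'a::euclidean_space itself \<Rightarrow> real" where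
  "dheat_const _ = (2 + real DIM('a) / 2) * 2 powr (real DIM('a) / 2)"

lemma heat_nonneg [simp]: "0 \<le> heat t x"
  by (simp add: heat_def)

lemma heat_pos: "0 < t \<Longrightarrow> 0 < heat t x"
  by (simp add: heat_def)

lemma heat_measurable [measurable (raw)]:
  assumes [measurable]: "f \<in> borel_measurable M" "g \<in> borel_measurable M"
  shows "(\<lambda>x. heat (f x) (g x :: 'a::euclidean_space)) \<in> borel_measurable M"
  unfolding heat_def by measurable

lemma dheat_measurable [measurable (raw)]:
  assumes [measurable]: "f \<in> borel_measurable M" "g \<in> borel_measurable M"
  shows "(\<lambda>x. dheat (f x) (g x :: 'a::euclidean_space)) \<in> borel_measurable M"
  unfolding dheat_def by measurable

lemma heat_le:
  fixes x :: "'a::euclidean_space"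
  shows "0 < t \<Longrightarrow> heat t x \<le> t powr (- real DIM('a) / 2)"
  by (simp add: heat_def mult_le_cancel_left1)

lemma heat_scale:
  fixes x :: "'a::euclidean_space"
  assumes "0 < t"
  shows "sqrt t ^ DIM('a) * heat t (sqrt t *\<^sub>R x) = heat 1 x"
proof -
  have "sqrt t ^ DIM('a) = t powr (real DIM('a) / 2)"
    using assms by (simp add: powr_half_sqrt[symmetric] powr_powr flip: powr_realpow)
  then show ?thesis
    using assms by (simp add: heat_def powr_minus field_simps power_mult_distrib)
qed

lemma nn_integral_heat_scale:
  fixes g :: "real \<Rightarrow> real"
  assumes [measurable]: "g \<in> borel_measurable borel" and "0 < t"
  shows "(\<integral>\<^sup>+x. ennreal (heat t (x::'a::euclidean_space) * g (norm x)) \<partial>lborel) =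
    (\<integral>\<^sup>+x. ennreal (heat 1 (x::'a) * g (sqrt t * norm x)) \<partial>lborel)"
proof -
  have "(\<integral>\<^sup>+x. ennreal (heat t (x::'a) * g (norm x)) \<partial>lborel) =
      ennreal (sqrt t ^ DIM('a)) * (\<integral>\<^sup>+x. ennreal (heat t (sqrt t *\<^sub>R (x::'a)) * g (sqrt t * norm x)) \<partial>lborel)"
    using \<open>0 < t\<close> nn_integral_lborel_affine[of "\<lambda>x. ennreal (heat t (x::'a) * g (norm x))" "sqrt t" 0]
    by simp
  also have "\<dots> = (\<integral>\<^sup>+x. ennreal (sqrt t ^ DIM('a)) * ennreal (heat t (sqrt t *\<^sub>R (x::'a)) * g (sqrt t * norm x)) \<partial>lborel)"
    by (intro nn_integral_cmult[symmetric]) measurable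
  also have "\<dots> = (\<integral>\<^sup>+x. ennreal (heat 1 (x::'a) * g (sqrt t * norm x)) \<partial>lborel)"
    using \<open>0 < t\<close> by (simp add: ennreal_mult'[symmetric] mult.assoc[symmetric] heat_scale)
  finally show ?thesis .
qed

lemma integrable_heat_1:
  shows "integrable lborel (\<lambda>x::'a::euclidean_space. heat 1 x)"
    and "integrable lborel (\<lambda>x::'a::euclidean_space. heat 1 x * norm x)"
proof -
  have *: "heat 1 x * (1 + norm x) \<le> exp 1 * exp (- norm x)" for x :: 'a
  proof -
    have "exp (- (norm x)\<^sup>2) * (1 + norm x) \<le> exp (- (norm x)\<^sup>2) * exp (norm x)"
      by (intro mult_left_mono exp_ge_add_one_self) auto
    \<comment> \<open>With \<open>r = norm x\<close>, the inequality
      \<open>r - r^2 \<le> 1 - r\<close> is \<open>(r - 1)^2 \<ge> 0\<close>.\<close>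
    also have "\<dots> \<le> exp (1 - norm x)"
      using sum_squares_ge_zero[of "norm x - 1" 0]
      by (simp add: power2_eq_square algebra_simps flip: exp_add)
    finally show ?thesis
      by (simp add: heat_def exp_diff exp_minus field_simps)
  qed
  have i: "integrable lborel (\<lambda>x::'a. exp 1 * exp (- norm x))"
    by (intro integrable_mult_right integrable_exp_neg_norm)
  have "heat 1 x \<le> exp 1 * exp (- norm x)" "heat 1 x * norm x \<le> exp 1 * exp (- norm x)" for x :: 'a
    using *[of x] mult_nonneg_nonneg[OF heat_nonneg[of 1 x] norm_ge_zero[of x]] heat_nonneg[of 1 x]
    unfolding distrib_left mult_1_right by linarith+
  then show "integrable lborel (\<lambda>x::'a. heat 1 x)" "integrable lborel (\<lambda>x::'a. heat 1 x * norm x)"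
    by (intro Bochner_Integration.integrable_bound[OF i]; simp)+
qed

lemma nn_integral_heat:
  assumes "0 < t"
  shows "(\<integral>\<^sup>+x. ennreal (heat t (x::'a::euclidean_space)) \<partial>lborel) = ennreal (heat_mass TYPE('a))"
  using nn_integral_heat_scale[of "\<lambda>_. 1" t, where 'a='a] assms
  by (simp add: heat_mass_def nn_integral_eq_integral integrable_heat_1)

lemma integrable_heat: "0 < t \<Longrightarrow> integrable lborel (\<lambda>x::'a::euclidean_space. heat t x)"
  by (intro integrableI_bounded) (auto simp: nn_integral_heat)

lemma heat_mass_nonneg: "0 \<le> heat_mass TYPE('a::euclidean_space)"
  by (simp add: heat_mass_def)

lemma integral_heat:
  "0 < t \<Longrightarrow> (LINT x|lborel. heat t (x::'a::euclidean_space)) = heat_mass TYPE('a)"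
  using nn_integral_heat[of t, where 'a='a]
  by (simp add: integral_eq_nn_integral heat_mass_nonneg)

lemma heat_mass_pos: "0 < heat_mass TYPE('a::euclidean_space)"
proof (rule ccontr)
  assume "\<not> ?thesis"
  then have "(\<integral>\<^sup>+x. ennreal (heat 1 (x::'a)) \<partial>lborel) = 0"
    by (simp add: nn_integral_heat ennreal_neg)
  then have "AE x in lborel. heat 1 (x::'a) \<le> 0"
    by (subst (asm) nn_integral_0_iff_AE) auto
  then have "AE x in (lborel :: 'a measure). False"
    by eventually_elim (simp add: heat_def)
  then show False
    by (auto simp: AE_iff_measurable[OF _ refl])
qed

text \<open>The first moment measures how far a convolution departs from the function when
  translations cost an amount linear in the displacement.\<close>

definition heat_moment :: "'a::euclidean_space itself \<Rightarrow> real" where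
  "heat_moment _ = (LINT x|lborel. heat 1 (x::'a) * norm x)"

lemma heat_moment_nonneg: "0 \<le> heat_moment TYPE('a::euclidean_space)"
  by (simp add: heat_moment_def)

lemma nn_integral_heat_norm:
  assumes "0 < t"
  shows "(\<integral>\<^sup>+x. ennreal (heat t (x::'a::euclidean_space) * norm x) \<partial>lborel) = ennreal (sqrt t * heat_moment TYPE('a))"
proof -
  have "(\<integral>\<^sup>+x. ennreal (heat t (x::'a::euclidean_space) * norm x) \<partial>lborel) =
     (\<integral>\<^sup>+x. ennreal (sqrt t * (heat 1 (x::'a::euclidean_space) * norm x)) \<partial>lborel)"
    using nn_integral_heat_scale[of "\<lambda>x. x" t, where 'a='a] assms
    by (simp only: mult.left_commute) simp
  also have "\<dots> = ennreal (LINT x|lborel. sqrt t * (heat 1 (x::'a::euclidean_space) * norm x))"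
    using assms by (intro nn_integral_eq_integral integrable_mult_right integrable_heat_1) auto
  finally show ?thesis
    by (simp add: heat_moment_def)
qed

lemma dheat_const_pos: "0 < dheat_const TYPE('a::euclidean_space)"
  by (simp add: dheat_const_def add_pos_nonneg)

text \<open>Half of the Gaussian decay is spent on the polynomial factor: with \<open>\<rho>\<close>
  the square of the norm over \<open>t\<close>, \<open>\<rho> * exp (- \<rho> / 2)\<close> is at
  most 2. The other half is the Gaussian at time \<open>2 * t\<close>, up to the factor
  \<open>2 powr (D / 2)\<close> from the prefactors. Bounds on \<open>dheat\<close> thereby reduce
  to bounds on \<open>heat\<close>.\<close>

lemma dheat_bound:
  fixes x :: "'a::euclidean_space"
  assumes "0 < t"
  shows "\<bar>dheat t x\<bar> \<le> dheat_const TYPE('a) / t * heat (2 * t) x"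
proof -
  define \<rho> where "\<rho> = (norm x)\<^sup>2 / t"
  define D where "D = real DIM('a)"
  have "\<rho> \<ge> 0" using assms by (simp add: \<rho>_def)
  have e: "\<rho> * exp (- (\<rho> / 2)) \<le> 2"
    using exp_ge_add_one_self[of "\<rho> / 2"] by (simp add: exp_minus field_simps)
  have "\<bar>(norm x)\<^sup>2 / t\<^sup>2 - D / (2 * t)\<bar> \<le> (norm x)\<^sup>2 / t\<^sup>2 + D / (2 * t)"
    using assms by (auto simp: abs_le_iff D_def)
  also have "\<dots> = (\<rho> + D / 2) / t"
    using assms by (simp add: \<rho>_def field_simps power2_eq_square)
  finally have "\<bar>dheat t x\<bar> \<le> (\<rho> + D / 2) / t * heat t x"
    unfolding dheat_def abs_mult D_def[symmetric] by (simp add: mult_right_mono del: times_divide_eq_left)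
  also have "heat t x = 2 powr (D / 2) * exp (- (\<rho> / 2)) * heat (2 * t) x"
  proof -
    have "exp (- (norm x)\<^sup>2 / t) = exp (- (\<rho> / 2)) * exp (- (norm x)\<^sup>2 / (2 * t))"
      using assms by (simp add: \<rho>_def flip: exp_add)
    then show ?thesis
      using assms by (simp add: heat_def powr_mult powr_minus D_def field_simps)
  qed
  also have "(\<rho> + D / 2) / t * (2 powr (D / 2) * exp (- (\<rho> / 2)) * heat (2 * t) x) =
      ((\<rho> + D / 2) * exp (- (\<rho> / 2))) * (2 powr (D / 2) / t * heat (2 * t) x)"
    by (simp add: mult_ac)
  also have "\<dots> \<le> (2 + D / 2) * (2 powr (D / 2) / t * heat (2 * t) x)"
  proof (intro mult_right_mono)
    have "D / 2 * exp (- (\<rho> / 2)) \<le> D / 2 * 1"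
      using \<open>\<rho> \<ge> 0\<close> by (intro mult_left_mono) (auto simp: D_def)
    then show "(\<rho> + D / 2) * exp (- (\<rho> / 2)) \<le> 2 + D / 2"
      using e by (simp add: algebra_simps)
  qed (use assms in auto)
  finally show ?thesis
    by (simp add: dheat_const_def D_def mult_ac)
qed

lemma heat_has_derivative:
  assumes "0 < t"
  shows "((\<lambda>t. heat t x) has_real_derivative dheat t (x::'a::euclidean_space)) (at t)"
proof -
  let ?D = "real DIM('a)"
  have "((\<lambda>t. heat t x) has_real_derivative
     (- ?D / 2 * t powr (- ?D / 2 - 1)) * exp (- (norm x)\<^sup>2 / t) +
     exp (- (norm x)\<^sup>2 / t) * ((norm x)\<^sup>2 / t\<^sup>2) * t powr (- ?D / 2)) (at t)"
    unfolding heat_def using assms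
    by (auto intro!: derivative_eq_intros simp: power2_eq_square)
  then show ?thesis
    using assms by (simp add: dheat_def heat_def powr_diff ring_distribs mult_ac)
qed

text \<open>Completing the square in \<open>y\<close>; the prefactors match because
  \<open>t * s\<close> is the product of \<open>t + s\<close> and \<open>t * s / (t + s)\<close>.
  The right-hand side is a single Gaussian in \<open>y\<close>, so integrating it yields the
  semigroup law.\<close>

lemma heat_product:
  fixes x y :: "'a::euclidean_space"
  assumes "0 < t" "0 < s"
  shows "heat t (x - y) * heat s y = heat (t + s) x * heat (t * s / (t + s)) (y - (s / (t + s)) *\<^sub>R x)"
proof -
  have "(norm (x - y))\<^sup>2 / t + (norm y)\<^sup>2 / s =
    (norm x)\<^sup>2 / (t + s) + (norm (y - (s / (t + s)) *\<^sub>R x))\<^sup>2 / (t * s / (t + s))"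
  proof -
    define X Y W where "X = x \<bullet> x" and "Y = y \<bullet> y" and "W = x \<bullet> y"
    have "(norm (x - y))\<^sup>2 = X - 2 * W + Y"
      by (simp add: X_def Y_def W_def power2_norm_eq_inner algebra_simps inner_commute)
    moreover have "(norm (y - (s / (t + s)) *\<^sub>R x))\<^sup>2 = Y - 2 * (s / (t + s)) * W + (s / (t + s))\<^sup>2 * X"
      unfolding X_def Y_def W_def power2_norm_eq_inner
      by (simp add: inner_diff_left inner_diff_right inner_commute power2_eq_square)
    moreover have "(norm x)\<^sup>2 = X" "(norm y)\<^sup>2 = Y"
      by (simp_all add: X_def Y_def power2_norm_eq_inner)
    moreover have "(X - 2 * W + Y) / t + Y / s =
       X / (t + s) + (Y - 2 * (s / (t + s)) * W + (s / (t + s))\<^sup>2 * X) / (t * s / (t + s))"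
    proof -
      have "t + s \<noteq> 0" "t \<noteq> 0" "s \<noteq> 0" using assms by auto
      then show ?thesis by (simp add: divide_simps power2_eq_square) algebra
    qed
    ultimately show ?thesis by simp
  qed
  then have "exp (- (norm (x - y))\<^sup>2 / t) * exp (- (norm y)\<^sup>2 / s) =
    exp (- (norm x)\<^sup>2 / (t + s)) * exp (- (norm (y - (s / (t + s)) *\<^sub>R x))\<^sup>2 / (t * s / (t + s)))"
    by (simp flip: exp_add)
  then have eq: "(t powr r * s powr r) * (exp (- (norm (x - y))\<^sup>2 / t) * exp (- (norm y)\<^sup>2 / s)) =
    ((t + s) powr r * (t * s / (t + s)) powr r) *
    (exp (- (norm x)\<^sup>2 / (t + s)) * exp (- (norm (y - (s / (t + s)) *\<^sub>R x))\<^sup>2 / (t * s / (t + s))))" for r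
    using assms by (simp flip: powr_mult)
  show ?thesis
    using eq[of "- real DIM('a) / 2"] unfolding heat_def by (simp only: mult_ac)
qed

lemma heat_semigroup:
  fixes x :: "'a::euclidean_space"
  assumes "0 < t" "0 < s"
  shows "(LINT y|lborel. heat t (x - y) * heat s y) = heat_mass TYPE('a) * heat (t + s) x"
    and "integrable lborel (\<lambda>y. heat t (x - y) * heat s y)"
proof -
  have "(LINT y|lborel. heat (t * s / (t + s)) (y - (s / (t + s)) *\<^sub>R x)) = heat_mass TYPE('a)"
    using integral_lborel_shift[of "heat (t * s / (t + s)) :: 'a \<Rightarrow> real" "- (s / (t + s)) *\<^sub>R x"] assms
    by (simp add: integral_heat)
  then show "(LINT y|lborel. heat t (x - y) * heat s y) = heat_mass TYPE('a) * heat (t + s) x"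
    unfolding heat_product[OF assms] by simp
  show "integrable lborel (\<lambda>y. heat t (x - y) * heat s y)"
    unfolding heat_product[OF assms]
    using integrable_lborel_shift[OF integrable_heat[of "t * s / (t + s)"], of "- (s / (t + s)) *\<^sub>R x"] assms
    by auto
qed

section \<open>Norms, semigroup law and mean of the time derivative\<close>

lemma dheat_le:
  fixes x :: "'a::euclidean_space"
  assumes "0 < t"
  shows "\<bar>dheat t x\<bar> \<le> dheat_const TYPE('a) * t powr (- 1 - real DIM('a) / 2)"
proof -
  let ?D = "real DIM('a)" and ?dc = "dheat_const TYPE('a)"
  have "\<bar>dheat t x\<bar> \<le> ?dc / t * heat (2 * t) x"
    by (rule dheat_bound) fact
  also have "\<dots> \<le> ?dc / t * t powr (- ?D / 2)"
  proof (intro mult_left_mono)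
    have "heat (2 * t) x \<le> (2 * t) powr (- ?D / 2)"
      using assms by (intro heat_le) auto
    also have "\<dots> \<le> t powr (- ?D / 2)"
      using assms by (intro powr_mono2') auto
    finally show "heat (2 * t) x \<le> t powr (- ?D / 2)" .
  qed (use assms dheat_const_pos[where 'a='a] in auto)
  also have "\<dots> = ?dc * t powr (- 1 - ?D / 2)"
    using assms powr_add[of t "- 1" "- ?D / 2"] by (simp add: powr_minus field_simps)
  finally show ?thesis .
qed

lemma nn_integral_dheat:
  assumes "0 < t"
  shows "L1_norm (\<lambda>x. dheat t (x::'a::euclidean_space)) \<le>
    ennreal (dheat_const TYPE('a) * heat_mass TYPE('a) / t)"
proof -
  have "L1_norm (\<lambda>x. dheat t (x::'a::euclidean_space)) \<le>
    (\<integral>\<^sup>+x. ennreal (dheat_const TYPE('a) / t * heat (2 * t) (x::'a)) \<partial>lborel)"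
    using assms by (intro nn_integral_mono ennreal_leI dheat_bound)
  also have "\<dots> = ennreal (LINT x|lborel. dheat_const TYPE('a) / t * heat (2 * t) (x::'a))"
    using assms dheat_const_pos[where 'a='a]
    by (intro nn_integral_eq_integral integrable_mult_right integrable_heat) auto
  finally show ?thesis
    using assms by (simp add: integral_heat)
qed

lemma nn_integral_dheat_norm:
  assumes "0 < t"
  shows "(\<integral>\<^sup>+x. ennreal (\<bar>dheat t (x::'a::euclidean_space)\<bar> * norm x) \<partial>lborel) \<le>
    ennreal (2 * dheat_const TYPE('a) * heat_moment TYPE('a) * t powr (- 1 / 2))"
proof -
  let ?dc = "dheat_const TYPE('a)"
  have "(\<integral>\<^sup>+x. ennreal (\<bar>dheat t (x::'a::euclidean_space)\<bar> * norm x) \<partial>lborel) \<le>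
    (\<integral>\<^sup>+x. ennreal (?dc / t * heat (2 * t) (x::'a) * norm x) \<partial>lborel)"
    using assms by (intro nn_integral_mono ennreal_leI mult_right_mono dheat_bound) auto
  also have "\<dots> = ennreal (?dc / t) * (\<integral>\<^sup>+x. ennreal (heat (2 * t) (x::'a) * norm x) \<partial>lborel)"
    using assms dheat_const_pos[where 'a='a]
    by (subst nn_integral_cmult[symmetric]) (auto simp: mult.assoc ennreal_mult' simp del: times_divide_eq_left intro!: nn_integral_cong)
  also have "\<dots> = ennreal (?dc / t * (sqrt (2 * t) * heat_moment TYPE('a)))"
    using assms dheat_const_pos[where 'a='a] heat_moment_nonneg[where 'a='a]
    by (subst nn_integral_heat_norm) (simp_all add: ennreal_mult'[symmetric] del: times_divide_eq_left)
  also have "\<dots> \<le> ennreal (2 * ?dc * heat_moment TYPE('a) * t powr (- 1 / 2))"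
  proof (intro ennreal_leI)
    have "sqrt (2 * t) / t = sqrt 2 * t powr (- 1 / 2)"
      using assms by (simp add: real_sqrt_mult powr_minus powr_half_sqrt field_simps)
    moreover have "sqrt 2 \<le> 2"
      using real_sqrt_le_mono[of 2 4] by simp
    ultimately have "sqrt (2 * t) / t \<le> 2 * t powr (- 1 / 2)"
      by (simp add: mult_right_mono)
    then have "?dc * heat_moment TYPE('a) * (sqrt (2 * t) / t) \<le>
      ?dc * heat_moment TYPE('a) * (2 * t powr (- 1 / 2))"
      using dheat_const_pos[where 'a='a] heat_moment_nonneg[where 'a='a] by (intro mult_left_mono) auto
    then show "?dc / t * (sqrt (2 * t) * heat_moment TYPE('a)) \<le>
      2 * ?dc * heat_moment TYPE('a) * t powr (- 1 / 2)"
      by (simp add: mult_ac)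
  qed
  finally show ?thesis .
qed

lemma integrable_dheat: "0 < t \<Longrightarrow> integrable lborel (\<lambda>x::'a::euclidean_space. dheat t x)"
  by (intro integrableI_bounded) (auto intro: le_less_trans[OF nn_integral_dheat])

text \<open>Both sides are time derivatives of the two sides of the semigroup law. For
  \<open>r\<close> within \<open>t / 2\<close> of \<open>t\<close> the sup bound on
  \<open>dheat r\<close> is uniform, so a multiple of \<open>heat s\<close> dominates.\<close>

lemma dheat_convolve_heat:
  fixes x :: "'a::euclidean_space"
  assumes "0 < t" "0 < s"
  shows "(LINT y|lborel. dheat t (x - y) * heat s y) = heat_mass TYPE('a) * dheat (t + s) x"
proof -
  let ?D = "real DIM('a)" and ?dc = "dheat_const TYPE('a)" and ?Z = "heat_mass TYPE('a)"
  have "((\<lambda>r. LINT y|lborel. heat r (x - y) * heat s y) has_real_derivative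
     (LINT y|lborel. dheat t (x - y) * heat s y)) (at t)"
  proof (rule deriv_under_integral[where \<delta>="t / 2" and g="\<lambda>y. ?dc * (t / 2) powr (- 1 - ?D / 2) * heat s y"])
    fix r y assume r: "\<bar>r - t\<bar> < t / 2"
    then have "r > t / 2" "r > 0" using assms by linarith+
    show "((\<lambda>r. heat r (x - y) * heat s y) has_real_derivative dheat r (x - y) * heat s y) (at r)"
      using heat_has_derivative[OF \<open>r > 0\<close>, of "x - y"] by (auto intro!: derivative_eq_intros)
    have "\<bar>dheat r (x - y)\<bar> \<le> ?dc * r powr (- 1 - ?D / 2)"
      by (rule dheat_le) fact
    also have "\<dots> \<le> ?dc * (t / 2) powr (- 1 - ?D / 2)"
      using \<open>r > t / 2\<close> assms dheat_const_pos[where 'a='a] by (intro mult_left_mono powr_mono2') auto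
    finally show "\<bar>dheat r (x - y) * heat s y\<bar> \<le> ?dc * (t / 2) powr (- 1 - ?D / 2) * heat s y"
      by (simp add: abs_mult mult_right_mono)
  next
    fix r assume "\<bar>r - t\<bar> < t / 2"
    then have "0 < r" by linarith
    then show "integrable lborel (\<lambda>y. heat r (x - y) * heat s y)"
      using assms by (intro heat_semigroup)
  qed (use assms in \<open>auto intro!: integrable_heat\<close>)
  moreover have "((\<lambda>r. ?Z * heat (r + s) x) has_real_derivative ?Z * dheat (t + s) x) (at t)"
    using DERIV_shift[THEN iffD1, OF heat_has_derivative[of "t + s" x]] assms
    by (auto intro!: DERIV_cmult)
  then have "((\<lambda>r. LINT y|lborel. heat r (x - y) * heat s y) has_real_derivative ?Z * dheat (t + s) x) (at t)"
    by (rule has_field_derivative_transform_within_open[of _ _ _ "{0<..}"])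
      (use assms in \<open>auto simp: heat_semigroup\<close>)
  ultimately show ?thesis
    by (rule DERIV_unique)
qed

text \<open>The mass of \<open>heat t\<close> does not depend on \<open>t\<close>. This cancellation
  is what lets the flow of a function be estimated through its displacements at small times.\<close>

lemma integral_dheat:
  assumes "0 < t"
  shows "(LINT y|lborel. dheat t (y::'a::euclidean_space)) = 0"
proof -
  let ?D = "real DIM('a)" and ?dc = "dheat_const TYPE('a)"
  have "((\<lambda>r. LINT y|lborel. heat r (y::'a)) has_real_derivative (LINT y|lborel. dheat t (y::'a))) (at t)"
  \<comment> \<open>A constant majorant is not integrable in \<open>y\<close>. Since
    \<open>2 * r < 3 * t\<close> in this window, all Gaussians at time \<open>2 * r\<close> lie
    below a multiple of the one at time \<open>3 * t\<close>.\<close>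
  proof (rule deriv_under_integral[where \<delta>="t / 2" and
      g="\<lambda>y. ?dc * (t / 2) powr (- 1 - ?D / 2) * (3 * t) powr (?D / 2) * heat (3 * t) y"])
    fix r and y :: 'a assume r: "\<bar>r - t\<bar> < t / 2"
    then have r: "r > t / 2" "r > 0" "2 * r < 3 * t" using assms by linarith+
    show "((\<lambda>r. heat r y) has_real_derivative dheat r y) (at r)"
      by (rule heat_has_derivative) fact
    have "\<bar>dheat r y\<bar> \<le> ?dc / r * ((2 * r) powr (- ?D / 2) * exp (- (norm y)\<^sup>2 / (2 * r)))"
      using dheat_bound[OF \<open>r > 0\<close>, of y] by (simp add: heat_def)
    also have "\<dots> \<le> ?dc / r * (r powr (- ?D / 2) * exp (- (norm y)\<^sup>2 / (3 * t)))"
      using r assms dheat_const_pos[where 'a='a]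
      by (intro mult_left_mono mult_mono powr_mono2' order_refl) (auto intro!: divide_left_mono)
    also have "\<dots> = ?dc * r powr (- 1 - ?D / 2) * exp (- (norm y)\<^sup>2 / (3 * t))"
      using r powr_add[of r "- 1" "- ?D / 2"] by (simp add: powr_minus field_simps)
    also have "\<dots> \<le> ?dc * (t / 2) powr (- 1 - ?D / 2) * exp (- (norm y)\<^sup>2 / (3 * t))"
      using r assms dheat_const_pos[where 'a='a] by (intro mult_left_mono mult_right_mono powr_mono2') auto
    also have "\<dots> = ?dc * (t / 2) powr (- 1 - ?D / 2) * (3 * t) powr (?D / 2) * heat (3 * t) y"
      using assms by (simp add: heat_def powr_minus field_simps)
    finally show "\<bar>dheat r y\<bar> \<le> \<dots>" .
  next
    fix r assume "\<bar>r - t\<bar> < t / 2"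
    then have "0 < r" by linarith
    then show "integrable lborel (heat r :: 'a \<Rightarrow> real)"
      by (intro integrable_heat)
  qed (use assms in \<open>auto intro!: integrable_heat\<close>)
  moreover have "((\<lambda>r. LINT y|lborel. heat r (y::'a)) has_real_derivative 0) (at t)"
    by (rule has_field_derivative_transform_within_open[OF DERIV_const[of "heat_mass TYPE('a)"], of "{0<..}"])
      (use assms in \<open>auto simp: integral_heat\<close>)
  ultimately show ?thesis
    by (rule DERIV_unique)
qed

subsection \<open>Mellin integrals in the time variable\<close>

abbreviation pos_ind :: "real \<Rightarrow> 'b::zero_neq_one" where
  "pos_ind \<equiv> indicator {0<..}"

text \<open>The maximum is attained at \<open>y = \<gamma>\<close>; its value
  \<open>\<gamma> powr \<gamma> * exp (- \<gamma>)\<close> is weakened by dropping the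
  exponential.\<close>

lemma powr_exp_le:
  fixes y \<gamma> :: real
  assumes "0 < \<gamma>" "0 < y"
  shows "y powr \<gamma> * exp (- y) \<le> \<gamma> powr \<gamma>"
proof -
  have "ln (y / \<gamma>) \<le> y / \<gamma> - 1"
    using assms by (intro ln_le_minus_one) auto
  then have "\<gamma> * ln (y / \<gamma>) \<le> \<gamma> * (y / \<gamma> - 1)"
    using assms by (intro mult_left_mono) auto
  then have "\<gamma> * (ln y - ln \<gamma>) \<le> y - \<gamma>"
    using assms by (simp add: ln_div algebra_simps)
  then have "exp (\<gamma> * ln y) * exp (- y) \<le> exp (\<gamma> * ln \<gamma>)"
    using assms by (simp add: algebra_simps flip: exp_add)
  then show ?thesis
    using assms by (simp add: powr_def mult.commute)
qed

text \<open>A bound uniform in time away from the origin. It controls the Mellin integrals near time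
  0, where \<open>heat_le\<close> blows up.\<close>

lemma heat_le_norm:
  fixes z :: "'a::euclidean_space"
  assumes "z \<noteq> 0" "0 < t"
  shows "heat t z \<le> (real DIM('a) / 2) powr (real DIM('a) / 2) * norm z powr (- real DIM('a))"
proof -
  let ?D = "real DIM('a)"
  let ?y = "(norm z)\<^sup>2 / t" and ?\<gamma> = "?D / 2"
  have y: "0 < ?y" using assms by auto
  have "((norm z)\<^sup>2) powr ?\<gamma> = norm z powr ?D"
    using powr_powr[of "norm z" 2 ?\<gamma>] by simp
  then have "heat t z = norm z powr (- ?D) * (?y powr ?\<gamma> * exp (- ?y))"
    using assms by (simp add: heat_def powr_divide powr_minus field_simps)
  also have "\<dots> \<le> norm z powr (- ?D) * (?\<gamma> powr ?\<gamma>)"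
    using y by (intro mult_left_mono powr_exp_le) auto
  finally show ?thesis by (simp add: mult.commute)
qed

lemma nn_integral_powr_Ioc:
  assumes "- 1 < c" "0 \<le> T"
  shows "(\<integral>\<^sup>+t\<in>{0<..T}. ennreal (t powr c) \<partial>lborel) = ennreal (T powr (c + 1) / (c + 1))"
proof -
  have "(\<integral>\<^sup>+t\<in>{0<..T}. ennreal (t powr c) \<partial>lborel) = (\<integral>\<^sup>+t. ennreal (t powr c) * indicator {0..T} t \<partial>lborel)"
    by (intro nn_integral_cong) (auto simp: indicator_def)
  also have "\<dots> = ennreal (T powr (c + 1) / (c + 1))"
    using assms by (intro nn_integral_has_integral_lebesgue' has_integral_powr_from_0) auto
  finally show ?thesis .
qed

lemma nn_integral_powr_Ioi:
  assumes "c < - 1" "0 < T"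
  shows "(\<integral>\<^sup>+t\<in>{T<..}. ennreal (t powr c) \<partial>lborel) = ennreal (T powr (c + 1) / (- c - 1))"
proof -
  have "(\<integral>\<^sup>+t\<in>{T<..}. ennreal (t powr c) \<partial>lborel) = (\<integral>\<^sup>+t. ennreal (t powr c) * indicator {T..} t \<partial>lborel)"
    by (intro nn_integral_cong_AE) (use AE_lborel_singleton[of T] in \<open>auto simp: indicator_def\<close>)
  also have "\<dots> = ennreal (- (T powr (c + 1)) / (c + 1))"
    using assms by (intro nn_integral_has_integral_lebesgue' has_integral_powr_to_inf) auto
  also have "- (T powr (c + 1)) / (c + 1) = T powr (c + 1) / (- c - 1)"
    using minus_divide_right[of "T powr (c + 1)" "c + 1"] by (simp add: algebra_simps)
  finally show ?thesis .
qed

abbreviation time_int :: "(real \<Rightarrow> ennreal) \<Rightarrow> ennreal" where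
  "time_int F \<equiv> \<integral>\<^sup>+t\<in>{0<..}. F t \<partial>lborel"

lemma nn_integral_mellin_finite:
  assumes "- 1 < c" "c - e < - 1"
    and "\<And>t. 0 < t \<Longrightarrow> g t \<le> A" "\<And>t. 0 < t \<Longrightarrow> g t \<le> B * t powr (- e)"
  shows "time_int (\<lambda>t. ennreal (t powr c * g t)) < \<infinity>"
proof -
  have "time_int (\<lambda>t. ennreal (t powr c * g t)) \<le>
    (\<integral>\<^sup>+t. ennreal \<bar>A\<bar> * (ennreal (t powr c) * indicator {0<..1} t) + 
           ennreal \<bar>B\<bar> * (ennreal (t powr (c - e)) * indicator {1<..} t) \<partial>lborel)"
  proof (intro nn_integral_mono)
    fix t :: real
    consider "t \<le> 0" | "0 < t" "t \<le> 1" | "1 < t" by linarith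
    then show "ennreal (t powr c * g t) * pos_ind t \<le>
      ennreal \<bar>A\<bar> * (ennreal (t powr c) * indicator {0<..1} t) + 
      ennreal \<bar>B\<bar> * (ennreal (t powr (c - e)) * indicator {1<..} t)"
    proof cases
      case 2
      then have "t powr c * g t \<le> t powr c * \<bar>A\<bar>"
        using assms(3)[of t] by (intro mult_left_mono) auto
      with 2 show ?thesis by (simp add: ennreal_mult[symmetric] mult.commute)
    next
      case 3
      then have "t powr c * g t \<le> t powr c * (\<bar>B\<bar> * t powr (- e))"
        using assms(4)[of t] abs_ge_self[of B] by (intro mult_left_mono order_trans[OF assms(4)] mult_right_mono) auto
      also have "\<dots> = \<bar>B\<bar> * t powr (c - e)"
        using 3 by (simp add: powr_diff powr_minus divide_inverse)
      finally show ?thesis using 3 by (simp add: ennreal_mult[symmetric])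
    qed simp
  qed
  also have "\<dots> = ennreal \<bar>A\<bar> * ennreal (1 powr (c + 1) / (c + 1)) + ennreal \<bar>B\<bar> * ennreal (1 powr (c - e + 1) / (- (c - e) - 1))"
    using assms(1,2) by (subst nn_integral_add)
      (auto simp: nn_integral_cmult nn_integral_powr_Ioc nn_integral_powr_Ioi simp del: powr_one_eq_one)
  also have "\<dots> < \<infinity>"
    by (simp add: ennreal_mult_less_top)
  finally show ?thesis .
qed

text \<open>For \<open>\<beta> < D / 2\<close> the substitution of \<open>1 / t\<close> for
  \<open>t\<close> identifies this integral with \<open>Gamma (D / 2 - \<beta>)\<close>.\<close>

definition mellin_heat :: "'a::euclidean_space itself \<Rightarrow> real \<Rightarrow> real" where
  "mellin_heat _ \<beta> = (LINT t|lborel. pos_ind t * (t powr (\<beta> - 1 - real DIM('a) / 2) * exp (- 1 / t)))"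

text \<open>Subordination: the Riesz kernel of order \<open>2 * \<beta>\<close> is a superposition
  of heat kernels. Replacing \<open>t\<close> by \<open>(norm z)^2 * t\<close> pulls out the power
  of the norm and leaves an integral independent of \<open>z\<close>.\<close>

lemma nn_integral_mellin_heat:
  fixes z :: "'a::euclidean_space"
  assumes "0 < \<beta>" "\<beta> < real DIM('a) / 2" "z \<noteq> 0"
  shows "time_int (\<lambda>t. ennreal (t powr (\<beta> - 1) * heat t z)) =
    ennreal (mellin_heat TYPE('a) \<beta> * norm z powr (2 * \<beta> - real DIM('a)))"
proof -
  let ?D = "real DIM('a)"
  let ?h = "\<lambda>t. t powr (\<beta> - 1 - ?D / 2) * exp (- 1 / t)"
  have scale: "time_int (\<lambda>t. ennreal (t powr (\<beta> - 1) * heat t z)) =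
    ennreal (norm z powr (2 * \<beta> - ?D)) *
    time_int (\<lambda>t. ennreal (?h t))"
    if "z \<noteq> 0" for z :: 'a
  proof -
    define r where "r = norm z"
    have "0 < r" using that by (simp add: r_def)
    have "time_int (\<lambda>t. ennreal (t powr (\<beta> - 1) * heat t z)) =
       ennreal \<bar>r\<^sup>2\<bar> * (\<integral>\<^sup>+t. ennreal ((0 + r\<^sup>2 * t) powr (\<beta> - 1) * heat (0 + r\<^sup>2 * t) z) * pos_ind (0 + r\<^sup>2 * t) \<partial>lborel)"
      using \<open>0 < r\<close> by (intro nn_integral_real_affine) auto
    also have "\<dots> = (\<integral>\<^sup>+t. ennreal \<bar>r\<^sup>2\<bar> * (ennreal ((0 + r\<^sup>2 * t) powr (\<beta> - 1) * heat (0 + r\<^sup>2 * t) z) * pos_ind (0 + r\<^sup>2 * t)) \<partial>lborel)"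
      by (intro nn_integral_cmult[symmetric]) measurable
    also have "\<dots> = (\<integral>\<^sup>+t. ennreal (r powr (2 * \<beta> - ?D)) *
      (ennreal (?h t) * pos_ind t) \<partial>lborel)"
    proof (intro nn_integral_cong)
      fix t :: real
      show "ennreal \<bar>r\<^sup>2\<bar> * (ennreal ((0 + r\<^sup>2 * t) powr (\<beta> - 1) * heat (0 + r\<^sup>2 * t) z) * pos_ind (0 + r\<^sup>2 * t)) =
        ennreal (r powr (2 * \<beta> - ?D)) * (ennreal (?h t) * pos_ind t)"
      proof (cases "0 < t")
        case True
        have sq: "(r\<^sup>2) powr c = r powr (2 * c)" for c
          using \<open>0 < r\<close> powr_powr[of r 2 c] by simp
        have "r\<^sup>2 * ((r\<^sup>2 * t) powr (\<beta> - 1) * heat (r\<^sup>2 * t) z) =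
          (r powr 2 * r powr (2 * (\<beta> - 1)) * r powr (2 * (- ?D / 2))) *
          ((t powr (\<beta> - 1) * t powr (- ?D / 2)) * exp (- 1 / t))"
          using True \<open>0 < r\<close> by (simp add: heat_def r_def[symmetric] powr_mult sq mult_ac powr_numeral)
        also have "\<dots> = r powr (2 * \<beta> - ?D) * (?h t)"
          unfolding powr_add[symmetric] by (simp add: algebra_simps)
        finally show ?thesis
          using True \<open>0 < r\<close> by (simp add: ennreal_mult'[symmetric])
      qed (use \<open>0 < r\<close> in \<open>auto simp: zero_less_mult_iff indicator_def\<close>)
    qed
    also have "\<dots> = ennreal (r powr (2 * \<beta> - ?D)) *
      time_int (\<lambda>t. ennreal (?h t))"
      by (intro nn_integral_cmult) measurable
    finally show ?thesis by (simp add: r_def)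
  qed
  \<comment> \<open>Finiteness is read backwards: the left-hand side of the scaling identity is
    finite by the two bounds on \<open>heat\<close>, and the factor pulled out is positive, so the
    constant is finite.\<close>
  have "time_int (\<lambda>t. ennreal (t powr (\<beta> - 1) * heat t z)) < \<infinity>"
    using assms heat_le heat_le_norm[OF \<open>z \<noteq> 0\<close>]
    by (intro nn_integral_mellin_finite[where e="?D / 2" and B=1]) auto
  with scale[OF \<open>z \<noteq> 0\<close>] \<open>z \<noteq> 0\<close>
  have fin: "time_int (\<lambda>t. ennreal (?h t)) < \<infinity>"
    by (auto simp: ennreal_mult_less_top)
  have "ennreal (mellin_heat TYPE('a) \<beta>) =
    (\<integral>\<^sup>+t. ennreal (pos_ind t * (?h t)) \<partial>lborel)"
    unfolding mellin_heat_def
  proof (intro nn_integral_eq_integral[symmetric] integrableI_bounded)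
    show "(\<integral>\<^sup>+t. ennreal (norm (pos_ind t * (?h t))) \<partial>lborel) < \<infinity>"
      by (rule le_less_trans[OF nn_integral_mono fin]) (auto simp: indicator_def)
  qed auto
  also have "\<dots> = time_int (\<lambda>t. ennreal (?h t))"
    by (intro nn_integral_cong) (auto simp: indicator_def)
  finally show ?thesis
    using scale[OF \<open>z \<noteq> 0\<close>] by (simp add: ennreal_mult'' mult.commute)
qed

lemma mellin_heat_pos:
  assumes "0 < \<beta>" "\<beta> < real DIM('a::euclidean_space) / 2"
  shows "0 < mellin_heat TYPE('a) \<beta>"
proof (rule ccontr)
  obtain z :: 'a where "z \<noteq> 0" using nonempty_Basis by (metis all_not_in_conv nonzero_Basis)
  assume "\<not> ?thesis"
  then have "ennreal (mellin_heat TYPE('a) \<beta> * norm z powr (2 * \<beta> - real DIM('a))) = 0"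
    by (intro ennreal_neg) (simp add: mult_le_0_iff)
  then have "time_int (\<lambda>t. ennreal (t powr (\<beta> - 1) * heat t z)) = 0"
    using nn_integral_mellin_heat[OF assms \<open>z \<noteq> 0\<close>] by simp
  then have "AE t in lborel. ennreal (t powr (\<beta> - 1) * heat t z) * pos_ind t = 0"
    by (subst (asm) nn_integral_0_iff_AE) auto
  then have "AE t in lborel. t \<notin> {0<..1::real}"
    by eventually_elim
      (auto simp: indicator_def ennreal_eq_0_iff mult_le_0_iff heat_pos[THEN not_le[THEN iffD2]])
  then have "emeasure lborel {x::real. 0 < x \<and> x \<le> 1} = 0"
    by (subst (asm) AE_iff_measurable[OF _ refl]) auto
  moreover have "{x::real. 0 < x \<and> x \<le> 1} = {0<..1}" by auto
  ultimately show False by simp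
qed

text \<open>Integration by parts in time. The boundary terms of
  \<open>t powr \<beta> * heat t z\<close> vanish, at 0 because \<open>heat t z\<close> stays
  bounded for \<open>z \<noteq> 0\<close> and at infinity because
  \<open>\<beta> < D / 2\<close>.\<close>

lemma mellin_dheat:
  fixes z :: "'a::euclidean_space"
  assumes "0 < \<beta>" "\<beta> < real DIM('a) / 2" "z \<noteq> 0"
  shows "(LINT t|lborel. pos_ind t * (t powr \<beta> * dheat t z)) =
     - \<beta> * mellin_heat TYPE('a) \<beta> * norm z powr (2 * \<beta> - real DIM('a))" (is ?eq)
    and "integrable lborel (\<lambda>t. pos_ind t * (t powr \<beta> * dheat t z))" (is ?int)
proof -
  let ?dc = "dheat_const TYPE('a)" and ?\<kappa> = "mellin_heat TYPE('a) \<beta>"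
  let ?D = "real DIM('a)"
  let ?C = "(?D / 2) powr (?D / 2) * norm z powr (- ?D)"
  have tp: "t powr \<beta> = t powr (\<beta> - 1) * t" if "0 < t" for t
    using that powr_add[of t "\<beta> - 1" 1] by simp
  have dh: "t * \<bar>dheat t z\<bar> \<le> ?dc * heat (2 * t) z" if "0 < t" for t
    using dheat_bound[OF that, of z] that by (simp add: field_simps)
  show i1: ?int
  proof (rule integrableI_bounded)
    have "(\<integral>\<^sup>+t. ennreal (norm (pos_ind t * (t powr \<beta> * dheat t z))) \<partial>lborel) =
      time_int (\<lambda>t. ennreal (t powr (\<beta> - 1) * (t * \<bar>dheat t z\<bar>)))"
      by (intro nn_integral_cong) (auto simp: indicator_def abs_mult tp mult_ac)
    also have "\<dots> < \<infinity>"
    proof (rule nn_integral_mellin_finite[where e="?D / 2" and B="?dc" and A="?dc * ?C"])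
      fix t :: real assume "0 < t"
      then show "t * \<bar>dheat t z\<bar> \<le> ?dc * ?C"
        using dh[of t] heat_le_norm[of z "2 * t"] \<open>z \<noteq> 0\<close> dheat_const_pos[where 'a='a]
        by (intro order_trans[OF dh] mult_left_mono) auto
      show "t * \<bar>dheat t z\<bar> \<le> ?dc * t powr - (?D / 2)"
      proof -
        have "t * \<bar>dheat t z\<bar> \<le> t powr 1 * (?dc * t powr (- 1 - ?D / 2))"
          using \<open>0 < t\<close> dheat_le[OF \<open>0 < t\<close>, of z] by simp
        also have "\<dots> = ?dc * t powr - (?D / 2)"
          by (simp only: mult.left_commute powr_add[symmetric]) simp
        finally show ?thesis .
      qed
    qed (use assms in auto)
    finally show "(\<integral>\<^sup>+t. ennreal (norm (pos_ind t * (t powr \<beta> * dheat t z))) \<partial>lborel) < \<infinity>" .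
  qed measurable
  have i2: "has_bochner_integral lborel (\<lambda>t. pos_ind t * (t powr (\<beta> - 1) * heat t z))
    (?\<kappa> * norm z powr (2 * \<beta> - ?D))"
  proof (rule has_bochner_integral_nn_integral)
    show "(\<integral>\<^sup>+t. ennreal (pos_ind t * (t powr (\<beta> - 1) * heat t z)) \<partial>lborel) =
      ennreal (?\<kappa> * norm z powr (2 * \<beta> - ?D))"
      unfolding nn_integral_mellin_heat[OF assms, symmetric]
      by (intro nn_integral_cong) (auto simp: indicator_def)
  qed (use mellin_heat_pos[OF assms(1,2)] in auto)
  let ?F = "\<lambda>t. t powr \<beta> * heat t z"
  let ?f = "\<lambda>t. \<beta> * (t powr (\<beta> - 1) * heat t z) + t powr \<beta> * dheat t z"
  have "integrable lborel (\<lambda>t. \<beta> * (pos_ind t * (t powr (\<beta> - 1) * heat t z)) + pos_ind t * (t powr \<beta> * dheat t z))"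
    using i1 i2 by (auto simp: has_bochner_integral_iff)
  then have si: "set_integrable lborel {0<..} ?f"
    unfolding set_integrable_def by (rule Bochner_Integration.integrable_cong[THEN iffD1, rotated -1]) (auto simp: algebra_simps)
  have "(LBINT t=0..\<infinity>. ?f t) = 0 - 0"
  proof (rule interval_integral_FTC_integrable[where F="?F"])
    fix t assume "(0::ereal) < ereal t"
    then have t: "0 < t" by (simp add: zero_ereal_def)
    show "(?F has_vector_derivative ?f t) (at t)"
      using t heat_has_derivative[OF t, of z]
      by (auto intro!: derivative_eq_intros simp: has_real_derivative_iff_has_vector_derivative[symmetric])
    show "isCont ?f t"
      unfolding dheat_def heat_def using t by (intro continuous_intros) auto
  next
    show "set_integrable lborel (einterval 0 \<infinity>) ?f"
      using si by (simp add: einterval_def zero_ereal_def greaterThan_def)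
    have "((\<lambda>t. t powr \<beta> * heat t z) \<longlongrightarrow> 0) (at_right 0)"
    proof (rule real_tendsto_sandwich[OF _ _ tendsto_const])
      show "\<forall>\<^sub>F t in at_right 0. t powr \<beta> * heat t z \<le> t powr \<beta> * ?C"
        using eventually_at_right_less[of 0]
        by eventually_elim (use heat_le_norm[OF \<open>z \<noteq> 0\<close>] in \<open>auto intro!: mult_left_mono\<close>)
      have "((\<lambda>t. t powr \<beta> * ?C) \<longlongrightarrow> 0 powr \<beta> * ?C) (at_right 0)"
        using assms(1) by (intro tendsto_intros tendsto_powr') (auto simp: eventually_at_filter)
      then show "((\<lambda>t. t powr \<beta> * ?C) \<longlongrightarrow> 0) (at_right 0)"
        by simp
    qed auto
    then show "((?F \<circ> real_of_ereal) \<longlongrightarrow> 0) (at_right 0)"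
      by (simp add: zero_ereal_def ereal_tendsto_simps1)
    have "((\<lambda>t. t powr \<beta> * heat t z) \<longlongrightarrow> 0) at_top"
    proof (rule real_tendsto_sandwich[OF _ _ tendsto_const])
      show "\<forall>\<^sub>F t in at_top. t powr \<beta> * heat t z \<le> t powr (\<beta> - ?D / 2)"
        using eventually_gt_at_top[of 0]
      proof eventually_elim
        case (elim t)
        then have "t powr \<beta> * heat t z \<le> t powr \<beta> * t powr (- ?D / 2)"
          by (intro mult_left_mono heat_le) auto
        then show ?case by (simp add: powr_add[symmetric])
      qed
      show "((\<lambda>t. t powr (\<beta> - ?D / 2)) \<longlongrightarrow> 0) at_top"
        using assms by (intro tendsto_neg_powr filterlim_ident) auto
    qed auto
    then show "((?F \<circ> real_of_ereal) \<longlongrightarrow> 0) (at_left \<infinity>)"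
      by (simp add: ereal_tendsto_simps1)
  qed (simp add: zero_ereal_def)
  also have "(LBINT t=0..\<infinity>. ?f t) = (LINT t|lborel. \<beta> * (pos_ind t * (t powr (\<beta> - 1) * heat t z)) + pos_ind t * (t powr \<beta> * dheat t z))"
    by (simp add: interval_lebesgue_integral_def set_lebesgue_integral_def einterval_def zero_ereal_def
        greaterThan_def algebra_simps)
  also have "\<dots> = \<beta> * (?\<kappa> * norm z powr (2 * \<beta> - ?D)) + (LINT t|lborel. pos_ind t * (t powr \<beta> * dheat t z))"
    using i1 i2 by (subst Bochner_Integration.integral_add) (auto simp: has_bochner_integral_iff)
  finally show ?eq by simp
qed

lemma fubini_real:
  fixes f :: "'a::euclidean_space \<Rightarrow> 'b::euclidean_space \<Rightarrow> real"
  assumes [measurable]: "case_prod f \<in> borel_measurable (lborel \<Otimes>\<^sub>M lborel)"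
    and fin: "(\<integral>\<^sup>+y. \<integral>\<^sup>+x. ennreal \<bar>f x y\<bar> \<partial>lborel \<partial>lborel) < \<infinity>"
  shows "(LINT x|lborel. LINT y|lborel. f x y) = (LINT y|lborel. LINT x|lborel. f x y)"
proof -
  have "(\<integral>\<^sup>+p. ennreal (norm (case_prod f p)) \<partial>(lborel \<Otimes>\<^sub>M lborel)) = (\<integral>\<^sup>+y. \<integral>\<^sup>+x. ennreal \<bar>f x y\<bar> \<partial>lborel \<partial>lborel)"
    by (subst lborel_pair.nn_integral_snd[symmetric]) auto
  with fin have int: "integrable (lborel \<Otimes>\<^sub>M lborel) (case_prod f)"
    by (intro integrableI_bounded) auto
  show ?thesis
    using lborel_pair.Fubini_integral[OF int] by simp
qed

subsection \<open>Riesz potentials through the heat kernel\<close>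

definition conv :: "('a::euclidean_space \<Rightarrow> real) \<Rightarrow> ('a \<Rightarrow> real) \<Rightarrow> 'a \<Rightarrow> real" where
  "conv k f x = (LINT y|lborel. k (x - y) * f y)"

lemma abs_integral_le_nn_integral: "ennreal \<bar>LINT x|M. f x\<bar> \<le> (\<integral>\<^sup>+x. ennreal \<bar>f x\<bar> \<partial>M)" for f :: "'b \<Rightarrow> real"
  using integral_norm_bound_ennreal[of M f] by (cases "integrable M f") (auto simp: not_integrable_integral_eq)

lemma abs_integral_leI:
  fixes f :: "'b \<Rightarrow> real"
  assumes "(\<integral>\<^sup>+x. ennreal \<bar>f x\<bar> \<partial>M) \<le> ennreal B" "0 \<le> B"
  shows "\<bar>LINT x|M. f x\<bar> \<le> B"
  using order_trans[OF abs_integral_le_nn_integral assms(1)] assms(2) by simp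

text \<open>Together with \<open>nn_conv_le_L1\<close> these are the two endpoint cases of Young's
  inequality for the sup norm. Bounding the integral of the absolute integrand also certifies
  absolute convergence, as Fubini requires.\<close>

lemma nn_conv_le_sup:
  fixes k f :: "'a::euclidean_space \<Rightarrow> real"
  assumes [measurable]: "k \<in> borel_measurable borel" "f \<in> borel_measurable borel"
    and "\<And>y. \<bar>f y\<bar> \<le> M" "L1_norm k \<le> ennreal K" "0 \<le> K"
  shows "L1_norm (\<lambda>y. k (x - y) * f y) \<le> ennreal (K * M)"
proof -
  have "0 \<le> M" using assms(3)[of undefined] by linarith
  have "L1_norm (\<lambda>y. k (x - y) * f y) \<le> (\<integral>\<^sup>+y. ennreal \<bar>k (x - y)\<bar> * ennreal M \<partial>lborel)"
    using assms(3) \<open>0 \<le> M\<close> by (intro nn_integral_mono) (simp add: abs_mult ennreal_mult'[symmetric] mult_left_mono)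
  also have "\<dots> = L1_norm k * ennreal M"
    using nn_integral_lborel_reflect[of "\<lambda>y. ennreal \<bar>k y\<bar>" x] by (simp add: nn_integral_multc)
  also have "\<dots> \<le> ennreal K * ennreal M"
    by (intro mult_right_mono assms) auto
  finally show ?thesis using \<open>0 \<le> M\<close> \<open>0 \<le> K\<close> by (simp add: ennreal_mult)
qed

lemma nn_conv_le_L1:
  fixes k f :: "'a::euclidean_space \<Rightarrow> real"
  assumes [measurable]: "f \<in> borel_measurable borel"
    and "\<And>y. \<bar>k y\<bar> \<le> K" "L1_norm f \<le> ennreal U" "0 \<le> U"
  shows "L1_norm (\<lambda>y. k (x - y) * f y) \<le> ennreal (K * U)"
proof -
  have "0 \<le> K" using assms(2)[of undefined] by linarith
  have "L1_norm (\<lambda>y. k (x - y) * f y) \<le> (\<integral>\<^sup>+y. ennreal K * ennreal \<bar>f y\<bar> \<partial>lborel)"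
    using assms(2) \<open>0 \<le> K\<close> by (intro nn_integral_mono) (simp add: abs_mult ennreal_mult'[symmetric] mult_right_mono)
  also have "\<dots> \<le> ennreal K * ennreal U"
    using assms(3) by (simp add: nn_integral_cmult mult_left_mono)
  finally show ?thesis using \<open>0 \<le> K\<close> \<open>0 \<le> U\<close> by (simp add: ennreal_mult)
qed

text \<open>The Beta integral rescaled from the unit interval to length \<tau>. The two indicators
  encode \<open>0 < t < \<tau>\<close> as a product, so that the same expression can be read as a
  function of \<tau> for fixed \<open>t\<close>.\<close>

lemma has_bochner_integral_Beta:
  fixes a b \<tau> :: real
  assumes "0 < a" "0 < b" "0 < \<tau>"
  shows "has_bochner_integral lborel
    (\<lambda>t. pos_ind t * t powr (a - 1) * (pos_ind (\<tau> - t) * (\<tau> - t) powr (b - 1)))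
    (Beta a b * \<tau> powr (a + b - 1))"
proof (rule has_bochner_integral_nn_integral)
  have nonneg: "0 \<le> Beta a b"
    using has_integral_nonneg[OF has_integral_Beta_real[OF assms(1,2)]] by auto
  let ?f = "\<lambda>t. ennreal (pos_ind t * t powr (a - 1) * (pos_ind (\<tau> - t) * (\<tau> - t) powr (b - 1)))"
  have "integral\<^sup>N lborel ?f = ennreal \<bar>\<tau>\<bar> * (\<integral>\<^sup>+t. ?f (0 + \<tau> * t) \<partial>lborel)"
    using assms by (intro nn_integral_real_affine) auto
  also have "\<dots> = ennreal \<bar>\<tau>\<bar> * (\<integral>\<^sup>+t. ennreal (\<tau> powr (a + b - 2)) * (ennreal (t powr (a - 1) * (1 - t) powr (b - 1)) * indicator {0..1} t) \<partial>lborel)"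
  proof (intro arg_cong2[where f="(*)"] refl nn_integral_cong_AE)
    show "AE t in lborel. ?f (0 + \<tau> * t) = ennreal (\<tau> powr (a + b - 2)) * (ennreal (t powr (a - 1) * (1 - t) powr (b - 1)) * indicator {0..1} t)"
      using AE_lborel_singleton[of 0] AE_lborel_singleton[of 1]
    proof eventually_elim
      case (elim t)
      show ?case
      proof (cases "0 < t \<and> t < 1")
        case True
        then have "(\<tau> * t) powr (a - 1) * (\<tau> - \<tau> * t) powr (b - 1) =
          (\<tau> powr (a - 1) * \<tau> powr (b - 1)) * (t powr (a - 1) * (1 - t) powr (b - 1))"
          using assms powr_mult[of \<tau> "1 - t" "b - 1"] by (simp add: powr_mult algebra_simps)
        also have "\<tau> powr (a - 1) * \<tau> powr (b - 1) = \<tau> powr (a + b - 2)"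
          by (simp add: powr_add[symmetric] algebra_simps)
        finally show ?thesis
          using True assms by (simp add: ennreal_mult'[symmetric])
      next
        case False
        then have "\<not> (0 < \<tau> * t \<and> 0 < \<tau> - \<tau> * t)"
          using assms by (auto simp: zero_less_mult_iff)
        with False elim show ?thesis by (auto simp: indicator_def)
      qed
    qed
  qed
  also have "\<dots> = ennreal \<bar>\<tau>\<bar> * (ennreal (\<tau> powr (a + b - 2)) * ennreal (Beta a b))"
    using assms nn_integral_has_integral_lebesgue'[OF _ has_integral_Beta_real[of a b]]
    by (subst nn_integral_cmult) auto
  also have "\<dots> = ennreal (Beta a b * \<tau> powr (a + b - 1))"
    using assms powr_add[of \<tau> 1 "a + b - 2"] nonneg
    by (simp add: ennreal_mult'[symmetric] ennreal_mult''[symmetric] algebra_simps)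
  finally show "integral\<^sup>N lborel ?f = ennreal (Beta a b * \<tau> powr (a + b - 1))" .
  show "0 \<le> Beta a b * \<tau> powr (a + b - 1)"
    using nonneg by simp
qed auto

section \<open>Potentials of a bounded integrable function as time integrals\<close>

locale bounded_integrable =
  fixes u :: "'a::euclidean_space \<Rightarrow> real" and M :: real
  assumes measurable_u [measurable]: "u \<in> borel_measurable borel"
    and bound_u: "\<And>y. \<bar>u y\<bar> \<le> M"
    and integrable_u: "integrable lborel u"
begin

definition U :: real where "U = (LINT y|lborel. \<bar>u y\<bar>)"

text \<open>The Riesz potential of order \<open>2 * \<beta>\<close> without its normalising
  constant; halving the order makes \<beta> the Mellin exponent in time.\<close>

definition rpot :: "real \<Rightarrow> 'a \<Rightarrow> real" where
  "rpot \<beta> x = (LINT y|lborel. norm (x - y) powr (2 * \<beta> - real DIM('a)) * u y)"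

lemma nn_integral_u: "L1_norm u = ennreal U"
  unfolding U_def using integrable_u by (intro nn_integral_eq_integral) auto

lemma U_nonneg: "0 \<le> U" by (simp add: U_def)

lemma M_nonneg: "0 \<le> M" using bound_u[of undefined] by linarith

abbreviation "heat_u t x \<equiv> L1_norm (\<lambda>y. heat t (x - y) * u y)"

abbreviation "dheat_u t x \<equiv> L1_norm (\<lambda>y. dheat t (x - y) * u y)"

text \<open>The first bound serves small times and the second, with its decay, large times; both are
  uniform in \<open>x\<close>.\<close>

lemma heat_u_le:
  assumes "0 < t"
  shows "heat_u t x \<le> ennreal (heat_mass TYPE('a) * M)"
    and "heat_u t x \<le> ennreal (U * t powr (- (real DIM('a) / 2)))"
proof -
  show "heat_u t x \<le> ennreal (heat_mass TYPE('a) * M)"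
    using assms bound_u heat_mass_nonneg by (intro nn_conv_le_sup) (auto simp: nn_integral_heat)
  show "heat_u t x \<le> ennreal (U * t powr (- (real DIM('a) / 2)))"
    using nn_conv_le_L1[of u "heat t" "t powr (- (real DIM('a) / 2))" U x] assms heat_le[of t, where 'a='a]
    by (simp add: nn_integral_u U_nonneg mult.commute)
qed

lemma dheat_u_le:
  assumes "0 < t"
  shows "dheat_u t x \<le> ennreal (dheat_const TYPE('a) * heat_mass TYPE('a) / t * M)"
    and "dheat_u t x \<le>
      ennreal (dheat_const TYPE('a) * t powr (- 1 - real DIM('a) / 2) * U)"
proof -
  show "dheat_u t x \<le> ennreal (dheat_const TYPE('a) * heat_mass TYPE('a) / t * M)"
    using assms bound_u heat_mass_nonneg[where 'a='a] dheat_const_pos[where 'a='a]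
    by (intro nn_conv_le_sup nn_integral_dheat) auto
  show "dheat_u t x \<le>
      ennreal (dheat_const TYPE('a) * t powr (- 1 - real DIM('a) / 2) * U)"
    using assms by (intro nn_conv_le_L1 dheat_le) (auto simp: nn_integral_u U_nonneg)
qed

lemma enn_mellin_finite:
  assumes "0 < \<beta>" "\<beta> < real DIM('a) / 2"
    and le: "\<And>t. 0 < t \<Longrightarrow> F t \<le> ennreal A" "\<And>t. 0 < t \<Longrightarrow> F t \<le> ennreal (B * t powr (- (real DIM('a) / 2)))"
  shows "time_int (\<lambda>t. ennreal (t powr (\<beta> - 1)) * F t) < \<infinity>"
proof -
  let ?D = "real DIM('a)"
  have "time_int (\<lambda>t. ennreal (t powr (\<beta> - 1)) * F t) \<le>
     time_int (\<lambda>t. ennreal (t powr (\<beta> - 1) * min \<bar>A\<bar> (\<bar>B\<bar> * t powr (- (?D / 2)))))"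
  proof (intro nn_integral_mono)
    fix t :: real
    show "ennreal (t powr (\<beta> - 1)) * F t * pos_ind t \<le>
      ennreal (t powr (\<beta> - 1) * min \<bar>A\<bar> (\<bar>B\<bar> * t powr (- (?D / 2)))) * pos_ind t"
    proof (cases "0 < t")
      case True
      have "F t \<le> ennreal \<bar>A\<bar>"
        using le(1)[OF True] by (rule order_trans) (auto intro!: ennreal_leI)
      moreover have "F t \<le> ennreal (\<bar>B\<bar> * t powr (- (?D / 2)))"
        using le(2)[OF True] by (rule order_trans) (auto intro!: ennreal_leI mult_right_mono)
      ultimately have "F t \<le> ennreal (min \<bar>A\<bar> (\<bar>B\<bar> * t powr (- (?D / 2))))"
        by (simp add: min_def)
      then show ?thesis
        using True by (simp add: ennreal_mult'' mult_left_mono)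
    qed simp
  qed
  also have "\<dots> < \<infinity>"
    using assms by (intro nn_integral_mellin_finite[where e="?D / 2" and A="\<bar>A\<bar>" and B="\<bar>B\<bar>"]) auto
  finally show ?thesis .
qed

text \<open>After subordination and Tonelli the time integrand is dominated by the sup norm of
  \<open>u\<close> at small times and by its \<open>L\<^sup>1\<close> norm at large times, both
  independent of \<open>x\<close>.\<close>

lemma nn_rpot_bounded:
  assumes "0 < \<beta>" "\<beta> < real DIM('a) / 2"
  obtains B where "0 \<le> B" "\<And>x. L1_norm (\<lambda>y. norm (x - y) powr (2 * \<beta> - real DIM('a)) * u y) \<le> ennreal B"
proof -
  let ?D = "real DIM('a)"
  let ?\<kappa> = "mellin_heat TYPE('a) \<beta>"
  define I where "I = time_int (\<lambda>t. ennreal (t powr (\<beta> - 1)) *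
    min (ennreal (heat_mass TYPE('a) * M)) (ennreal (U * t powr (- (?D / 2)))))"
  have "I < \<infinity>"
    unfolding I_def using assms
    by (intro enn_mellin_finite[where A="heat_mass TYPE('a) * M" and B=U]) auto
  then obtain J where J: "0 \<le> J" "I = ennreal J" by (cases I) auto
  have \<kappa>: "0 < ?\<kappa>" by (rule mellin_heat_pos[OF assms])
  have "L1_norm (\<lambda>y. norm (x - y) powr (2 * \<beta> - ?D) * u y) \<le> ennreal (J / ?\<kappa>)" for x
  proof -
    have "ennreal ?\<kappa> * L1_norm (\<lambda>y. norm (x - y) powr (2 * \<beta> - ?D) * u y) =
      (\<integral>\<^sup>+y. ennreal (?\<kappa> * norm (x - y) powr (2 * \<beta> - ?D)) * ennreal \<bar>u y\<bar> \<partial>lborel)"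
      using \<kappa> by (subst nn_integral_cmult[symmetric])
       (auto simp: ennreal_mult'[symmetric] abs_mult mult.assoc intro!: nn_integral_cong)
    also have "\<dots> = (\<integral>\<^sup>+y. time_int (\<lambda>t. ennreal (t powr (\<beta> - 1) * heat t (x - y))) * ennreal \<bar>u y\<bar> \<partial>lborel)"
      by (intro nn_integral_cong_AE) (use AE_lborel_singleton[of x] in \<open>eventually_elim, subst nn_integral_mellin_heat[OF assms], auto\<close>)
    also have "\<dots> = (\<integral>\<^sup>+y. \<integral>\<^sup>+t. ennreal (t powr (\<beta> - 1)) * pos_ind t * ennreal \<bar>heat t (x - y) * u y\<bar> \<partial>lborel \<partial>lborel)"
      by (subst nn_integral_multc[symmetric])
        (auto simp: abs_mult ennreal_mult mult_ac intro!: nn_integral_cong)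
    also have "\<dots> = (\<integral>\<^sup>+t. \<integral>\<^sup>+y. ennreal (t powr (\<beta> - 1)) * pos_ind t * ennreal \<bar>heat t (x - y) * u y\<bar> \<partial>lborel \<partial>lborel)"
      by (rule lborel_pair.Fubini'[symmetric]) measurable
    also have "\<dots> = time_int (\<lambda>t. ennreal (t powr (\<beta> - 1)) * heat_u t x)"
      by (subst nn_integral_cmult) (auto simp: mult_ac intro!: nn_integral_cong)
    also have "\<dots> \<le> I"
      unfolding I_def using heat_u_le by (intro nn_integral_mono) (auto simp: indicator_def intro!: mult_left_mono)
    finally have "ennreal ?\<kappa> * L1_norm (\<lambda>y. norm (x - y) powr (2 * \<beta> - ?D) * u y) \<le> ennreal J"
      by (simp add: J)
    then have "ennreal (1 / ?\<kappa>) * (ennreal ?\<kappa> * L1_norm (\<lambda>y. norm (x - y) powr (2 * \<beta> - ?D) * u y))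
       \<le> ennreal (1 / ?\<kappa>) * ennreal J"
      by (intro mult_left_mono) auto
    then show ?thesis
      using \<kappa> J by (simp add: mult.assoc[symmetric] ennreal_mult'[symmetric])
  qed
  moreover have "0 \<le> J / ?\<kappa>" using J \<kappa> by simp
  ultimately show ?thesis using that by blast
qed

lemma rpot_heat:
  assumes "0 < \<beta>" "\<beta> < real DIM('a) / 2"
  shows "rpot \<beta> x = 1 / mellin_heat TYPE('a) \<beta> *
      (LINT t|lborel. pos_ind t * (t powr (\<beta> - 1) * conv (heat t) u x))"
proof -
  let ?D = "real DIM('a)"
  let ?\<kappa> = "mellin_heat TYPE('a) \<beta>"
  let ?f = "\<lambda>y t. pos_ind t * (t powr (\<beta> - 1) * heat t (x - y)) * u y :: real"
  have "(\<integral>\<^sup>+t. \<integral>\<^sup>+y. ennreal \<bar>?f y t\<bar> \<partial>lborel \<partial>lborel) =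
    time_int (\<lambda>t. ennreal (t powr (\<beta> - 1)) * heat_u t x)"
    by (subst nn_integral_cmult[symmetric])
      (auto simp: indicator_def abs_mult ennreal_mult mult_ac intro!: nn_integral_cong)
  also have "\<dots> < \<infinity>"
    using assms heat_u_le by (intro enn_mellin_finite) auto
  finally have fin: "(\<integral>\<^sup>+t. \<integral>\<^sup>+y. ennreal \<bar>?f y t\<bar> \<partial>lborel \<partial>lborel) < \<infinity>" .
  have "?\<kappa> * rpot \<beta> x = (LINT y|lborel. ?\<kappa> * norm (x - y) powr (2 * \<beta> - ?D) * u y)"
    by (simp add: rpot_def mult.assoc)
  also have "\<dots> = (LINT y|lborel. LINT t|lborel. ?f y t)"
  proof (intro integral_cong_AE)
    show "AE y in lborel. ?\<kappa> * norm (x - y) powr (2 * \<beta> - ?D) * u y = (LINT t|lborel. ?f y t)"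
      using AE_lborel_singleton[of x]
    proof eventually_elim
      case (elim y)
      have "(LINT t|lborel. pos_ind t * (t powr (\<beta> - 1) * heat t (x - y))) =
        ?\<kappa> * norm (x - y) powr (2 * \<beta> - ?D)"
      proof (subst integral_eq_nn_integral)
        have "(\<integral>\<^sup>+t. ennreal (pos_ind t * (t powr (\<beta> - 1) * heat t (x - y))) \<partial>lborel) =
          ennreal (?\<kappa> * norm (x - y) powr (2 * \<beta> - ?D))"
        proof -
          have "x - y \<noteq> 0" using elim by simp
          show ?thesis
            unfolding nn_integral_mellin_heat[OF assms \<open>x - y \<noteq> 0\<close>, symmetric]
            by (intro nn_integral_cong) (auto simp: indicator_def)
        qed
        then show "enn2real (\<integral>\<^sup>+t. ennreal (pos_ind t * (t powr (\<beta> - 1) * heat t (x - y))) \<partial>lborel) =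
          ?\<kappa> * norm (x - y) powr (2 * \<beta> - ?D)"
          using mellin_heat_pos[OF assms] by simp
      qed auto
      then show ?case by simp
    qed
  qed measurable
  also have "\<dots> = (LINT t|lborel. LINT y|lborel. ?f y t)"
    by (rule fubini_real[OF _ fin]) measurable
  also have "\<dots> = (LINT t|lborel. pos_ind t * (t powr (\<beta> - 1) * conv (heat t) u x))"
    by (simp add: conv_def mult.assoc)
  finally show ?thesis
    using mellin_heat_pos[OF assms] by (simp add: field_simps)
qed

text \<open>The extra factor \<open>t\<close> compensates the \<open>1 / t\<close> lost in
  differentiating: \<open>t * dheat_u t x\<close> obeys bounds of the same form as
  \<open>heat_u t x\<close>.\<close>

lemma dheat_u_mellin_finite:
  assumes "0 < \<beta>" "\<beta> < real DIM('a) / 2"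
  shows "time_int (\<lambda>t. ennreal (t powr \<beta>) * dheat_u t x) < \<infinity>"
proof -
  let ?D = "real DIM('a)" and ?dc = "dheat_const TYPE('a)"
  have "time_int (\<lambda>t. ennreal (t powr \<beta>) * dheat_u t x) =
    time_int (\<lambda>t. ennreal (t powr (\<beta> - 1)) * (ennreal t * dheat_u t x))"
  proof (intro nn_integral_cong)
    fix t :: real
    show "ennreal (t powr \<beta>) * dheat_u t x * pos_ind t =
      ennreal (t powr (\<beta> - 1)) * (ennreal t * dheat_u t x) * pos_ind t"
      using powr_add[of t "\<beta> - 1" 1] by (cases "0 < t") (auto simp: mult.assoc[symmetric] ennreal_mult'[symmetric])
  qed
  also have "\<dots> < \<infinity>"
  proof (rule enn_mellin_finite[OF assms])
    fix t :: real assume "0 < t"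
    have "ennreal t * dheat_u t x \<le>
      ennreal t * ennreal (?dc * heat_mass TYPE('a) / t * M)"
      using \<open>0 < t\<close> by (intro mult_left_mono dheat_u_le) auto
    also have "\<dots> = ennreal (?dc * heat_mass TYPE('a) * M)"
      using \<open>0 < t\<close> by (simp add: ennreal_mult'[symmetric])
    finally show "ennreal t * dheat_u t x \<le> \<dots>" .
    have "ennreal t * dheat_u t x \<le>
      ennreal t * ennreal (?dc * t powr (- 1 - ?D / 2) * U)"
      using \<open>0 < t\<close> by (intro mult_left_mono dheat_u_le) auto
    also have "\<dots> = ennreal (?dc * U * t powr (- (?D / 2)))"
      using \<open>0 < t\<close> powr_add[of t 1 "- 1 - ?D / 2"] by (simp add: ennreal_mult'[symmetric] mult_ac)
    finally show "ennreal t * dheat_u t x \<le> \<dots>" .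
  qed
  finally show ?thesis .
qed

lemma rpot_dheat:
  assumes "0 < \<beta>" "\<beta> < real DIM('a) / 2"
  shows "rpot \<beta> x = - 1 / (\<beta> * mellin_heat TYPE('a) \<beta>) *
      (LINT t|lborel. pos_ind t * (t powr \<beta> * conv (dheat t) u x))"
proof -
  let ?\<kappa> = "mellin_heat TYPE('a) \<beta>"
  let ?f = "\<lambda>y t. pos_ind t * (t powr \<beta> * dheat t (x - y)) * u y :: real"
  have "(\<integral>\<^sup>+t. \<integral>\<^sup>+y. ennreal \<bar>?f y t\<bar> \<partial>lborel \<partial>lborel) =
    time_int (\<lambda>t. ennreal (t powr \<beta>) * dheat_u t x)"
    by (subst nn_integral_cmult[symmetric])
      (auto simp: indicator_def abs_mult ennreal_mult mult_ac intro!: nn_integral_cong)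
  then have fin: "(\<integral>\<^sup>+t. \<integral>\<^sup>+y. ennreal \<bar>?f y t\<bar> \<partial>lborel \<partial>lborel) < \<infinity>"
    using dheat_u_mellin_finite[OF assms] by simp
  have "- \<beta> * ?\<kappa> * rpot \<beta> x = (LINT y|lborel. - \<beta> * ?\<kappa> * norm (x - y) powr (2 * \<beta> - real DIM('a)) * u y)"
    by (simp add: rpot_def mult.assoc)
  also have "\<dots> = (LINT y|lborel. LINT t|lborel. ?f y t)"
  proof (intro integral_cong_AE)
    show "AE y in lborel. - \<beta> * ?\<kappa> * norm (x - y) powr (2 * \<beta> - real DIM('a)) * u y = (LINT t|lborel. ?f y t)"
      using AE_lborel_singleton[of x]
    proof eventually_elim
      case (elim y)
      with mellin_dheat(1)[OF assms, of "x - y"] show ?case by simp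
    qed
  qed measurable
  also have "\<dots> = (LINT t|lborel. LINT y|lborel. ?f y t)"
    by (rule fubini_real[OF _ fin]) measurable
  also have "\<dots> = (LINT t|lborel. pos_ind t * (t powr \<beta> * conv (dheat t) u x))"
    by (simp add: conv_def mult.assoc)
  finally have eq: "- \<beta> * ?\<kappa> * rpot \<beta> x = \<dots>" .
  show ?thesis
    unfolding eq[symmetric] using mellin_heat_pos[OF assms] assms(1) by simp
qed

section \<open>Heat flow of a potential and the change of order\<close>

lemma conv_heat_measurable [measurable]:
  assumes [measurable]: "f \<in> borel_measurable N" "g \<in> borel_measurable N"
  shows "(\<lambda>w. conv (heat (f w)) u (g w)) \<in> borel_measurable N"
    and "(\<lambda>w. conv (dheat (f w)) u (g w)) \<in> borel_measurable N"
  unfolding conv_def by measurable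

lemma conv_dheat_heat:
  assumes "0 < t" "0 < s"
  shows "conv (dheat t) (conv (heat s) u) x = heat_mass TYPE('a) * conv (dheat (t + s)) u x"
proof -
  let ?Z = "heat_mass TYPE('a)"
  let ?f = "\<lambda>y z. dheat t (x - y) * (heat s (y - z) * u z)"
  have fin: "(\<integral>\<^sup>+y. \<integral>\<^sup>+z. ennreal \<bar>?f y z\<bar> \<partial>lborel \<partial>lborel) < \<infinity>"
  proof -
    have "(\<integral>\<^sup>+y. \<integral>\<^sup>+z. ennreal \<bar>?f y z\<bar> \<partial>lborel \<partial>lborel) =
      (\<integral>\<^sup>+y. ennreal \<bar>dheat t (x - y)\<bar> * L1_norm (\<lambda>z. heat s (y - z) * u z) \<partial>lborel)"
      by (subst nn_integral_cmult[symmetric]) (auto simp: abs_mult ennreal_mult mult_ac intro!: nn_integral_cong)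
    also have "\<dots> \<le> (\<integral>\<^sup>+y. ennreal \<bar>dheat t (x - y)\<bar> * ennreal (?Z * M) \<partial>lborel)"
      using heat_u_le[OF \<open>0 < s\<close>] by (intro nn_integral_mono mult_left_mono) auto
    also have "\<dots> = L1_norm (\<lambda>y. dheat t (y::'a)) * ennreal (?Z * M)"
      using nn_integral_lborel_reflect[of "\<lambda>y. ennreal \<bar>dheat t y\<bar>" x] by (simp add: nn_integral_multc)
    also have "\<dots> < \<infinity>"
      using nn_integral_dheat[OF \<open>0 < t\<close>, where 'a='a] by (auto simp: ennreal_mult_less_top intro: le_less_trans)
    finally show ?thesis .
  qed
  have fin': "(\<integral>\<^sup>+z. \<integral>\<^sup>+y. ennreal \<bar>?f y z\<bar> \<partial>lborel \<partial>lborel) < \<infinity>"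
    by (subst lborel_pair.Fubini') (use fin in auto)
  have "conv (dheat t) (conv (heat s) u) x = (LINT y|lborel. LINT z|lborel. ?f y z)"
    by (simp add: conv_def)
  also have "\<dots> = (LINT z|lborel. LINT y|lborel. ?f y z)"
    by (rule fubini_real[OF _ fin']) measurable
  also have "\<dots> = (LINT z|lborel. ?Z * (dheat (t + s) (x - z) * u z))"
  proof (intro Bochner_Integration.integral_cong refl)
    fix z
    have "(LINT y|lborel. ?f y z) = (LINT y|lborel. dheat t (x - y) * heat s (y - z)) * u z"
      by (simp add: mult.assoc[symmetric])
    also have "(LINT y|lborel. dheat t (x - y) * heat s (y - z)) = (LINT y|lborel. dheat t (x - z - y) * heat s y)"
      using integral_lborel_shift[of "\<lambda>y. dheat t (x - y) * heat s (y - z)" z] by (simp add: algebra_simps)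
    also have "\<dots> = ?Z * dheat (t + s) (x - z)"
      by (rule dheat_convolve_heat[OF assms])
    finally show "(LINT y|lborel. ?f y z) = ?Z * (dheat (t + s) (x - z) * u z)"
      by simp
  qed
  also have "\<dots> = ?Z * conv (dheat (t + s)) u x"
    by (simp add: conv_def)
  finally show ?thesis .
qed

text \<open>Subordination writes the potential as a time integral of heat flows, and
  \<open>dheat t\<close> shifts each of them from time \<open>s\<close> to time
  \<open>t + s\<close>. The outcome is a fractional integral of order \<beta> over later times of
  the function sending \<tau> to \<open>conv (dheat \<tau>) u x\<close>.\<close>

lemma conv_dheat_rpot:
  assumes "0 < \<beta>" "\<beta> < real DIM('a) / 2" "0 < t"
  shows "conv (dheat t) (rpot \<beta>) x = heat_mass TYPE('a) / mellin_heat TYPE('a) \<beta> *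
    (LINT s|lborel. pos_ind s * s powr (\<beta> - 1) * conv (dheat (t + s)) u x)"
proof -
  let ?Z = "heat_mass TYPE('a)"
  let ?\<kappa> = "mellin_heat TYPE('a) \<beta>"
  let ?f = "\<lambda>y s. dheat t (x - y) * (pos_ind s * (s powr (\<beta> - 1) * conv (heat s) u y))"
  have fin: "(\<integral>\<^sup>+s. \<integral>\<^sup>+y. ennreal \<bar>?f y s\<bar> \<partial>lborel \<partial>lborel) < \<infinity>"
  proof -
    define K where "K = dheat_const TYPE('a) * ?Z / t"
    have K: "0 \<le> K"
      using assms dheat_const_pos[where 'a='a] heat_mass_nonneg[where 'a='a] by (simp add: K_def)
    have le: "L1_norm (\<lambda>y. dheat t (x - y) * conv (heat s) u y) \<le> ennreal (K * A)"
      if A: "\<And>y. L1_norm (\<lambda>z. heat s (y - z) * u z) \<le> ennreal A" "0 \<le> A" for s A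
      using A K nn_integral_dheat[OF \<open>0 < t\<close>, where 'a='a]
      by (intro nn_conv_le_sup) (auto simp: K_def conv_def intro!: abs_integral_leI conv_heat_measurable(1)[unfolded conv_def])
    have "(\<integral>\<^sup>+s. \<integral>\<^sup>+y. ennreal \<bar>?f y s\<bar> \<partial>lborel \<partial>lborel) =
      time_int (\<lambda>s. ennreal (s powr (\<beta> - 1)) * L1_norm (\<lambda>y. dheat t (x - y) * conv (heat s) u y))"
      by (subst nn_integral_cmult[symmetric])
        (auto simp: indicator_def abs_mult ennreal_mult mult_ac intro!: nn_integral_cong)
    also have "\<dots> < \<infinity>"
    proof (rule enn_mellin_finite[OF assms(1,2)])
      fix s :: real assume "0 < s"
      show "L1_norm (\<lambda>y. dheat t (x - y) * conv (heat s) u y) \<le> ennreal (K * (?Z * M))"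
        using heat_u_le(1)[OF \<open>0 < s\<close>] heat_mass_nonneg[where 'a='a] M_nonneg by (intro le) auto
      show "L1_norm (\<lambda>y. dheat t (x - y) * conv (heat s) u y) \<le> ennreal (K * U * s powr (- (real DIM('a) / 2)))"
        unfolding mult.assoc using heat_u_le(2)[OF \<open>0 < s\<close>] U_nonneg by (intro le) auto
    qed
    finally show ?thesis .
  qed
  have "conv (dheat t) (rpot \<beta>) x = 1 / ?\<kappa> * (LINT y|lborel. LINT s|lborel. ?f y s)"
    by (simp add: conv_def rpot_heat[OF assms(1,2)])
  also have "(LINT y|lborel. LINT s|lborel. ?f y s) = (LINT s|lborel. LINT y|lborel. ?f y s)"
    by (rule fubini_real[OF _ fin]) measurable
  also have "\<dots> = (LINT s|lborel. pos_ind s * s powr (\<beta> - 1) * conv (dheat t) (conv (heat s) u) x)"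
  proof (intro Bochner_Integration.integral_cong refl)
    fix s :: real
    have "(LINT y|lborel. ?f y s) =
      (LINT y|lborel. (pos_ind s * s powr (\<beta> - 1)) * (dheat t (x - y) * conv (heat s) u y))"
      by (intro Bochner_Integration.integral_cong refl) (simp only: mult_ac)
    then show "(LINT y|lborel. ?f y s) = pos_ind s * s powr (\<beta> - 1) * conv (dheat t) (conv (heat s) u) x"
      by (simp only: conv_def[of "dheat t"] integral_mult_right_zero)
  qed
  also have "\<dots> = (LINT s|lborel. ?Z * (pos_ind s * s powr (\<beta> - 1) * conv (dheat (t + s)) u x))"
    using conv_dheat_heat[OF \<open>0 < t\<close>]
    by (intro Bochner_Integration.integral_cong) (auto simp: indicator_def)
  finally show ?thesis by simp
qed

text \<open>The Abel integral equation in the time variable trades the potential of order \<open>2 * \<beta>\<close>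
  for the one of order 1: composing the fractional integrals in time produces a Beta function.\<close>

lemma rpot_eq_mellin_rpot:
  assumes "0 < \<beta>" "\<beta> < real DIM('a) / 2" "2 \<le> DIM('a)"
  shows "rpot \<beta> x = - (mellin_heat TYPE('a) (1 / 2) /
      (\<beta> * mellin_heat TYPE('a) \<beta> * heat_mass TYPE('a) * Beta (\<beta> + 1 / 2) (1 / 2))) *
    (LINT t|lborel. pos_ind t * t powr (\<beta> - 1 / 2) * conv (dheat t) (rpot (1 / 2)) x)"
proof -
  let ?Q = "\<lambda>t. conv (dheat t) u x"
  let ?B = "Beta (\<beta> + 1 / 2) (1 / 2)"
  let ?\<kappa> = "mellin_heat TYPE('a)"
  let ?Z = "heat_mass TYPE('a)"
  let ?w = "\<lambda>\<tau> t. pos_ind (\<tau> - t) * (\<tau> - t) powr (- 1 / 2) :: real"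
  have B: "0 < ?B"
    using assms by (simp add: Beta_def Gamma_real_pos)
  have half: "0 < (1 / 2 :: real)" "1 / 2 < real DIM('a) / 2"
    using assms by auto
  \<comment> \<open>Here \<open>\<tau> = t + s\<close>. Integrating the powers
    \<open>\<beta> - 1 / 2\<close> and \<open>- 1 / 2\<close> over \<open>0 < t < \<tau>\<close>
    produces exactly \<open>\<tau> powr \<beta>\<close>, the weight in
    \<open>rpot_dheat\<close>.\<close>
  let ?f = "\<lambda>t \<tau>. pos_ind t * t powr (\<beta> - 1 / 2) * ?w \<tau> t * ?Q \<tau> :: real"
  have Beta: "has_bochner_integral lborel (\<lambda>t. pos_ind t * t powr (\<beta> - 1 / 2) *
      ?w \<tau> t) (?B * (pos_ind \<tau> * \<tau> powr \<beta>))" for \<tau> :: real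
  proof (cases "0 < \<tau>")
    case True
    then show ?thesis using has_bochner_integral_Beta[of "\<beta> + 1 / 2" "1 / 2" \<tau>] assms by simp
  next
    case False
    then have "(\<lambda>t. pos_ind t * t powr (\<beta> - 1 / 2) *
      ?w \<tau> t) = (\<lambda>t. 0 :: real)"
      by (auto simp: indicator_def)
    with False show ?thesis by (simp add: has_bochner_integral_zero)
  qed
  have fin: "(\<integral>\<^sup>+\<tau>. \<integral>\<^sup>+t. ennreal \<bar>?f t \<tau>\<bar> \<partial>lborel \<partial>lborel) < \<infinity>"
  proof -
    have "L1_norm (\<lambda>t. ?f t \<tau>) =
      ennreal (?B * (pos_ind \<tau> * \<tau> powr \<beta>)) * ennreal \<bar>?Q \<tau>\<bar>" for \<tau>
    proof -
      have "L1_norm (\<lambda>t. ?f t \<tau>) = (\<integral>\<^sup>+t. ennreal (pos_ind t * t powr (\<beta> - 1 / 2) *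
        ?w \<tau> t) * ennreal \<bar>?Q \<tau>\<bar> \<partial>lborel)"
        by (intro nn_integral_cong) (simp add: abs_mult ennreal_mult)
      also have "\<dots> = (\<integral>\<^sup>+t. ennreal (pos_ind t * t powr (\<beta> - 1 / 2) *
        ?w \<tau> t) \<partial>lborel) * ennreal \<bar>?Q \<tau>\<bar>"
        by (intro nn_integral_multc) measurable
      also have "(\<integral>\<^sup>+t. ennreal (pos_ind t * t powr (\<beta> - 1 / 2) *
        ?w \<tau> t) \<partial>lborel) = ennreal (?B * (pos_ind \<tau> * \<tau> powr \<beta>))"
        using Beta[of \<tau>] by (subst nn_integral_eq_integral) (auto simp: has_bochner_integral_iff)
      finally show ?thesis .
    qed
    then have "(\<integral>\<^sup>+\<tau>. \<integral>\<^sup>+t. ennreal \<bar>?f t \<tau>\<bar> \<partial>lborel \<partial>lborel) =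
      (\<integral>\<^sup>+\<tau>. ennreal (?B * (pos_ind \<tau> * \<tau> powr \<beta>)) * ennreal \<bar>?Q \<tau>\<bar> \<partial>lborel)" by simp
    also have "\<dots> \<le> (\<integral>\<^sup>+\<tau>. ennreal ?B * (ennreal (\<tau> powr \<beta>) * L1_norm (\<lambda>y. dheat \<tau> (x - y) * u y) * pos_ind \<tau>) \<partial>lborel)"
      using B by (intro nn_integral_mono)
        (auto simp: indicator_def ennreal_mult mult.assoc conv_def intro!: mult_left_mono abs_integral_le_nn_integral)
    also have "\<dots> = ennreal ?B * time_int (\<lambda>\<tau>. ennreal (\<tau> powr \<beta>) * L1_norm (\<lambda>y. dheat \<tau> (x - y) * u y))"
      by (intro nn_integral_cmult) measurable
    also have "\<dots> < \<infinity>"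
      using dheat_u_mellin_finite[OF assms(1,2), of x] by (simp add: ennreal_mult_less_top)
    finally show ?thesis .
  qed
  have "(LINT t|lborel. pos_ind t * t powr (\<beta> - 1 / 2) * conv (dheat t) (rpot (1 / 2)) x) =
    (LINT t|lborel. ?Z / ?\<kappa> (1 / 2) * (LINT \<tau>|lborel. ?f t \<tau>))"
  proof (intro Bochner_Integration.integral_cong refl)
    fix t :: real
    show "pos_ind t * t powr (\<beta> - 1 / 2) * conv (dheat t) (rpot (1 / 2)) x = ?Z / ?\<kappa> (1 / 2) * (LINT \<tau>|lborel. ?f t \<tau>)"
    proof (cases "0 < t")
      case True
      have "(LINT s|lborel. pos_ind s * s powr (- 1 / 2) * ?Q (t + s)) =
        (LINT \<tau>|lborel. pos_ind (\<tau> - t) * (\<tau> - t) powr (- 1 / 2) * ?Q \<tau>)"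
        using integral_lborel_shift[of "\<lambda>s. pos_ind s * s powr (- 1 / 2) * ?Q (t + s)" "- t"] by simp
      moreover have "(LINT \<tau>|lborel. ?f t \<tau>) = (LINT \<tau>|lborel. t powr (\<beta> - 1 / 2) *
        (pos_ind (\<tau> - t) * (\<tau> - t) powr (- 1 / 2) * ?Q \<tau>))"
        using True by (intro Bochner_Integration.integral_cong refl) (simp add: mult_ac)
      ultimately show ?thesis
        using True by (simp add: conv_dheat_rpot[OF half True])
    qed simp
  qed
  also have "\<dots> = ?Z / ?\<kappa> (1 / 2) * (LINT t|lborel. LINT \<tau>|lborel. ?f t \<tau>)"
    by simp
  also have "(LINT t|lborel. LINT \<tau>|lborel. ?f t \<tau>) = (LINT \<tau>|lborel. LINT t|lborel. ?f t \<tau>)"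
    by (rule fubini_real[OF _ fin]) measurable
  also have "\<dots> = (LINT \<tau>|lborel. ?B * (pos_ind \<tau> * \<tau> powr \<beta>) * ?Q \<tau>)"
    using Beta by (simp add: has_bochner_integral_iff)
  also have "\<dots> = ?B * (LINT \<tau>|lborel. pos_ind \<tau> * (\<tau> powr \<beta> * ?Q \<tau>))"
    by (simp add: mult.assoc)
  finally have eq: "(LINT t|lborel. pos_ind t * t powr (\<beta> - 1 / 2) * conv (dheat t) (rpot (1 / 2)) x) =
     ?Z / ?\<kappa> (1 / 2) * (?B * (LINT \<tau>|lborel. pos_ind \<tau> * (\<tau> powr \<beta> * ?Q \<tau>)))" .
  show ?thesis
    unfolding eq rpot_dheat[OF assms(1,2)]
    using B mellin_heat_pos[OF half] heat_mass_pos[where 'a='a] by simp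
qed

end

subsection \<open>Minkowski's integral inequality with a majorant\<close>

text \<open>Since \<open>enn2real top\<close> is 0, infinity has its own case; time integrals may be
  infinite at some points until the estimate is proved.\<close>

definition epow :: "real \<Rightarrow> ennreal \<Rightarrow> ennreal" where
  "epow p x = (if x = top then top else ennreal (enn2real x powr p))"

lemma epow_ennreal: "0 \<le> x \<Longrightarrow> epow p (ennreal x) = ennreal (x powr p)"
  by (simp add: epow_def)

lemma epow_top [simp]: "epow p top = top"
  by (simp add: epow_def)

lemma epow_zero [simp]: "epow p 0 = 0"
  by (simp add: epow_def)

lemma epow_mono: "0 \<le> p \<Longrightarrow> x \<le> y \<Longrightarrow> epow p x \<le> epow p y"
  by (auto simp: epow_def top.extremum_uniqueI intro!: ennreal_leI powr_mono2 enn2real_mono)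
    (auto simp: less_top)

lemma epow_cmult:
  assumes "0 \<le> c"
  shows "epow p (ennreal c * x) = ennreal (c powr p) * epow p x"
proof (cases x)
  case (real r)
  then show ?thesis
    using assms by (simp add: ennreal_mult'[symmetric] epow_ennreal powr_mult)
next
  case top
  then show ?thesis
    using assms by (cases "c = 0") (auto simp: ennreal_mult_top)
qed

lemma epow_measurable [measurable]:
  assumes [measurable]: "f \<in> borel_measurable M"
  shows "(\<lambda>x. epow p (f x)) \<in> borel_measurable M"
  unfolding epow_def by measurable

text \<open>Young's inequality for the numbers \<open>y / (b * l)\<close> and 1, multiplied by
  \<open>l * b\<close>. The weight \<open>b\<close> becomes the density of the measure in Jensen's
  inequality, and \<open>l\<close> is left free for optimisation.\<close>

lemma epow_Young:
  assumes "1 < p" "0 < l" "0 < b"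
  shows "y \<le> ennreal (l powr (1 - p) / p) * (ennreal (b powr (1 - p)) * epow p y) + ennreal (l * (1 - 1 / p) * b)"
proof (cases y)
  case (real r)
  define s where "s = r / b / l"
  have "s * 1 \<le> s powr p / p + 1 powr (p / (p - 1)) / (p / (p - 1))"
    using assms real by (intro Youngs_inequality) (auto simp: s_def field_simps)
  then have "s \<le> s powr p / p + (1 - 1 / p)"
    using assms by (simp add: field_simps)
  then have "l * b * s \<le> l * b * (s powr p / p + (1 - 1 / p))"
    using assms by (intro mult_left_mono) auto
  moreover have "l * b * s = r"
    using assms by (simp add: s_def)
  moreover have "l * b * (s powr p / p) = l powr (1 - p) / p * (b powr (1 - p) * r powr p)"
    using assms real by (simp add: s_def powr_divide powr_mult powr_diff mult_ac)
  ultimately have "r \<le> l powr (1 - p) / p * (b powr (1 - p) * r powr p) + l * b * (1 - 1 / p)"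
    by (simp only: distrib_left)
  then have "r \<le> l powr (1 - p) / p * (b powr (1 - p) * r powr p) + l * (1 - 1 / p) * b"
    by (simp only: mult_ac)
  then show ?thesis
    using real assms by (simp add: epow_ennreal ennreal_mult'[symmetric] ennreal_plus[symmetric] del: ennreal_plus)
next
  case top
  then show ?thesis using assms by (simp add: ennreal_mult_top)
qed

text \<open>Jensen's inequality for \<open>f / B\<close> and the measure with density \<open>B\<close>.\<close>

lemma epow_nn_integral_le:
  assumes [measurable]: "f \<in> borel_measurable M" "B \<in> borel_measurable M"
    and "1 < p" "0 < S" "\<And>t. 0 \<le> B t" "\<And>t. B t = 0 \<Longrightarrow> f t = 0"
    and S: "(\<integral>\<^sup>+t. ennreal (B t) \<partial>M) = ennreal S"
  shows "epow p (\<integral>\<^sup>+t. f t \<partial>M) \<le> ennreal (S powr (p - 1)) * (\<integral>\<^sup>+t. ennreal (B t powr (1 - p)) * epow p (f t) \<partial>M)"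
proof -
  define J where "J = (\<integral>\<^sup>+t. ennreal (B t powr (1 - p)) * epow p (f t) \<partial>M)"
  define I where "I = (\<integral>\<^sup>+t. f t \<partial>M)"
  have *: "I \<le> ennreal (l powr (1 - p) / p) * J + ennreal (l * (1 - 1 / p)) * ennreal S" if "0 < l" for l
  proof -
    have "I \<le> (\<integral>\<^sup>+t. ennreal (l powr (1 - p) / p) * (ennreal (B t powr (1 - p)) * epow p (f t)) + ennreal (l * (1 - 1 / p)) * ennreal (B t) \<partial>M)"
      unfolding I_def
    proof (intro nn_integral_mono)
      fix t
      show "f t \<le> ennreal (l powr (1 - p) / p) * (ennreal (B t powr (1 - p)) * epow p (f t)) + ennreal (l * (1 - 1 / p)) * ennreal (B t)"
        using epow_Young[of p l "B t" "f t"] assms that by (cases "B t = 0") (auto simp: ennreal_mult' order_less_le)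
    qed
    also have "\<dots> = ennreal (l powr (1 - p) / p) * J + ennreal (l * (1 - 1 / p)) * ennreal S"
      by (simp add: nn_integral_add nn_integral_cmult S J_def)
    finally show ?thesis .
  qed
  show ?thesis
  proof (cases J)
    case (real j)
    have "I < top"
      using *[of 1] real by (auto simp: ennreal_mult_less_top intro: le_less_trans)
    then obtain i where i: "0 \<le> i" "I = ennreal i" by (cases I) auto
    have **: "i \<le> l powr (1 - p) / p * j + l * (1 - 1 / p) * S" if "0 < l" for l
      using *[OF that] that real i assms
      by (simp add: ennreal_mult'[symmetric] ennreal_plus[symmetric] del: ennreal_plus)
    have "i powr p \<le> S powr (p - 1) * j"
    proof (cases "j = 0")
      case True
      have "i \<le> 0"
      proof (rule ccontr)
        assume "\<not> i \<le> 0"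
        \<comment> \<open>For \<open>j = 0\<close> the bound reads \<open>i \<le> l * c\<close> for
          every positive \<open>l\<close>; the choice \<open>l = i / (2 * c)\<close> gives
          \<open>i \<le> i / 2\<close>.\<close>
        define c where "c = (1 - 1 / p) * S"
        have c: "0 < c" using assms by (auto simp: c_def)
        have "0 < i / (2 * c)" using c \<open>\<not> i \<le> 0\<close> by simp
        then have "i \<le> i / (2 * c) * c"
          using ** True unfolding c_def by (auto simp only: mult_zero_right add_0_left mult.assoc)
        then show False
          using c \<open>\<not> i \<le> 0\<close> by simp
      qed
      then show ?thesis using i True by simp
    next
      case False
      \<comment> \<open>The minimiser in \<open>l\<close>: then
        \<open>l powr (1 - p) * j = l * S\<close>, and the whole bound collapses to
        \<open>l * S\<close>.\<close>
      define l where "l = (j / S) powr (1 / p)"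
      have "0 < l" using False real assms by (auto simp: l_def)
      have lp: "l powr p = j / S"
        using False real assms by (simp add: l_def powr_powr)
      have "l powr (1 - p) * j = l * S"
        using lp \<open>0 < l\<close> \<open>0 < S\<close> False by (simp add: powr_diff field_simps)
      then have "l powr (1 - p) / p * j + l * (1 - 1 / p) * S = l * S"
        using assms by (simp add: field_simps)
      then have "i powr p \<le> (l * S) powr p"
        using **[OF \<open>0 < l\<close>] i assms by (intro powr_mono2) auto
      also have "\<dots> = S powr (p - 1) * j"
        using \<open>0 < l\<close> \<open>0 < S\<close> by (simp add: powr_mult lp powr_diff)
      finally show ?thesis .
    qed
    then show ?thesis
      using i real by (simp add: I_def[symmetric] J_def[symmetric] epow_ennreal ennreal_mult'[symmetric])
  next
    case top
    then show ?thesis using assms by (simp add: J_def[symmetric] ennreal_mult_top)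
  qed
qed

text \<open>Jensen's inequality at each \<open>x\<close> with the density \<open>B\<close>, then
  Tonelli; the weights recombine to \<open>B powr (1 - p) * B powr p = B\<close>, with no duality
  argument. As \<open>0 powr (1 - p)\<close> is 0, the integrand has to vanish wherever
  \<open>B\<close> does.\<close>

lemma (in pair_sigma_finite) epow_minkowski:
  assumes f [measurable]: "case_prod f \<in> borel_measurable (M1 \<Otimes>\<^sub>M M2)"
    and [measurable]: "B \<in> borel_measurable M2"
    and "1 < p" "0 \<le> S" "\<And>t. 0 \<le> B t" "\<And>x t. B t = 0 \<Longrightarrow> f x t = 0"
    and le: "\<And>t. (\<integral>\<^sup>+x. epow p (f x t) \<partial>M1) \<le> ennreal (B t powr p)"
    and S: "(\<integral>\<^sup>+t. ennreal (B t) \<partial>M2) = ennreal S"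
  shows "(\<integral>\<^sup>+x. epow p (\<integral>\<^sup>+t. f x t \<partial>M2) \<partial>M1) \<le> ennreal (S powr p)"
proof (cases "S = 0")
  case True
  then have "AE t in M2. B t = 0"
    using S assms(5) by (auto simp: nn_integral_0_iff_AE order.antisym)
  then have "(\<integral>\<^sup>+t. f x t \<partial>M2) = 0" if "x \<in> space M1" for x
    using that assms(6) by (subst nn_integral_0_iff_AE) auto
  then have "(\<integral>\<^sup>+x. epow p (\<integral>\<^sup>+t. f x t \<partial>M2) \<partial>M1) = (\<integral>\<^sup>+x. 0 \<partial>M1)"
    by (intro nn_integral_cong) simp
  then show ?thesis by simp
next
  case False
  with \<open>0 \<le> S\<close> have "0 < S" by simp
  have "(\<integral>\<^sup>+x. epow p (\<integral>\<^sup>+t. f x t \<partial>M2) \<partial>M1) \<le>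
    (\<integral>\<^sup>+x. ennreal (S powr (p - 1)) * (\<integral>\<^sup>+t. ennreal (B t powr (1 - p)) * epow p (f x t) \<partial>M2) \<partial>M1)"
    using assms(3,5,6) S \<open>0 < S\<close> by (intro nn_integral_mono epow_nn_integral_le) auto
  also have "\<dots> = ennreal (S powr (p - 1)) * (\<integral>\<^sup>+x. \<integral>\<^sup>+t. ennreal (B t powr (1 - p)) * epow p (f x t) \<partial>M2 \<partial>M1)"
    by (intro nn_integral_cmult) measurable
  also have "(\<integral>\<^sup>+x. \<integral>\<^sup>+t. ennreal (B t powr (1 - p)) * epow p (f x t) \<partial>M2 \<partial>M1) =
    (\<integral>\<^sup>+t. \<integral>\<^sup>+x. ennreal (B t powr (1 - p)) * epow p (f x t) \<partial>M1 \<partial>M2)"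
    by (rule Fubini'[symmetric]) measurable
  also have "\<dots> = (\<integral>\<^sup>+t. ennreal (B t powr (1 - p)) * (\<integral>\<^sup>+x. epow p (f x t) \<partial>M1) \<partial>M2)"
    by (intro nn_integral_cong nn_integral_cmult) measurable
  also have "\<dots> \<le> (\<integral>\<^sup>+t. ennreal (B t) \<partial>M2)"
  proof (intro nn_integral_mono)
    fix t
    have "ennreal (B t powr (1 - p)) * (\<integral>\<^sup>+x. epow p (f x t) \<partial>M1) \<le> ennreal (B t powr (1 - p)) * ennreal (B t powr p)"
      by (intro mult_left_mono le) auto
    also have "\<dots> = ennreal (B t)"
      using assms(5)[of t] by (cases "B t = 0") (auto simp: ennreal_mult'[symmetric] powr_add[symmetric])
    finally show "ennreal (B t powr (1 - p)) * (\<integral>\<^sup>+x. epow p (f x t) \<partial>M1) \<le> ennreal (B t)" .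
  qed
  finally have "(\<integral>\<^sup>+x. epow p (\<integral>\<^sup>+t. f x t \<partial>M2) \<partial>M1) \<le> ennreal (S powr (p - 1)) * ennreal S"
    by (simp add: S mult_left_mono)
  also have "\<dots> = ennreal (S powr p)"
    using \<open>0 < S\<close> powr_add[of S "p - 1" 1] by (simp add: ennreal_mult'[symmetric])
  finally show ?thesis .
qed

lemma nn_integral_epow_interpolate:
  assumes [measurable]: "g \<in> borel_measurable M"
    and "1 < p" "\<And>x. \<bar>g x\<bar> \<le> A" "(\<integral>\<^sup>+x. ennreal \<bar>g x\<bar> \<partial>M) \<le> ennreal L" "0 \<le> L"
  shows "(\<integral>\<^sup>+x. epow p (ennreal \<bar>g x\<bar>) \<partial>M) \<le> ennreal (A powr (p - 1) * L)"
proof -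
  have "(\<integral>\<^sup>+x. epow p (ennreal \<bar>g x\<bar>) \<partial>M) \<le> (\<integral>\<^sup>+x. ennreal (A powr (p - 1)) * ennreal \<bar>g x\<bar> \<partial>M)"
  proof (intro nn_integral_mono)
    fix x
    have "\<bar>g x\<bar> powr p = \<bar>g x\<bar> powr (p - 1) * \<bar>g x\<bar>"
      using powr_add[of "\<bar>g x\<bar>" "p - 1" 1] by (cases "g x = 0") auto
    also have "\<dots> \<le> A powr (p - 1) * \<bar>g x\<bar>"
      using assms(2,3) by (intro mult_right_mono powr_mono2) auto
    finally show "epow p (ennreal \<bar>g x\<bar>) \<le> ennreal (A powr (p - 1)) * ennreal \<bar>g x\<bar>"
      by (simp add: epow_ennreal ennreal_mult'[symmetric])
  qed
  also have "\<dots> \<le> ennreal (A powr (p - 1)) * ennreal L"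
    using assms(4) by (simp add: nn_integral_cmult mult_left_mono)
  finally show ?thesis using assms(5) by (simp add: ennreal_mult')
qed

subsection \<open>Convolution estimates for one truncation level\<close>

lemma conv_measurable [measurable]:
  fixes k f :: "'a::euclidean_space \<Rightarrow> real"
  assumes [measurable]: "k \<in> borel_measurable borel" "f \<in> borel_measurable borel"
  shows "conv k f \<in> borel_measurable borel"
  unfolding conv_def by measurable

lemma nn_integral_conv_le:
  fixes k f :: "'a::euclidean_space \<Rightarrow> real"
  assumes [measurable]: "k \<in> borel_measurable borel" "f \<in> borel_measurable borel"
  shows "L1_norm (\<lambda>x. conv k f x) \<le> L1_norm k * L1_norm f"
proof -
  have "L1_norm (\<lambda>x. conv k f x) \<le> (\<integral>\<^sup>+x. \<integral>\<^sup>+y. ennreal \<bar>k (x - y) * f y\<bar> \<partial>lborel \<partial>lborel)"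
    unfolding conv_def by (intro nn_integral_mono abs_integral_le_nn_integral)
  also have "\<dots> = (\<integral>\<^sup>+y. \<integral>\<^sup>+x. ennreal \<bar>k (x - y) * f y\<bar> \<partial>lborel \<partial>lborel)"
    by (rule lborel_pair.Fubini'[symmetric]) measurable
  also have "\<dots> = (\<integral>\<^sup>+y. L1_norm (\<lambda>x. k (x - y)) * ennreal \<bar>f y\<bar> \<partial>lborel)"
    by (subst nn_integral_multc[symmetric]) (auto simp: abs_mult ennreal_mult)
  also have "\<dots> = (\<integral>\<^sup>+y. L1_norm k * ennreal \<bar>f y\<bar> \<partial>lborel)"
    using nn_integral_lborel_shift[of "\<lambda>x. ennreal \<bar>k x\<bar>" "- y" for y] by simp
  finally show ?thesis by (simp add: nn_integral_cmult)
qed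

text \<open>The difference is an average of \<open>f (x - y) - f x\<close> with weight
  \<open>k y\<close>, whose \<open>L\<^sup>1\<close> norm in \<open>x\<close> is a displacement.
  With \<open>heat\<close> this compares a function with its flow; with \<open>dheat\<close>, of
  mean zero, it bounds the convolution itself.\<close>

lemma nn_integral_conv_diff_le:
  fixes k f :: "'a::euclidean_space \<Rightarrow> real"
  assumes k: "integrable lborel k" and [measurable]: "f \<in> borel_measurable borel"
    and f: "\<And>x. \<bar>f x\<bar> \<le> H"
    and disp: "\<And>h. L1_norm (\<lambda>x. f (x + h) - f x) \<le> ennreal (a * norm h)"
    and "0 \<le> a"
  shows "L1_norm (\<lambda>x. conv k f x - (LINT y|lborel. k y) * f x) \<le>
    ennreal a * (\<integral>\<^sup>+y. ennreal (\<bar>k y\<bar> * norm y) \<partial>lborel)"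
proof -
  have [measurable]: "k \<in> borel_measurable borel" using k by auto
  have int: "integrable lborel (\<lambda>y. k y * f (x - y))" for x
  proof (rule Bochner_Integration.integrable_bound)
    show "integrable lborel (\<lambda>y. H * k y)" using k by auto
    show "AE y in lborel. norm (k y * f (x - y)) \<le> norm (H * k y)"
      using f by (auto intro!: AE_I2 simp: abs_mult mult.commute[of H] intro: mult_left_mono order_trans[OF f abs_ge_self])
  qed auto
  have "L1_norm (\<lambda>x. conv k f x - (LINT y|lborel. k y) * f x) =
    L1_norm (\<lambda>x. LINT y|lborel. k y * (f (x - y) - f x))"
  proof (intro nn_integral_cong)
    fix x
    have "conv k f x = (LINT y|lborel. k y * f (x - y))"
      unfolding conv_def using integral_lborel_reflect[of "\<lambda>y. k y * f (x - y)" x] by simp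
    then have "conv k f x - (LINT y|lborel. k y) * f x = (LINT y|lborel. k y * (f (x - y) - f x))"
      using int[of x] k by (simp add: right_diff_distrib)
    then show "ennreal \<bar>conv k f x - (LINT y|lborel. k y) * f x\<bar> = ennreal \<bar>LINT y|lborel. k y * (f (x - y) - f x)\<bar>"
      by simp
  qed
  also have "\<dots> \<le> (\<integral>\<^sup>+x. \<integral>\<^sup>+y. ennreal \<bar>k y * (f (x - y) - f x)\<bar> \<partial>lborel \<partial>lborel)"
    by (intro nn_integral_mono abs_integral_le_nn_integral)
  also have "\<dots> = (\<integral>\<^sup>+y. \<integral>\<^sup>+x. ennreal \<bar>k y * (f (x - y) - f x)\<bar> \<partial>lborel \<partial>lborel)"
    by (rule lborel_pair.Fubini'[symmetric]) measurable
  also have "\<dots> = (\<integral>\<^sup>+y. ennreal \<bar>k y\<bar> * L1_norm (\<lambda>x. f (x + - y) - f x) \<partial>lborel)"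
    by (subst nn_integral_cmult[symmetric]) (auto simp: abs_mult ennreal_mult)
  also have "\<dots> \<le> (\<integral>\<^sup>+y. ennreal \<bar>k y\<bar> * ennreal (a * norm (- y)) \<partial>lborel)"
    by (intro nn_integral_mono mult_left_mono disp) auto
  also have "\<dots> = (\<integral>\<^sup>+y. ennreal a * ennreal (\<bar>k y\<bar> * norm y) \<partial>lborel)"
    using \<open>0 \<le> a\<close> by (simp add: ennreal_mult mult_ac)
  finally show ?thesis by (simp add: nn_integral_cmult)
qed

definition level_const :: "'a::euclidean_space itself \<Rightarrow> real" where
  "level_const _ = dheat_const TYPE('a) * (1 + heat_mass TYPE('a) + 2 * heat_moment TYPE('a))"

lemma level_const_bounds:
  assumes "0 < t"
  shows "0 < level_const TYPE('a::euclidean_space)"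
    and "\<bar>dheat t (x::'a)\<bar> \<le> level_const TYPE('a) * t powr (- 1 - real DIM('a) / 2)"
    and "L1_norm (\<lambda>x. dheat t (x::'a)) \<le> ennreal (level_const TYPE('a) / t)"
    and "(\<integral>\<^sup>+x. ennreal (\<bar>dheat t (x::'a)\<bar> * norm x) \<partial>lborel) \<le> ennreal (level_const TYPE('a) * t powr (- 1 / 2))"
proof -
  let ?dc = "dheat_const TYPE('a)" and ?K = "level_const TYPE('a)"
  note pos = dheat_const_pos[where 'a='a] heat_mass_nonneg[where 'a='a] heat_moment_nonneg[where 'a='a]
  have le: "?dc * 1 \<le> ?K"
    "?dc * heat_mass TYPE('a) \<le> ?K"
    "?dc * (2 * heat_moment TYPE('a)) \<le> ?K"
    unfolding level_const_def using pos by (intro mult_left_mono; simp)+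
  show "0 < ?K" using le(1) pos by simp
  show "\<bar>dheat t (x::'a)\<bar> \<le> ?K * t powr (- 1 - real DIM('a) / 2)"
    using le(1) by (intro order_trans[OF dheat_le[OF assms]] mult_right_mono) auto
  show "L1_norm (\<lambda>x. dheat t (x::'a)) \<le> ennreal (?K / t)"
    using le(2) assms by (intro order_trans[OF nn_integral_dheat[OF assms]] ennreal_leI divide_right_mono) auto
  show "(\<integral>\<^sup>+x. ennreal (\<bar>dheat t (x::'a)\<bar> * norm x) \<partial>lborel) \<le> ennreal (?K * t powr (- 1 / 2))"
    using le(3) by (intro order_trans[OF nn_integral_dheat_norm[OF assms]] ennreal_leI mult_right_mono) auto
qed

abbreviation flow_dens :: "real \<Rightarrow> real \<Rightarrow> ('a::euclidean_space \<Rightarrow> real) \<Rightarrow> 'a \<Rightarrow> ennreal" where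
  "flow_dens \<alpha> t f x \<equiv> ennreal (t powr ((\<alpha> - 1) / 2) * \<bar>conv (dheat t) f x\<bar>)"

text \<open>What the estimates know about a slice: its height \<open>H\<close>, the measure
  \<open>m\<close> of its support, entering through the \<open>L\<^sup>1\<close> norm, and its total
  variation \<open>a\<close>. The variation is expressed by translations because a slice need not be
  differentiable at its edges.\<close>

locale truncation_level =
  fixes f :: "'a::euclidean_space \<Rightarrow> real" and H m a :: real
  assumes measurable_f [measurable]: "f \<in> borel_measurable borel"
    and f_nonneg: "\<And>x. 0 \<le> f x" and f_le: "\<And>x. f x \<le> H"
    and int_f: "L1_norm f \<le> ennreal (H * m)"
    and disp: "\<And>h. L1_norm (\<lambda>x. f (x + h) - f x) \<le> ennreal (a * norm h)"
    and pos: "0 < H" "0 < m" "0 \<le> a"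
begin

lemma abs_f_le: "\<bar>f x\<bar> \<le> H"
  using f_nonneg[of x] f_le[of x] by simp

text \<open>Comparing \<open>f\<close> with its heat flow at the time when the flow has dropped below half
  of the top level replaces the isoperimetric inequality.\<close>

lemma top_level_measure_le:
  assumes [measurable]: "E \<in> sets borel" and E: "\<And>x. x \<in> E \<Longrightarrow> f x = H"
  shows "ennreal H * emeasure lborel E \<le>
    ennreal (2 * heat_moment TYPE('a) / heat_mass TYPE('a) * (2 / heat_mass TYPE('a)) powr (1 / real DIM('a)) *
      a * m powr (1 / real DIM('a)))"
proof -
  let ?Z = "heat_mass TYPE('a)" and ?D = "real DIM('a)"
  have Z: "0 < ?Z" by (rule heat_mass_pos)
  \<comment> \<open>The time at which the decay bound \<open>t powr (- D / 2) * (H * m)\<close> on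
    the flow equals half of \<open>?Z * H\<close>, the value of \<open>?Z * f\<close> on
    \<open>E\<close>.\<close>
  define t where "t = (2 * m / ?Z) powr (2 / ?D)"
  have t: "0 < t" using pos Z by (simp add: t_def)
  have tD: "t powr (- (?D / 2)) = ?Z / (2 * m)"
    using pos Z by (simp add: t_def powr_powr powr_minus field_simps)
  have st: "sqrt t = (2 / ?Z) powr (1 / ?D) * m powr (1 / ?D)"
    using pos Z by (simp add: t_def powr_half_sqrt[symmetric] powr_powr powr_mult[symmetric])
  have small: "\<bar>conv (heat t) f x\<bar> \<le> ?Z * H / 2" for x
  proof -
    have "L1_norm (\<lambda>y. heat t (x - y) * f y) \<le> ennreal (t powr (- (?D / 2)) * (H * m))"
      using int_f pos heat_le[OF t] by (intro nn_conv_le_L1) auto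
    also have "t powr (- (?D / 2)) * (H * m) = ?Z * H / 2"
      using pos by (simp add: tD)
    finally show ?thesis
      unfolding conv_def using Z pos by (intro abs_integral_leI) auto
  qed
  have "ennreal (?Z * H / 2) * emeasure lborel E = (\<integral>\<^sup>+x. ennreal (?Z * H / 2) * indicator E x \<partial>lborel)"
    by (simp add: nn_integral_cmult_indicator)
  also have "\<dots> \<le> L1_norm (\<lambda>x. conv (heat t) f x - (LINT y|lborel. heat t (y::'a)) * f x)"
  proof (intro nn_integral_mono)
    fix x
    show "ennreal (?Z * H / 2) * indicator E x \<le> ennreal \<bar>conv (heat t) f x - (LINT y|lborel. heat t (y::'a)) * f x\<bar>"
    proof (cases "x \<in> E")
      case True
      then show ?thesis
        using small[of x] unfolding E[OF True] integral_heat[OF t] abs_le_iff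
        by (simp add: ennreal_leI mult.commute[of H])
    qed simp
  qed
  also have "\<dots> \<le> ennreal a * (\<integral>\<^sup>+y. ennreal (\<bar>heat t (y::'a)\<bar> * norm y) \<partial>lborel)"
    using t pos disp abs_f_le by (intro nn_integral_conv_diff_le integrable_heat) auto
  also have "\<dots> = ennreal (a * (sqrt t * heat_moment TYPE('a)))"
    using t pos nn_integral_heat_norm[OF t, where 'a='a] by (simp add: ennreal_mult'[symmetric])
  finally have "ennreal (2 / ?Z) * (ennreal (?Z * H / 2) * emeasure lborel E) \<le> ennreal (2 / ?Z) * ennreal (a * (sqrt t * heat_moment TYPE('a)))"
    by (intro mult_left_mono) auto
  moreover have "ennreal (2 / ?Z) * (ennreal (?Z * H / 2) * emeasure lborel E) = ennreal H * emeasure lborel E"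
    using Z by (simp add: mult.assoc[symmetric] ennreal_mult'[symmetric])
  moreover have "ennreal (2 / ?Z) * ennreal (a * (sqrt t * heat_moment TYPE('a))) =
    ennreal (2 / ?Z * (a * (sqrt t * heat_moment TYPE('a))))"
    using Z by (intro ennreal_mult'[symmetric]) simp
  moreover have "2 / ?Z * (a * (sqrt t * heat_moment TYPE('a))) =
    2 * heat_moment TYPE('a) / ?Z * (2 / ?Z) powr (1 / ?D) * a * m powr (1 / ?D)"
    by (simp add: st)
  ultimately show ?thesis by (simp only:)
qed

text \<open>Minkowski's inequality in time with \<open>B t\<close> bounding the
  \<open>L\<^sup>p\<close> norm of the flow density. Up to time \<open>T\<close> the sup bound
  \<open>K * H / t\<close> is interpolated with the cancellation bound
  \<open>a * K * t powr (- 1 / 2)\<close>; afterwards the two kernel bounds with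
  \<open>H * m\<close> are used. Here \<open>a\<close> must be positive so that \<open>B\<close>
  vanishes only at nonpositive times.\<close>

lemma heat_flow_epow_le:
  fixes \<alpha> :: real
  defines "p \<equiv> real DIM('a) / (real DIM('a) - \<alpha>)"
  assumes \<alpha>: "0 < \<alpha>" "\<alpha> < real DIM('a)" and D2: "2 \<le> DIM('a)" and "0 < a"
  shows "(\<integral>\<^sup>+x. epow p (time_int (\<lambda>t. flow_dens \<alpha> t f x)) \<partial>lborel) \<le>
    ennreal ((level_const TYPE('a) * (2 * real DIM('a) / (\<alpha> * (real DIM('a) - 1)) + 2) *
      (a + H * m powr (1 - 1 / real DIM('a)))) powr p)"
proof -
  let ?D = "real DIM('a)" and ?K = "level_const TYPE('a)"
  let ?E = "\<lambda>t. \<integral>\<^sup>+x. epow p (flow_dens \<alpha> t f x * pos_ind t) \<partial>lborel"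
  \<comment> \<open>\<open>1 / p = 1 - \<theta>\<close>, so interpolation raises the sup bound to
    the power \<theta> and the \<open>L\<^sup>1\<close> bound to the power
    \<open>1 - \<theta>\<close>.\<close>
  define \<theta> where "\<theta> = \<alpha> / ?D"
  define e where "e = \<alpha> / 2 - 1 - \<theta> / 2"
  \<comment> \<open>The parabolic time scale of a set of measure \<open>m\<close>: cutting here
    makes both time integrals expressions in \<open>a\<close> and \<open>b\<close> alone.\<close>
  define T where "T = m powr (2 / ?D)"
  define b where "b = H * m powr (1 - 1 / ?D)"
  define B where "B t = (if t \<le> 0 then 0 else if t \<le> T then ?K * H powr \<theta> * a powr (1 - \<theta>) * t powr e
    else ?K * (H * m) * t powr (- (3 / 2)))" for t
  have D: "2 \<le> ?D" using D2 by simp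
  have \<theta>: "0 < \<theta>" "\<theta> < 1" using \<alpha> D by (auto simp: \<theta>_def)
  have p: "1 < p" "1 / p = 1 - \<theta>" "p * \<theta> = p - 1" "p * (1 - \<theta>) = 1" "p * ?D - ?D = p * \<alpha>"
    using \<alpha> D by (auto simp: p_def \<theta>_def field_simps)
  have K: "0 < ?K" using level_const_bounds(1)[of 1] by simp
  have T: "0 < T" using pos by (simp add: T_def)
  \<comment> \<open>Integrability at time 0, valid for every admissible \<alpha> as soon as the
    dimension is at least 2.\<close>
  have e1: "e + 1 = \<theta> * (?D - 1) / 2"
    using D by (simp add: e_def \<theta>_def field_simps)
  have e1_pos: "0 < e + 1" unfolding e1 using \<theta> D by simp
  have B0: "0 \<le> B t" for t using K pos by (simp add: B_def)
  have [measurable]: "B \<in> borel_measurable borel" unfolding B_def by measurable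
  define S where "S = ?K * H powr \<theta> * a powr (1 - \<theta>) * (T powr (e + 1) / (e + 1)) + ?K * (H * m) * (2 * T powr (- (1 / 2)))"
  have S0: "0 \<le> S" unfolding S_def using K pos e1_pos by (intro add_nonneg_nonneg mult_nonneg_nonneg) auto
  have BS: "(\<integral>\<^sup>+t. ennreal (B t) \<partial>lborel) = ennreal S"
  proof -
    have "(\<integral>\<^sup>+t. ennreal (B t) \<partial>lborel) =
      (\<integral>\<^sup>+t. ennreal (?K * H powr \<theta> * a powr (1 - \<theta>)) * (ennreal (t powr e) * indicator {0<..T} t) +
       ennreal (?K * (H * m)) * (ennreal (t powr (- (3 / 2))) * indicator {T<..} t) \<partial>lborel)"
      using T K pos by (intro nn_integral_cong) (auto simp: B_def indicator_def ennreal_mult)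
    also have "\<dots> = ennreal (?K * H powr \<theta> * a powr (1 - \<theta>)) * ennreal (T powr (e + 1) / (e + 1)) +
      ennreal (?K * (H * m)) * ennreal (2 * T powr (- (1 / 2)))"
    proof -
      have "- 1 < e" using e1_pos by simp
      moreover have "(\<integral>\<^sup>+t\<in>{T<..}. ennreal (t powr (- (3 / 2))) \<partial>lborel) = ennreal (2 * T powr (- (1 / 2)))"
        using nn_integral_powr_Ioi[of "- (3 / 2)" T] T by (simp add: mult.commute)
      moreover have "(\<integral>\<^sup>+t. c1 * (ennreal (t powr e) * indicator {0<..T} t) +
          c2 * (ennreal (t powr (- (3 / 2))) * indicator {T<..} t) \<partial>lborel) =
        c1 * (\<integral>\<^sup>+t\<in>{0<..T}. ennreal (t powr e) \<partial>lborel) +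
        c2 * (\<integral>\<^sup>+t\<in>{T<..}. ennreal (t powr (- (3 / 2))) \<partial>lborel)" for c1 c2
        by (simp add: nn_integral_add nn_integral_cmult)
      ultimately show ?thesis
        using T by (simp only: nn_integral_powr_Ioc order.strict_implies_order)
    qed
    also have "\<dots> = ennreal S"
    proof -
      have "ennreal c1 * ennreal c2 + ennreal c3 * ennreal c4 = ennreal (c1 * c2 + c3 * c4)"
        if "0 \<le> c1" "0 \<le> c2" "0 \<le> c3" "0 \<le> c4" for c1 c2 c3 c4
        using that by (simp add: ennreal_mult ennreal_plus)
      then show ?thesis
        unfolding S_def using K pos e1_pos by auto
    qed
    finally show ?thesis .
  qed
  have Sle: "S \<le> ?K * (2 * ?D / (\<alpha> * (?D - 1)) + 2) * (a + b)"
  proof -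
    have b: "0 < b" using pos by (simp add: b_def)
    have "T powr (e + 1) = (m powr (1 - 1 / ?D)) powr \<theta>"
      unfolding e1 T_def powr_powr using D by (intro arg_cong[where f="(powr) m"]) (simp add: field_simps)
    then have b1: "H powr \<theta> * T powr (e + 1) = b powr \<theta>"
      using pos by (simp add: b_def powr_mult)
    have "m * T powr (- (1 / 2)) = m powr (1 - 1 / ?D)"
    proof -
      have "T powr (- (1 / 2)) = m powr (- (1 / ?D))"
        unfolding T_def powr_powr by (intro arg_cong[where f="(powr) m"]) simp
      then show ?thesis
        using pos powr_add[of m 1 "- (1 / ?D)"] by simp
    qed
    then have b2: "H * (m * T powr (- (1 / 2))) = b"
      by (simp add: b_def)
    have "S = ?K * (1 / (e + 1) * ((H powr \<theta> * T powr (e + 1)) * a powr (1 - \<theta>)) + 2 * (H * (m * T powr (- (1 / 2)))))"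
      by (simp add: S_def distrib_left mult_ac)
    also have "\<dots> = ?K * (1 / (e + 1) * (b powr \<theta> * a powr (1 - \<theta>)) + 2 * b)"
      unfolding b1 b2 ..
    \<comment> \<open>The weighted inequality of arithmetic and geometric means turns the product of
      powers into a sum, which can later be summed over the slices.\<close>
    also have "\<dots> \<le> ?K * (1 / (e + 1) * (\<theta> * b + (1 - \<theta>) * a) + 2 * b)"
      using K e1_pos \<theta> b \<open>0 < a\<close> by (intro mult_left_mono add_right_mono Youngs_inequality_0) auto
    also have "\<dots> \<le> ?K * (1 / (e + 1) * (1 * b + 1 * a) + 2 * (a + b))"
      using K e1_pos \<theta> b \<open>0 < a\<close> by (intro mult_left_mono add_mono mult_right_mono) auto
    also have "1 / (e + 1) = 2 * ?D / (\<alpha> * (?D - 1))"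
      unfolding e1 using D \<alpha> by (simp add: \<theta>_def)
    finally show ?thesis by (simp add: algebra_simps)
  qed
  have "(\<integral>\<^sup>+x. epow p (time_int (\<lambda>t. flow_dens \<alpha> t f x)) \<partial>lborel) \<le> ennreal (S powr p)"
  proof (rule lborel_pair.epow_minkowski[OF _ _ _ S0 _ _ _ BS])
    show "(\<lambda>(x, t). flow_dens \<alpha> t f x * pos_ind t) \<in> borel_measurable (lborel \<Otimes>\<^sub>M lborel)"
      unfolding conv_def by measurable
    show "B t = 0 \<Longrightarrow> flow_dens \<alpha> t f x * pos_ind t = 0" for x t
      using K pos T \<open>0 < a\<close> by (auto simp: B_def split: if_splits)
    fix t
    show "?E t \<le> ennreal (B t powr p)"
    proof (cases "0 < t")
      case t: True
      have *: "?E t \<le>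
         ennreal ((t powr ((\<alpha> - 1) / 2)) powr p * (A powr (p - 1) * L))"
        if "\<And>x. \<bar>conv (dheat t) f x\<bar> \<le> A" "L1_norm (conv (dheat t) f) \<le> ennreal L" "0 \<le> L" for A L
      proof -
        have "?E t =
          (\<integral>\<^sup>+x. ennreal ((t powr ((\<alpha> - 1) / 2)) powr p) * epow p (ennreal \<bar>conv (dheat t) f x\<bar>) \<partial>lborel)"
          using t by (intro nn_integral_cong) (simp add: epow_ennreal powr_mult ennreal_mult'[symmetric])
        also have "\<dots> \<le> ennreal ((t powr ((\<alpha> - 1) / 2)) powr p) * ennreal (A powr (p - 1) * L)"
          using nn_integral_epow_interpolate[OF _ p(1) that] by (simp add: nn_integral_cmult mult_left_mono)
        finally show ?thesis by (simp add: ennreal_mult')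
      qed
      show ?thesis
      proof (cases "t \<le> T")
        case True
        have "?E t \<le>
          ennreal ((t powr ((\<alpha> - 1) / 2)) powr p * ((?K / t * H) powr (p - 1) * (a * (?K * t powr (- 1 / 2)))))"
        proof (rule *)
          show "\<bar>conv (dheat t) f x\<bar> \<le> ?K / t * H" for x
            unfolding conv_def using level_const_bounds(3)[OF t, where 'a='a] abs_f_le K t pos
            by (intro abs_integral_leI nn_conv_le_sup) auto
          \<comment> \<open>The subtracted term is zero; written this way, the displacement bound
            applies.\<close>
          have "L1_norm (conv (dheat t) f) = L1_norm (\<lambda>x. conv (dheat t) f x - (LINT y|lborel. dheat t (y::'a)) * f x)"
            by (simp add: integral_dheat[OF t])
          also have "\<dots> \<le> ennreal a * (\<integral>\<^sup>+y. ennreal (\<bar>dheat t (y::'a)\<bar> * norm y) \<partial>lborel)"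
            using t pos disp abs_f_le by (intro nn_integral_conv_diff_le integrable_dheat) auto
          also have "\<dots> \<le> ennreal a * ennreal (?K * t powr (- 1 / 2))"
            by (intro mult_left_mono level_const_bounds t) auto
          finally show "L1_norm (conv (dheat t) f) \<le> ennreal (a * (?K * t powr (- 1 / 2)))"
            using pos by (simp add: ennreal_mult')
        qed (use K pos in auto)
        also have "(t powr ((\<alpha> - 1) / 2)) powr p * ((?K / t * H) powr (p - 1) * (a * (?K * t powr (- 1 / 2)))) =
          (?K powr (p - 1) * ?K powr 1) * H powr (p - 1) * a * (t powr ((\<alpha> - 1) / 2 * p) * (t powr (- (p - 1)) * t powr (- 1 / 2)))"
        proof -
          have "(?K / t * H) powr (p - 1) = ?K powr (p - 1) * t powr (- (p - 1)) * H powr (p - 1)"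
            using K t pos powr_minus[of t "p - 1"] inverse_powr[of t "p - 1"]
            by (simp only: powr_mult powr_divide divide_inverse)
          then show ?thesis
            using K by (simp only: powr_powr powr_one mult_ac)
        qed
        also have "\<dots> = ?K powr p * H powr (\<theta> * p) * a powr ((1 - \<theta>) * p) * t powr (e * p)"
        proof -
          have "(\<alpha> - 1) / 2 * p + (- (p - 1) + - 1 / 2) = e * p"
          proof -
            have "e * p = \<alpha> * p / 2 - p - p * \<theta> / 2"
              by (simp add: e_def algebra_simps)
            then show ?thesis unfolding p(3) by (simp add: field_simps)
          qed
          then show ?thesis
            using p \<open>0 < a\<close> unfolding powr_add[symmetric] by (simp add: mult.commute[of _ p])
        qed
        also have "\<dots> = B t powr p"
          using True t K pos \<open>0 < a\<close> by (simp add: B_def powr_mult powr_powr)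
        finally show ?thesis .
      next
        case False
        have "?E t \<le>
          ennreal ((t powr ((\<alpha> - 1) / 2)) powr p * ((?K * t powr (- 1 - ?D / 2) * (H * m)) powr (p - 1) * (?K / t * (H * m))))"
        proof (rule *)
          show "\<bar>conv (dheat t) f x\<bar> \<le> ?K * t powr (- 1 - ?D / 2) * (H * m)" for x
            unfolding conv_def using level_const_bounds(2)[OF t, where 'a='a] int_f K t pos
            by (intro abs_integral_leI nn_conv_le_L1) auto
          have "L1_norm (conv (dheat t) f) \<le> ennreal (?K / t) * ennreal (H * m)"
            using int_f level_const_bounds(3)[OF t, where 'a='a]
            by (intro order_trans[OF nn_integral_conv_le] mult_mono) auto
          then show "L1_norm (conv (dheat t) f) \<le> ennreal (?K / t * (H * m))"
            using K t by (subst ennreal_mult') auto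
        qed (use K t pos in auto)
        also have "(t powr ((\<alpha> - 1) / 2)) powr p * ((?K * t powr (- 1 - ?D / 2) * (H * m)) powr (p - 1) * (?K / t * (H * m))) =
          (?K powr (p - 1) * ?K powr 1) * ((H * m) powr (p - 1) * (H * m) powr 1) *
          (t powr ((\<alpha> - 1) / 2 * p) * (t powr ((- 1 - ?D / 2) * (p - 1)) * t powr (- 1)))"
        proof -
          have "(?K * t powr (- 1 - ?D / 2) * (H * m)) powr (p - 1) =
            ?K powr (p - 1) * t powr ((- 1 - ?D / 2) * (p - 1)) * (H * m) powr (p - 1)"
            using K t pos by (simp only: powr_mult powr_powr)
          moreover have "?K / t * (H * m) = ?K powr 1 * t powr (- 1) * (H * m) powr 1"
            using K t pos by (simp add: powr_minus_divide)
          ultimately show ?thesis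
            by (simp only: powr_powr mult_ac)
        qed
        also have "\<dots> = ?K powr p * (H * m) powr p * t powr (- (3 / 2) * p)"
        proof -
          have "(\<alpha> - 1) / 2 * p + ((- 1 - ?D / 2) * (p - 1) + - 1) = - (3 / 2) * p"
            using p(5) by (simp add: field_simps)
          then show ?thesis
            unfolding powr_add[symmetric] by simp
        qed
        also have "\<dots> = B t powr p"
          using False t K pos by (simp add: B_def powr_mult powr_powr)
        finally show ?thesis .
      qed
    qed (simp add: B_def)
  qed (use B0 p in auto)
  also have "\<dots> \<le> ennreal ((?K * (2 * ?D / (\<alpha> * (?D - 1)) + 2) * (a + b)) powr p)"
    using S0 Sle p(1) by (intro ennreal_leI powr_mono2) auto
  finally show ?thesis by (simp add: b_def)
qed

end

text \<open>Minkowski's inequality again, now with counting measure as the second factor.\<close>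

lemma epow_suminf_le:
  fixes F :: "nat \<Rightarrow> 'a::euclidean_space \<Rightarrow> ennreal"
  assumes [measurable]: "\<And>k. F k \<in> borel_measurable borel"
    and "1 < p" "\<And>k. 0 \<le> B k" "\<And>k x. B k = 0 \<Longrightarrow> F k x = 0"
    and "\<And>k. (\<integral>\<^sup>+x. epow p (F k x) \<partial>lborel) \<le> ennreal (B k powr p)"
    and "summable B"
  shows "(\<integral>\<^sup>+x. epow p (\<Sum>k. F k x) \<partial>lborel) \<le> ennreal (suminf B powr p)"
proof -
  interpret C: sigma_finite_measure "count_space (UNIV :: nat set)"
    by (rule sigma_finite_measure_count_space)
  interpret pair_sigma_finite "lborel :: 'a measure" "count_space (UNIV :: nat set)" ..
  have "(\<lambda>p. F (snd p) (fst p)) \<in> borel_measurable (lborel \<Otimes>\<^sub>M count_space UNIV)"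
    by (rule measurable_compose_countable[where f="\<lambda>k p. F k (fst p)" and g=snd]) measurable
  then have "case_prod (\<lambda>x k. F k x) \<in> borel_measurable (lborel \<Otimes>\<^sub>M count_space UNIV)"
    by (simp add: case_prod_beta')
  moreover have "(\<integral>\<^sup>+k. ennreal (B k) \<partial>count_space UNIV) = ennreal (suminf B)"
    using assms by (simp add: nn_integral_count_space_nat suminf_ennreal2)
  ultimately have "(\<integral>\<^sup>+x. epow p (\<integral>\<^sup>+k. F k x \<partial>count_space UNIV) \<partial>lborel) \<le> ennreal (suminf B powr p)"
    using assms by (intro epow_minkowski) (auto intro: suminf_nonneg)
  then show ?thesis by (simp add: nn_integral_count_space_nat)
qed

lemma epow_add_le:
  assumes "1 < p"
  shows "epow p (x + y) \<le> ennreal (2 powr p) * (epow p x + epow p y)"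
proof (cases "x = top \<or> y = top")
  case True
  then show ?thesis by (auto simp: ennreal_mult_top)
next
  case False
  then obtain r s where rs: "x = ennreal r" "y = ennreal s" "0 \<le> r" "0 \<le> s"
    by (cases x; cases y) auto
  have "(r + s) powr p \<le> (2 * max r s) powr p"
    using rs assms by (intro powr_mono2) auto
  also have "\<dots> \<le> 2 powr p * (r powr p + s powr p)"
    using rs by (auto simp: powr_mult max_def)
  finally show ?thesis
    using rs by (simp add: epow_ennreal ennreal_mult'[symmetric] ennreal_plus[symmetric] del: ennreal_plus)
qed

subsection \<open>Truncations of a continuously differentiable function\<close>

definition slice :: "real \<Rightarrow> real \<Rightarrow> real \<Rightarrow> real" where
  "slice a b s = max a (min b s) - a"

lemma slice_add: "c \<le> a \<Longrightarrow> a \<le> b \<Longrightarrow> slice c a s + slice a b s = slice c b s"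
  by (auto simp: slice_def max_def min_def)

text \<open>After the last time the path is at or below the larger of \<open>a\<close> and its starting value, it
  stays inside the open interval until it reaches the smaller of \<open>b\<close> and its end value.\<close>

lemma slice_path_le:
  fixes \<phi> \<phi>' :: "real \<Rightarrow> real"
  assumes deriv: "\<And>s. (\<phi> has_real_derivative \<phi>' s) (at s)" and cont: "\<And>s. isCont \<phi>' s" and "a \<le> b"
  shows "ennreal \<bar>slice a b (\<phi> 1) - slice a b (\<phi> 0)\<bar> \<le>
    (\<integral>\<^sup>+s\<in>{0..1}. ennreal (\<bar>\<phi>' s\<bar> * indicator {a<..<b} (\<phi> s)) \<partial>lborel)"
proof -
  have *: "ennreal \<bar>slice a b (\<phi> 1) - slice a b (\<phi> 0)\<bar> \<le>
      (\<integral>\<^sup>+s\<in>{0..1}. ennreal (\<bar>\<phi>' s\<bar> * indicator {a<..<b} (\<phi> s)) \<partial>lborel)"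
    if deriv: "\<And>s. (\<phi> has_real_derivative \<phi>' s) (at s)" and cont: "\<And>s. isCont \<phi>' s"
      and less: "slice a b (\<phi> 0) < slice a b (\<phi> 1)" for \<phi> \<phi>' :: "real \<Rightarrow> real"
  proof -
    \<comment> \<open>The values at both ends clipped to the interval from \<open>a\<close> to
      \<open>b\<close>, so that \<open>d - c\<close> is the increment of the slice.\<close>
    define c d where "c = max a (min b (\<phi> 0))" and "d = max a (min b (\<phi> 1))"
    have cd: "c < d" "\<phi> 0 \<le> c" "d \<le> \<phi> 1" "a \<le> c" "d \<le> b"
      using less \<open>a \<le> b\<close> by (auto simp: c_def d_def slice_def max_def min_def split: if_splits)
    have cont\<phi>: "continuous_on A \<phi>" for A
      using deriv by (intro continuous_at_imp_continuous_on ballI DERIV_isCont)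
    have "compact ({0..1} \<inter> \<phi> -` {..c})"
      using continuous_closed_preimage[OF cont\<phi> closed_atLeastAtMost closed_atMost]
      by (intro compact_Int_closed[of "{0..1}" "{0..1} \<inter> \<phi> -` {..c}", simplified]) auto
    moreover have "0 \<in> {0..1} \<inter> \<phi> -` {..c}" using cd by auto
    then have "{0..1} \<inter> \<phi> -` {..c} \<noteq> {}" by blast
    ultimately obtain s0 where s0: "s0 \<in> {0..1}" "\<phi> s0 \<le> c" "\<And>s. s \<in> {0..1} \<Longrightarrow> \<phi> s \<le> c \<Longrightarrow> s \<le> s0"
      using compact_attains_sup[of "{0..1} \<inter> \<phi> -` {..c}"] by fastforce
    have "compact ({s0..1} \<inter> \<phi> -` {d..})"
      using continuous_closed_preimage[OF cont\<phi> closed_atLeastAtMost closed_atLeast]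
      by (intro compact_Int_closed[of "{s0..1}" "{s0..1} \<inter> \<phi> -` {d..}", simplified]) auto
    moreover have "1 \<in> {s0..1} \<inter> \<phi> -` {d..}" using cd s0 by auto
    then have "{s0..1} \<inter> \<phi> -` {d..} \<noteq> {}" by blast
    ultimately obtain s1 where s1: "s1 \<in> {s0..1}" "d \<le> \<phi> s1" "\<And>s. s \<in> {s0..1} \<Longrightarrow> d \<le> \<phi> s \<Longrightarrow> s1 \<le> s"
      using compact_attains_inf[of "{s0..1} \<inter> \<phi> -` {d..}"] by fastforce
    have "d - c \<le> \<phi> s1 - \<phi> s0" using s0 s1 by auto
    also have "\<phi> s1 - \<phi> s0 = (LINT s|lborel. \<phi>' s * indicator {s0..s1} s)"
      using s1 deriv cont by (intro integral_FTC_Icc_real[symmetric]) auto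
    also have "\<dots> \<le> \<bar>LINT s|lborel. \<phi>' s * indicator {s0..s1} s\<bar>" by simp
    finally have "ennreal (d - c) \<le> ennreal \<bar>LINT s|lborel. \<phi>' s * indicator {s0..s1} s\<bar>"
      by (rule ennreal_leI)
    also have "\<dots> \<le> L1_norm (\<lambda>s. \<phi>' s * indicator {s0..s1} s)"
      by (rule abs_integral_le_nn_integral)
    also have "\<dots> \<le> (\<integral>\<^sup>+s\<in>{0..1}. ennreal (\<bar>\<phi>' s\<bar> * indicator {a<..<b} (\<phi> s)) \<partial>lborel)"
    proof (rule nn_integral_mono_AE)
      show "AE s in lborel. ennreal \<bar>\<phi>' s * indicator {s0..s1} s\<bar> \<le>
        ennreal (\<bar>\<phi>' s\<bar> * indicator {a<..<b} (\<phi> s)) * indicator {0..1} s"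
        using AE_lborel_singleton[of s0] AE_lborel_singleton[of s1]
      proof eventually_elim
        case (elim s)
        show ?case
        proof (cases "s0 < s \<and> s < s1")
          case True
          then have "c < \<phi> s" "\<phi> s < d" "s \<in> {0..1}"
            using s0(1) s1(1) s0(3)[of s] s1(3)[of s] by (auto simp: not_le[symmetric])
          then show ?thesis using cd by (simp add: indicator_def)
        next
          case False
          then show ?thesis using elim by (auto simp: indicator_def)
        qed
      qed
    qed
    also have "d - c = \<bar>slice a b (\<phi> 1) - slice a b (\<phi> 0)\<bar>"
      using cd by (simp add: slice_def c_def d_def)
    finally show ?thesis .
  qed
  consider "slice a b (\<phi> 0) < slice a b (\<phi> 1)" | "slice a b (\<phi> 1) < slice a b (\<phi> 0)"
    | "slice a b (\<phi> 1) = slice a b (\<phi> 0)" by linarith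
  then show ?thesis
  proof cases
    case 1
    then show ?thesis by (intro * deriv cont)
  next
    case 2
    have [measurable]: "\<phi> \<in> borel_measurable borel" "\<phi>' \<in> borel_measurable borel"
      using cont by (auto intro!: borel_measurable_continuous_onI continuous_at_imp_continuous_on simp: DERIV_isCont[OF deriv])
    \<comment> \<open>A decreasing increment is handled by running the path backwards.\<close>
    have "ennreal \<bar>slice a b (\<phi> (1 - 1)) - slice a b (\<phi> (1 - 0))\<bar> \<le>
       (\<integral>\<^sup>+s\<in>{0..1}. ennreal (\<bar>- \<phi>' (1 - s)\<bar> * indicator {a<..<b} (\<phi> (1 - s))) \<partial>lborel)"
    proof (rule *)
      show "((\<lambda>s. \<phi> (1 - s)) has_real_derivative - \<phi>' (1 - s)) (at s)" for s
      proof -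
        have "((\<lambda>s. 1 - s) has_real_derivative - 1) (at s)"
          by (auto intro!: derivative_eq_intros)
        then show ?thesis
          using DERIV_chain2[where f=\<phi> and g="\<lambda>s. 1 - s" and x=s and s=UNIV, OF deriv] by fastforce
      qed
      show "isCont (\<lambda>s. - \<phi>' (1 - s)) s" for s
        using cont by (intro continuous_intros isCont_o2[OF _ cont])
    qed (use 2 in simp)
    also have "\<dots> = (\<integral>\<^sup>+s. (\<lambda>s. ennreal (\<bar>\<phi>' s\<bar> * indicator {a<..<b} (\<phi> s)) * indicator {0..1} s) (1 - s) \<partial>lborel)"
      by (intro nn_integral_cong) (auto simp: indicator_def)
    also have "\<dots> = (\<integral>\<^sup>+s\<in>{0..1}. ennreal (\<bar>\<phi>' s\<bar> * indicator {a<..<b} (\<phi> s)) \<partial>lborel)"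
      by (rule nn_integral_lborel_reflect) measurable
    finally show ?thesis by (simp add: abs_minus_commute)
  qed simp
qed

text \<open>Summing the recursion reproduces the sum of \<open>b\<close> up to boundary terms, and
  half of it is absorbed on the left. The a priori bound \<open>M\<close> serves to obtain
  summability; then \<open>b n\<close> tends to 0, so \<open>M\<close> leaves no trace in the final
  estimate.\<close>

lemma absorb_half_sum:
  fixes a b :: "nat \<Rightarrow> real"
  assumes b: "\<And>k. 0 \<le> b k" "\<And>k. b k \<le> M" and rec: "\<And>k. b k \<le> b (Suc k) / 2 + c * a k"
    and a: "\<And>n. (\<Sum>k<n. a k) \<le> A" and "0 \<le> c"
  shows "summable b" "suminf b \<le> 2 * c * A"
proof -
  have S: "(\<Sum>k<n. b k) \<le> b n + 2 * c * A" for n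
  proof -
    have "(\<Sum>k<n. b k) \<le> (\<Sum>k<n. b (Suc k) / 2 + c * a k)"
      by (intro sum_mono rec)
    also have "\<dots> = (\<Sum>k<n. b (Suc k)) / 2 + c * (\<Sum>k<n. a k)"
      by (simp add: sum.distrib sum_divide_distrib sum_distrib_left)
    also have "(\<Sum>k<n. b (Suc k)) = (\<Sum>k<n. b k) + b n - b 0"
      by (induction n) auto
    finally have "(\<Sum>k<n. b k) \<le> ((\<Sum>k<n. b k) + b n - b 0) / 2 + c * (\<Sum>k<n. a k)" .
    moreover have "c * (\<Sum>k<n. a k) \<le> c * A"
      using a \<open>0 \<le> c\<close> by (rule mult_left_mono)
    moreover have "x \<le> y + 2 * z" if "x \<le> (x + y - w) / 2 + r" "r \<le> z" "0 \<le> w" for x y z w r :: real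
    proof -
      have "2 * x \<le> x + y - w + 2 * r" using that(1) by (simp add: field_simps)
      then show ?thesis using that(2,3) by linarith
    qed
    ultimately have "(\<Sum>k<n. b k) \<le> b n + 2 * (c * A)" using b(1)[of 0] by blast
    then show ?thesis by (simp add: mult.assoc)
  qed
  show "summable b"
  proof (rule bounded_imp_summable)
    show "(\<Sum>k\<le>n. b k) \<le> M + 2 * c * A" for n
      using S[of "Suc n"] b(2)[of "Suc n"] by (simp add: lessThan_Suc_atMost)
  qed (rule b)
  then have "b \<longlonglongrightarrow> 0" "(\<lambda>n. \<Sum>k<n. b k) \<longlonglongrightarrow> suminf b"
    by (auto intro: summable_LIMSEQ_zero summable_LIMSEQ)
  then have "suminf b \<le> 0 + 2 * c * A"
    using S by (intro LIMSEQ_le[OF _ tendsto_add[OF _ tendsto_const]]) auto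
  then show "suminf b \<le> 2 * c * A" by simp
qed

section \<open>Dyadic slices of a positive part and the sum of their flows\<close>

definition iso_const :: "'a::euclidean_space itself \<Rightarrow> real" where
  "iso_const _ = 2 * heat_moment TYPE('a) / heat_mass TYPE('a) * (2 / heat_mass TYPE('a)) powr (1 / real DIM('a))"

lemma iso_const_nonneg: "0 \<le> iso_const TYPE('a::euclidean_space)"
  using heat_moment_nonneg[where 'a='a] heat_mass_nonneg[where 'a='a] by (simp add: iso_const_def)

definition flow :: "real \<Rightarrow> ('a::euclidean_space \<Rightarrow> real) \<Rightarrow> 'a \<Rightarrow> ennreal" where
  "flow \<alpha> f x = time_int (\<lambda>t. flow_dens \<alpha> t f x)"

lemma flow_measurable [measurable]:
  fixes f :: "'a::euclidean_space \<Rightarrow> real"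
  assumes [measurable]: "f \<in> borel_measurable borel"
  shows "flow \<alpha> f \<in> borel_measurable borel"
  unfolding flow_def conv_def by measurable

definition flow_const :: "'a::euclidean_space itself \<Rightarrow> real \<Rightarrow> real" where
  "flow_const _ \<alpha> = level_const TYPE('a) * (2 * real DIM('a) / (\<alpha> * (real DIM('a) - 1)) + 2)"

text \<open>The bounds on \<open>v\<close> are one-sided because just its positive part is sliced;
  the negative part is reached by applying the locale to \<open>- v\<close>. The constant
  \<open>C0\<close> has a qualitative role: it makes the level weights finite and bounded.\<close>

locale c1_decaying =
  fixes v :: "'a::euclidean_space \<Rightarrow> real" and g :: "'a \<Rightarrow> 'a" and L C0 :: real
  assumes cont_v: "continuous_on UNIV v" and cont_g: "continuous_on UNIV g"
    and deriv: "\<And>x h. ((\<lambda>s. v (x + s *\<^sub>R h)) has_real_derivative (g x \<bullet> h)) (at 0)"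
    and L_pos: "0 < L" and v_le: "\<And>x. v x \<le> L"
    and decay: "\<And>x. v x * norm x ^ (DIM('a) - 1) \<le> C0"
    and int_g: "integrable lborel (\<lambda>x. norm (g x))"
    and dim: "2 \<le> DIM('a)"
begin

lemma v_measurable [measurable]: "v \<in> borel_measurable borel"
  using cont_v by (rule borel_measurable_continuous_onI)

lemma g_measurable [measurable]: "g \<in> borel_measurable borel"
  using cont_g by (rule borel_measurable_continuous_onI)

text \<open>\<open>lev\<close>, \<open>grad_mass\<close> and \<open>wt\<close> are the
  \<open>\<lambda>\<^sub>k\<close>, \<open>a\<^sub>k\<close> and \<open>b\<^sub>k\<close> of the
  overview.\<close>

definition lev :: "nat \<Rightarrow> real" where "lev k = L / 2 ^ k"

definition trunc :: "nat \<Rightarrow> 'a \<Rightarrow> real" where "trunc k x = slice (lev (Suc k)) (lev k) (v x)"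

definition grad_mass :: "nat \<Rightarrow> real" where
  "grad_mass k = (LINT x|lborel. norm (g x) * indicator {lev (Suc k)<..<lev k} (v x))"

definition super :: "nat \<Rightarrow> real" where "super k = measure lborel {x. lev k < v x}"

definition wt :: "nat \<Rightarrow> real" where "wt k = lev k * super k powr (1 - 1 / real DIM('a))"

lemma lev_pos: "0 < lev k" using L_pos by (simp add: lev_def)

lemma lev_Suc: "lev k = 2 * lev (Suc k)" by (simp add: lev_def)

lemma lev_mono: "lev (Suc k) \<le> lev k" using lev_pos[of "Suc k"] lev_Suc[of k] by simp

lemma lev_diff: "lev k - lev (Suc k) = lev (Suc k)" using lev_Suc[of k] by simp

lemma trunc_measurable [measurable]: "trunc k \<in> borel_measurable borel"
  unfolding trunc_def slice_def by measurable

lemma trunc_nonneg: "0 \<le> trunc k x" by (simp add: trunc_def slice_def)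

lemma trunc_le: "trunc k x \<le> lev (Suc k)"
  using lev_diff[of k] lev_mono[of k] by (auto simp: trunc_def slice_def max_def min_def)

lemma trunc_eq_0: "v x \<le> lev (Suc k) \<Longrightarrow> trunc k x = 0"
  using lev_mono[of k] by (auto simp: trunc_def slice_def max_def min_def)

lemma trunc_top: "lev k < v x \<Longrightarrow> trunc k x = lev (Suc k)"
  using lev_mono[of k] lev_diff[of k] by (auto simp: trunc_def slice_def max_def min_def)

lemma sum_trunc: "(\<Sum>k<n. trunc k x) = slice (lev n) L (v x)"
proof (induction n)
  case 0
  then show ?case using v_le[of x] by (simp add: slice_def lev_def)
next
  case (Suc n)
  have "lev n \<le> L" using L_pos by (simp add: lev_def divide_le_eq)
  then show ?case
    using Suc slice_add[OF lev_mono[of n], of L "v x"] lev_mono by (simp add: trunc_def)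
qed

lemma sum_trunc_tendsto: "(\<lambda>n. \<Sum>k<n. trunc k x) \<longlonglongrightarrow> max 0 (v x)"
proof -
  have "lev \<longlonglongrightarrow> 0"
  proof -
    have "(\<lambda>k. L * (1 / 2) ^ k) \<longlonglongrightarrow> L * 0"
      by (intro tendsto_mult_left LIMSEQ_power_zero) auto
    then show ?thesis by (simp add: lev_def[abs_def] power_divide)
  qed
  then have "(\<lambda>n. max (lev n) (min L (v x)) - lev n) \<longlonglongrightarrow> max 0 (min L (v x)) - 0"
    by (intro tendsto_intros)
  moreover have "min L (v x) = v x" using v_le[of x] by simp
  ultimately show ?thesis by (simp add: sum_trunc slice_def)
qed

lemma sum_trunc_bounds: "0 \<le> (\<Sum>k<n. trunc k x)" "(\<Sum>k<n. trunc k x) \<le> L"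
  using v_le[of x] L_pos lev_pos[of n] by (auto simp: sum_trunc slice_def max_def min_def)

lemma grad_integrable: "integrable lborel (\<lambda>x. norm (g x) * indicator {lev (Suc k)<..<lev k} (v x))"
  using int_g by (rule Bochner_Integration.integrable_bound) (auto simp: indicator_def)

lemma grad_mass_nonneg: "0 \<le> grad_mass k"
  by (simp add: grad_mass_def)

lemma sum_grad_mass: "(\<Sum>k<n. grad_mass k) \<le> (LINT x|lborel. norm (g x))"
proof -
  have "(\<Sum>k<n. grad_mass k) = (LINT x|lborel. (\<Sum>k<n. norm (g x) * indicator {lev (Suc k)<..<lev k} (v x)))"
    unfolding grad_mass_def using grad_integrable by (intro Bochner_Integration.integral_sum[symmetric]) auto
  also have "\<dots> \<le> (LINT x|lborel. norm (g x))"
  proof (intro integral_mono int_g Bochner_Integration.integrable_sum grad_integrable)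
    fix x
    \<comment> \<open>Each band is bounded by a difference of indicators of sublevel sets, so the
      sum telescopes to at most 1.\<close>
    have "(\<Sum>k<n. indicator {lev (Suc k)<..<lev k} (v x)) \<le>
      (\<Sum>k<n. (if v x < lev k then 1 else 0) - (if v x < lev (Suc k) then 1 else 0 :: real))"
      using lev_mono by (intro sum_mono) (auto simp: indicator_def dest: less_le_trans)
    also have "\<dots> = (if v x < lev 0 then 1 else 0) - (if v x < lev n then 1 else 0)"
      by (rule sum_lessThan_telescope')
    also have "\<dots> \<le> 1" by auto
    finally have "norm (g x) * (\<Sum>k<n. indicator {lev (Suc k)<..<lev k} (v x)) \<le> norm (g x) * 1"
      by (intro mult_left_mono) auto
    then show "(\<Sum>k<n. norm (g x) * indicator {lev (Suc k)<..<lev k} (v x)) \<le> norm (g x)"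
      by (simp add: sum_distrib_left)
  qed
  finally show ?thesis .
qed

lemmas deriv_line = deriv_along_line[where f=v, OF deriv]

text \<open>The one-dimensional path estimate is applied along every segment from \<open>x\<close>
  to \<open>x + h\<close>. After Tonelli the integral over \<open>x\<close> no longer depends on the
  position on the segment, by translation invariance.\<close>

lemma trunc_disp: "L1_norm (\<lambda>x. trunc k (x + h) - trunc k x) \<le> ennreal (grad_mass k * norm h)"
proof -
  let ?G = "\<lambda>x. norm (g x) * indicator {lev (Suc k)<..<lev k} (v x)"
  have "L1_norm (\<lambda>x. trunc k (x + h) - trunc k x) \<le>
     (\<integral>\<^sup>+x. \<integral>\<^sup>+s. ennreal (norm h) * (ennreal (?G (x + s *\<^sub>R h)) * indicator {0..1} s) \<partial>lborel \<partial>lborel)"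
  proof (intro nn_integral_mono)
    fix x
    have "continuous_on UNIV (\<lambda>s. g (x + s *\<^sub>R h) \<bullet> h)"
      by (intro continuous_intros continuous_on_compose2[OF cont_g]) auto
    then have "isCont (\<lambda>s. g (x + s *\<^sub>R h) \<bullet> h) s" for s
      by (simp add: continuous_on_eq_continuous_at)
    then have "ennreal \<bar>trunc k (x + 1 *\<^sub>R h) - trunc k (x + 0 *\<^sub>R h)\<bar> \<le>
      (\<integral>\<^sup>+s\<in>{0..1}. ennreal (\<bar>g (x + s *\<^sub>R h) \<bullet> h\<bar> * indicator {lev (Suc k)<..<lev k} (v (x + s *\<^sub>R h))) \<partial>lborel)"
      unfolding trunc_def using lev_mono deriv_line by (intro slice_path_le)
    also have "\<dots> \<le> (\<integral>\<^sup>+s. ennreal (norm h) * (ennreal (?G (x + s *\<^sub>R h)) * indicator {0..1} s) \<partial>lborel)"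
    proof (intro nn_integral_mono)
      fix s :: real
      have "\<bar>g (x + s *\<^sub>R h) \<bullet> h\<bar> * indicator {lev (Suc k)<..<lev k} (v (x + s *\<^sub>R h)) \<le> norm h * ?G (x + s *\<^sub>R h)"
        using Cauchy_Schwarz_ineq2[of "g (x + s *\<^sub>R h)" h] by (auto simp: indicator_def mult.commute)
      then show "ennreal (\<bar>g (x + s *\<^sub>R h) \<bullet> h\<bar> * indicator {lev (Suc k)<..<lev k} (v (x + s *\<^sub>R h))) * indicator {0..1} s \<le>
        ennreal (norm h) * (ennreal (?G (x + s *\<^sub>R h)) * indicator {0..1} s)"
        by (simp add: mult.assoc[symmetric] ennreal_mult'[symmetric] mult_right_mono ennreal_leI)
    qed
    finally show "ennreal \<bar>trunc k (x + h) - trunc k x\<bar> \<le>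
      (\<integral>\<^sup>+s. ennreal (norm h) * (ennreal (?G (x + s *\<^sub>R h)) * indicator {0..1} s) \<partial>lborel)" by simp
  qed
  also have "\<dots> = (\<integral>\<^sup>+s. \<integral>\<^sup>+x. ennreal (norm h) * (ennreal (?G (x + s *\<^sub>R h)) * indicator {0..1} s) \<partial>lborel \<partial>lborel)"
    by (rule lborel_pair.Fubini'[symmetric]) measurable
  also have "\<dots> = (\<integral>\<^sup>+s. ennreal (norm h) * ((\<integral>\<^sup>+x. ennreal (?G (x + s *\<^sub>R h)) \<partial>lborel) * indicator {0..1} s) \<partial>lborel)"
    by (simp add: nn_integral_cmult nn_integral_multc)
  also have "\<dots> = (\<integral>\<^sup>+s. ennreal (norm h) * ((\<integral>\<^sup>+x. ennreal (?G x) \<partial>lborel) * indicator {0..1::real} s) \<partial>lborel)"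
  proof -
    have "(\<integral>\<^sup>+x. ennreal (?G (x + s *\<^sub>R h)) \<partial>lborel) = (\<integral>\<^sup>+x. ennreal (?G x) \<partial>lborel)" for s
      by (rule nn_integral_lborel_shift) measurable
    then show ?thesis by (simp only:)
  qed
  also have "(\<integral>\<^sup>+x. ennreal (?G x) \<partial>lborel) = ennreal (grad_mass k)"
    unfolding grad_mass_def using grad_integrable by (intro nn_integral_eq_integral) auto
  also have "(\<integral>\<^sup>+s. ennreal (norm h) * (ennreal (grad_mass k) * indicator {0..1::real} s) \<partial>lborel) = ennreal (grad_mass k * norm h)"
    using grad_mass_nonneg[of k]
    by (simp add: nn_integral_cmult nn_integral_cmult_indicator ennreal_mult) (simp add: mult.commute)
  finally show ?thesis .
qed

lemma super_set [measurable]: "{x. lev k < v x} \<in> sets borel"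
  by measurable

text \<open>The decay of \<open>v\<close> confines the superlevel set to a ball whose radius
  satisfies \<open>lev k * r ^ (D - 1) = C0\<close>. The weight is thus bounded uniformly in
  \<open>k\<close>: \<open>v\<close> is of weak type \<open>D / (D - 1)\<close> with a qualitative
  constant.\<close>

lemma super_ball:
  shows "emeasure lborel {x. lev k < v x} = ennreal (super k)"
    and "wt k \<le> 2 powr (real DIM('a) - 1) * C0"
proof -
  let ?D = "real DIM('a)"
  have D: "1 < ?D" using dim by simp
  have C0: "0 \<le> C0" using decay[of 0] dim by (simp add: zero_power)
  define r where "r = (C0 / lev k) powr (1 / (?D - 1))"
  have sub: "{x. lev k < v x} \<subseteq> cball 0 r"
  proof
    fix x assume "x \<in> {x. lev k < v x}"
    then have x: "lev k < v x" by simp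
    have "lev k * norm x ^ (DIM('a) - 1) \<le> v x * norm x ^ (DIM('a) - 1)"
      using x by (intro mult_right_mono) auto
    with decay[of x] have "norm x ^ (DIM('a) - 1) \<le> C0 / lev k"
      using lev_pos[of k] by (simp add: field_simps)
    then have "(norm x ^ (DIM('a) - 1)) powr (1 / (?D - 1)) \<le> r"
      unfolding r_def using D by (intro powr_mono2) auto
    moreover have "(norm x ^ (DIM('a) - 1)) powr (1 / (?D - 1)) = norm x"
    proof (cases "x = 0")
      case False
      then show ?thesis
        using D dim by (simp add: powr_realpow[symmetric] powr_powr of_nat_diff)
    next
      case True
      then show ?thesis using dim by (simp add: zero_power)
    qed
    ultimately show "x \<in> cball 0 r" by simp
  qed
  have r: "0 \<le> r" by (simp add: r_def)
  have le: "emeasure lborel {x. lev k < v x} \<le> ennreal ((2 * r) ^ DIM('a))"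
    using emeasure_mono[OF sub, of lborel] emeasure_cball_le[OF r, of "0::'a"] by simp
  then have "emeasure lborel {x. lev k < v x} < \<infinity>" by (auto intro: le_less_trans)
  then show eq: "emeasure lborel {x. lev k < v x} = ennreal (super k)"
    unfolding super_def by (intro emeasure_eq_ennreal_measure) auto
  have "super k \<le> (2 * r) ^ DIM('a)"
    using le r unfolding eq by simp
  also have "\<dots> = (2 * r) powr ?D"
    using r dim by (cases "r = 0") (auto simp: powr_realpow zero_power)
  finally have "super k powr (1 - 1 / ?D) \<le> ((2 * r) powr ?D) powr (1 - 1 / ?D)"
    using D by (intro powr_mono2) (auto simp: super_def)
  also have "\<dots> = (2 * r) powr (?D - 1)"
    using D by (simp add: powr_powr right_diff_distrib)
  also have "\<dots> = 2 powr (?D - 1) * (C0 / lev k)"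
    using D C0 lev_pos[of k] by (cases "C0 = 0") (auto simp: powr_mult r_def powr_powr)
  finally show "wt k \<le> 2 powr (?D - 1) * C0"
    unfolding wt_def using lev_pos[of k] by (simp add: field_simps)
qed

lemma super_nonneg: "0 \<le> super k" by (simp add: super_def)

lemma super_mono: "super k \<le> super (Suc k)"
proof -
  have "ennreal (super k) \<le> ennreal (super (Suc k))"
    unfolding super_ball(1)[symmetric] using lev_mono[of k] by (intro emeasure_mono) (auto intro: le_less_trans)
  then show ?thesis using super_nonneg by simp
qed

lemma wt_nonneg: "0 \<le> wt k" using lev_pos[of k] by (simp add: wt_def)

lemma nn_integral_trunc: "L1_norm (trunc k) \<le> ennreal (lev (Suc k) * super (Suc k))"
proof -
  have "L1_norm (trunc k) \<le> (\<integral>\<^sup>+x. ennreal (lev (Suc k)) * indicator {x. lev (Suc k) < v x} x \<partial>lborel)"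
  proof (intro nn_integral_mono)
    fix x
    show "ennreal \<bar>trunc k x\<bar> \<le> ennreal (lev (Suc k)) * indicator {x. lev (Suc k) < v x} x"
      using trunc_nonneg[of k x] trunc_le[of k x] trunc_eq_0[of x k] by (cases "lev (Suc k) < v x") (auto intro!: ennreal_leI)
  qed
  also have "\<dots> = ennreal (lev (Suc k) * super (Suc k))"
    using lev_pos[of "Suc k"] by (simp add: nn_integral_cmult_indicator super_ball ennreal_mult')
  finally show ?thesis .
qed

text \<open>Height and support of slice \<open>k\<close> both carry the index \<open>Suc k\<close>,
  because halving the levels makes the height equal to the lower level; hence
  \<open>H * m powr (1 - 1 / D)\<close> becomes \<open>wt (Suc k)\<close>. The freedom to enlarge
  \<open>a\<close> is used to make it positive.\<close>

lemma truncation_level_trunc: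
  assumes "0 < super (Suc k)" "grad_mass k \<le> a"
  shows "truncation_level (trunc k) (lev (Suc k)) (super (Suc k)) a"
proof
  fix h
  have "L1_norm (\<lambda>x. trunc k (x + h) - trunc k x) \<le> ennreal (grad_mass k * norm h)"
    by (rule trunc_disp)
  also have "\<dots> \<le> ennreal (a * norm h)"
    using assms by (intro ennreal_leI mult_right_mono) auto
  finally show "L1_norm (\<lambda>x. trunc k (x + h) - trunc k x) \<le> ennreal (a * norm h)" .
qed (use assms trunc_nonneg trunc_le lev_pos nn_integral_trunc grad_mass_nonneg[of k] in auto)

text \<open>A dichotomy. If \<open>wt (Suc k) \<ge> 2 * wt k\<close>, the first summand suffices.
  Otherwise two consecutive superlevel sets have comparable measure, so the factor
  \<open>super (Suc k) powr (1 / D)\<close> in the top level estimate can be replaced by a multiple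
  of \<open>super k powr (1 / D)\<close> and divided out.\<close>

lemma wt_rec: "wt k \<le> wt (Suc k) / 2 + 8 * iso_const TYPE('a) * grad_mass k"
proof (rule ccontr)
  let ?ic = "iso_const TYPE('a)"
  let ?D = "real DIM('a)"
  assume "\<not> ?thesis"
  then have gt: "wt (Suc k) / 2 + 8 * ?ic * grad_mass k < wt k" by simp
  have D: "2 \<le> ?D" using dim by simp
  have prod: "0 \<le> ?ic * grad_mass k"
    using iso_const_nonneg[where 'a='a] grad_mass_nonneg by simp
  have w1: "wt (Suc k) < 2 * wt k" using gt prod by simp
  have w2: "8 * ?ic * grad_mass k < wt k" using gt wt_nonneg[of "Suc k"] by simp
  have "0 < wt k" using prod w2 by simp
  then have m0: "0 < super k" using super_nonneg[of k] by (cases "super k = 0") (auto simp: wt_def)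
  then have m1: "0 < super (Suc k)" using super_mono[of k] by simp
  interpret T: truncation_level "trunc k" "lev (Suc k)" "super (Suc k)" "grad_mass k"
    using m1 by (intro truncation_level_trunc) auto
  have "ennreal (lev (Suc k)) * ennreal (super k) \<le> ennreal (?ic * grad_mass k * super (Suc k) powr (1 / ?D))"
    using T.top_level_measure_le[of "{x. lev k < v x}"] trunc_top by (simp add: super_ball iso_const_def)
  then have iso: "lev (Suc k) * super k \<le> ?ic * grad_mass k * super (Suc k) powr (1 / ?D)"
    using lev_pos[of "Suc k"] prod by (simp add: ennreal_mult'[symmetric])
  \<comment> \<open>\<open>wt (Suc k) < 2 * wt k\<close> compares the powers
    \<open>1 - 1 / D\<close> with factor 4, as the levels contribute another 2. Taking the root of
    order \<open>D - 1\<close> keeps the factor at most 4, since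
    \<open>D - 1 \<ge> 1\<close>.\<close>
  have "super (Suc k) powr (1 / ?D) \<le> 4 * super k powr (1 / ?D)"
  proof (rule ccontr)
    assume "\<not> ?thesis"
    then have "(4 * super k powr (1 / ?D)) powr (?D - 1) < (super (Suc k) powr (1 / ?D)) powr (?D - 1)"
      using D by (intro powr_less_mono2) auto
    moreover have "(super j powr (1 / ?D)) powr (?D - 1) = super j powr (1 - 1 / ?D)" for j
      unfolding powr_powr using D by (intro arg_cong[where f="(powr) (super j)"]) (simp add: field_simps)
    ultimately have "4 powr (?D - 1) * super k powr (1 - 1 / ?D) < super (Suc k) powr (1 - 1 / ?D)"
      by (simp add: powr_mult)
    moreover have "4 powr 1 \<le> (4::real) powr (?D - 1)"
      using D by (intro powr_mono) auto
    then have "4 * super k powr (1 - 1 / ?D) \<le> 4 powr (?D - 1) * super k powr (1 - 1 / ?D)"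
      by (intro mult_right_mono) auto
    ultimately have "4 * super k powr (1 - 1 / ?D) < super (Suc k) powr (1 - 1 / ?D)" by linarith
    then have "lev (Suc k) * (4 * super k powr (1 - 1 / ?D)) < lev (Suc k) * super (Suc k) powr (1 - 1 / ?D)"
      using lev_pos[of "Suc k"] by (intro mult_strict_left_mono)
    then have "2 * wt k < wt (Suc k)"
      unfolding wt_def lev_Suc[of k] by simp
    with w1 show False by simp
  qed
  then have "?ic * grad_mass k * super (Suc k) powr (1 / ?D) \<le> ?ic * grad_mass k * (4 * super k powr (1 / ?D))"
    using prod by (intro mult_left_mono)
  \<comment> \<open>The 8 is this 2, from \<open>lev k = 2 * lev (Suc k)\<close>, times the 4 from
    comparing the measures.\<close>
  with iso have "2 * (lev (Suc k) * super k) \<le> 8 * ?ic * grad_mass k * super k powr (1 / ?D)" by simp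
  moreover have "2 * (lev (Suc k) * super k) = wt k * super k powr (1 / ?D)"
    using m0 powr_add[of "super k" "1 - 1 / ?D" "1 / ?D"] by (simp add: wt_def lev_Suc[of k])
  ultimately have "wt k \<le> 8 * ?ic * grad_mass k"
    using m0 by simp
  with w2 show False by simp
qed

lemma wt_sum:
  shows "summable wt" "suminf wt \<le> 16 * iso_const TYPE('a) * (LINT x|lborel. norm (g x))"
  using absorb_half_sum[of wt "2 powr (real DIM('a) - 1) * C0" "8 * iso_const TYPE('a)" grad_mass "LINT x|lborel. norm (g x)"]
    wt_nonneg super_ball(2) wt_rec sum_grad_mass iso_const_nonneg[where 'a='a] by auto

text \<open>The partial sums of the slices stay between 0 and \<open>L\<close> and converge to the
  positive part, so \<open>L\<close> times the absolute kernel dominates and the convolution passes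
  to the limit.\<close>

lemma conv_dheat_pos_part_le:
  assumes "0 < t"
  shows "ennreal \<bar>conv (dheat t) (\<lambda>y. max 0 (v y)) x\<bar> \<le> (\<Sum>k. ennreal \<bar>conv (dheat t) (trunc k) x\<bar>)"
proof -
  have idh: "integrable lborel (\<lambda>y. dheat t (x - y))"
    using integrable_lborel_reflect[OF integrable_dheat[OF assms], of x] .
  have int: "integrable lborel (\<lambda>y. dheat t (x - y) * trunc k y)" for k
  proof (rule Bochner_Integration.integrable_bound)
    show "integrable lborel (\<lambda>y. lev (Suc k) * dheat t (x - y))" using idh by auto
    show "AE y in lborel. norm (dheat t (x - y) * trunc k y) \<le> norm (lev (Suc k) * dheat t (x - y))"
      using trunc_nonneg[of k] trunc_le[of k] lev_pos[of "Suc k"]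
      by (auto intro!: AE_I2 mult_right_mono simp: abs_mult mult.commute)
  qed measurable
  have "(\<lambda>n. LINT y|lborel. dheat t (x - y) * (\<Sum>k<n. trunc k y)) \<longlonglongrightarrow> conv (dheat t) (\<lambda>y. max 0 (v y)) x"
    unfolding conv_def
  proof (rule integral_dominated_convergence[where w="\<lambda>y. \<bar>dheat t (x - y)\<bar> * L"])
    show "integrable lborel (\<lambda>y. \<bar>dheat t (x - y)\<bar> * L)" using idh by auto
    show "AE y in lborel. (\<lambda>n. dheat t (x - y) * (\<Sum>k<n. trunc k y)) \<longlonglongrightarrow> dheat t (x - y) * max 0 (v y)"
      by (intro AE_I2 tendsto_mult_left sum_trunc_tendsto)
    show "AE y in lborel. norm (dheat t (x - y) * (\<Sum>k<n. trunc k y)) \<le> \<bar>dheat t (x - y)\<bar> * L" for n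
      using sum_trunc_bounds[where n=n] by (auto intro!: AE_I2 mult_left_mono simp: abs_mult)
  qed measurable
  then have "(\<lambda>n. ennreal \<bar>LINT y|lborel. dheat t (x - y) * (\<Sum>k<n. trunc k y)\<bar>) \<longlonglongrightarrow> ennreal \<bar>conv (dheat t) (\<lambda>y. max 0 (v y)) x\<bar>"
    by (intro tendsto_ennrealI tendsto_rabs)
  then show ?thesis
  proof (rule LIMSEQ_le_const2, intro exI allI impI)
    fix n :: nat
    have "(LINT y|lborel. dheat t (x - y) * (\<Sum>k<n. trunc k y)) = (\<Sum>k<n. conv (dheat t) (trunc k) x)"
      unfolding conv_def sum_distrib_left using int by (intro Bochner_Integration.integral_sum)
    then have "ennreal \<bar>LINT y|lborel. dheat t (x - y) * (\<Sum>k<n. trunc k y)\<bar> \<le> ennreal (\<Sum>k<n. \<bar>conv (dheat t) (trunc k) x\<bar>)"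
      by (auto intro!: ennreal_leI sum_abs)
    also have "\<dots> = (\<Sum>k<n. ennreal \<bar>conv (dheat t) (trunc k) x\<bar>)"
      by (rule sum_ennreal[symmetric]) auto
    also have "\<dots> \<le> (\<Sum>k. ennreal \<bar>conv (dheat t) (trunc k) x\<bar>)"
      by (rule sum_le_suminf) auto
    finally show "ennreal \<bar>LINT y|lborel. dheat t (x - y) * (\<Sum>k<n. trunc k y)\<bar> \<le> \<dots>" .
  qed
qed

lemma flow_pos_part_le:
  fixes \<alpha> :: real
  defines "p \<equiv> real DIM('a) / (real DIM('a) - \<alpha>)"
  assumes \<alpha>: "0 < \<alpha>" "\<alpha> < real DIM('a)"
  shows "(\<integral>\<^sup>+x. epow p (flow \<alpha> (\<lambda>y. max 0 (v y)) x) \<partial>lborel) \<le>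
    ennreal ((flow_const TYPE('a) \<alpha> * (2 + 32 * iso_const TYPE('a)) * (LINT x|lborel. norm (g x))) powr p)"
proof -
  let ?fc = "flow_const TYPE('a) \<alpha> * (2 + 32 * iso_const TYPE('a))" and ?fl = "flow_const TYPE('a) \<alpha>"
  let ?D = "real DIM('a)" and ?A = "LINT x|lborel. norm (g x)"
  have D: "2 \<le> ?D" using dim by simp
  have p: "1 < p" using \<alpha> by (simp add: p_def)
  have c: "0 \<le> ?fl"
    using level_const_bounds(1)[of 1, where 'a='a] \<alpha> D by (simp add: flow_const_def)
  have A: "0 \<le> ?A" by simp
  \<comment> \<open>\<open>truncation_level\<close> requires a support bound \<open>m > 0\<close>. A
    slice over a null superlevel set vanishes almost everywhere and has zero flow, so
    \<open>B k = 0\<close> is right there; elsewhere \<open>B k\<close> is positive, as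
    \<open>epow_suminf_le\<close> asks whenever the flow is not identically 0.\<close>
  define B where "B k = (if super (Suc k) = 0 then 0 else ?fl * (grad_mass k + 2 * wt (Suc k)))" for k
  define B' where "B' k = ?fl * (grad_mass k + 2 * wt (Suc k))" for k
  have B_le: "0 \<le> B k" "B k \<le> B' k" for k
    using c grad_mass_nonneg[of k] wt_nonneg[of "Suc k"] by (auto simp: B_def B'_def)
  have flow0: "flow \<alpha> (trunc k) x = 0" if "super (Suc k) = 0" for k x
  proof -
    have "L1_norm (trunc k) = 0"
      using nn_integral_trunc[of k] that by simp
    then have "AE y in lborel. trunc k y = 0"
      by (subst (asm) nn_integral_0_iff_AE) auto
    then have "conv (dheat t) (trunc k) x = (LINT y|(lborel :: 'a measure). 0)" for t
      unfolding conv_def by (intro integral_cong_AE) auto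
    then show ?thesis by (simp add: flow_def)
  qed
  have level: "(\<integral>\<^sup>+x. epow p (flow \<alpha> (trunc k) x) \<partial>lborel) \<le> ennreal (B k powr p)" for k
  proof (cases "super (Suc k) = 0")
    case True
    then show ?thesis by (simp add: flow0)
  next
    case False
    then have m: "0 < super (Suc k)" using super_nonneg[of "Suc k"] by simp
    then have "0 < wt (Suc k)" using lev_pos[of "Suc k"] by (simp add: wt_def)
    \<comment> \<open>\<open>grad_mass k\<close> may vanish, while the estimate for one slice
      requires \<open>0 < a\<close>. Adding \<open>wt (Suc k)\<close> ensures this and costs a
      second copy of a term that is present anyway, whence the 2 in \<open>B\<close>.\<close>
    then have a: "0 < grad_mass k + wt (Suc k)" "grad_mass k \<le> grad_mass k + wt (Suc k)"
      using grad_mass_nonneg[of k] by auto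
    interpret T: truncation_level "trunc k" "lev (Suc k)" "super (Suc k)" "grad_mass k + wt (Suc k)"
      using m a by (intro truncation_level_trunc)
    show ?thesis
      using T.heat_flow_epow_le[OF \<alpha> dim a(1)] False
      by (simp add: flow_def p_def B_def flow_const_def wt_def add.assoc)
  qed
  have sumA: "summable grad_mass" "suminf grad_mass \<le> ?A"
  proof -
    show "summable grad_mass"
      using sum_grad_mass[of "Suc n" for n] grad_mass_nonneg
      by (intro bounded_imp_summable[where B="?A"]) (auto simp: lessThan_Suc_atMost)
    then show "suminf grad_mass \<le> ?A"
      using sum_grad_mass by (intro suminf_le_const)
  qed
  have sumw: "summable (\<lambda>k. wt (Suc k))" "(\<Sum>k. wt (Suc k)) \<le> 16 * iso_const TYPE('a) * ?A"
    using wt_sum suminf_split_head[OF wt_sum(1)] wt_nonneg[of 0] by (auto simp: summable_Suc_iff)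
  have sumB': "summable B'"
    unfolding B'_def using sumA sumw by (intro summable_mult summable_add)
  have "suminf B' = ?fl * (suminf grad_mass + 2 * (\<Sum>k. wt (Suc k)))"
    unfolding B'_def using sumA sumw by (simp add: suminf_mult suminf_add[symmetric] summable_add summable_mult)
  also have "\<dots> \<le> ?fl * (2 * ?A + 2 * (16 * iso_const TYPE('a) * ?A))"
    using sumA(2) sumw(2) A c by (intro mult_left_mono add_mono order_trans[OF sumA(2)]) linarith+
  finally have B'_le: "suminf B' \<le> ?fc * ?A"
    by (simp add: algebra_simps)
  have sumB: "summable B"
    using sumB' B_le by (intro summable_comparison_test[OF _ sumB']) auto
  have "(\<integral>\<^sup>+x. epow p (flow \<alpha> (\<lambda>y. max 0 (v y)) x) \<partial>lborel) \<le> (\<integral>\<^sup>+x. epow p (\<Sum>k. flow \<alpha> (trunc k) x) \<partial>lborel)"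
  proof (rule nn_integral_mono, rule epow_mono)
    fix x
    have "flow \<alpha> (\<lambda>y. max 0 (v y)) x \<le> (\<integral>\<^sup>+t. (\<Sum>k. flow_dens \<alpha> t (trunc k) x * pos_ind t) \<partial>lborel)"
      unfolding flow_def
    proof (intro nn_integral_mono)
      fix t :: real
      show "flow_dens \<alpha> t (\<lambda>y. max 0 (v y)) x * pos_ind t \<le>
        (\<Sum>k. flow_dens \<alpha> t (trunc k) x * pos_ind t)"
      proof (cases "0 < t")
        case True
        have "flow_dens \<alpha> t (\<lambda>y. max 0 (v y)) x =
          ennreal (t powr ((\<alpha> - 1) / 2)) * ennreal \<bar>conv (dheat t) (\<lambda>y. max 0 (v y)) x\<bar>"
          by (rule ennreal_mult) auto
        also have "\<dots> \<le> ennreal (t powr ((\<alpha> - 1) / 2)) * (\<Sum>k. ennreal \<bar>conv (dheat t) (trunc k) x\<bar>)"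
          by (intro mult_left_mono conv_dheat_pos_part_le True) auto
        also have "\<dots> = (\<Sum>k. ennreal (t powr ((\<alpha> - 1) / 2)) * ennreal \<bar>conv (dheat t) (trunc k) x\<bar>)"
          by (rule ennreal_suminf_cmult[symmetric])
        also have "\<dots> = (\<Sum>k. flow_dens \<alpha> t (trunc k) x)"
          by (intro suminf_cong ennreal_mult[symmetric]) auto
        finally show ?thesis using True by simp
      qed simp
    qed
    also have "\<dots> = (\<Sum>k. flow \<alpha> (trunc k) x)"
      unfolding flow_def conv_def by (intro nn_integral_suminf) measurable
    finally show "flow \<alpha> (\<lambda>y. max 0 (v y)) x \<le> (\<Sum>k. flow \<alpha> (trunc k) x)" .
  qed (use p in auto)
  also have "\<dots> \<le> ennreal (suminf B powr p)"
  proof (intro epow_suminf_le p sumB level)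
    fix k x assume "B k = 0"
    show "flow \<alpha> (trunc k) x = 0"
    proof (cases "super (Suc k) = 0")
      case False
      then have "0 < super (Suc k)" using super_nonneg[of "Suc k"] by simp
      then have "0 < wt (Suc k)" using lev_pos[of "Suc k"] by (simp add: wt_def)
      moreover have "0 < ?fl"
        using level_const_bounds(1)[of 1, where 'a='a] \<alpha> D by (simp add: flow_const_def add_pos_pos)
      ultimately show ?thesis
        using \<open>B k = 0\<close> False grad_mass_nonneg[of k] by (simp add: B_def)
    qed (rule flow0)
  qed (use B_le in auto)
  also have "\<dots> \<le> ennreal ((?fc * ?A) powr p)"
    using suminf_le[OF B_le(2) sumB sumB'] B'_le p suminf_nonneg[OF sumB B_le(1)]
    by (intro ennreal_leI powr_mono2) auto
  finally show ?thesis .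
qed

end

subsection \<open>The potential of order one\<close>

text \<open>The uniform bound on potentials, applied to the indicator of the ball and evaluated at
  the origin, replaces polar coordinates.\<close>

lemma integrable_powr_norm_cball:
  assumes "2 \<le> DIM('a::euclidean_space)"
  shows "integrable lborel (\<lambda>y::'a. norm y powr (1 - real DIM('a)) * indicator (cball 0 r) y)"
proof -
  interpret bounded_integrable "indicator (cball (0::'a) r)" 1
  proof
    show "integrable lborel (indicator (cball (0::'a) r) :: 'a \<Rightarrow> real)"
      by (intro integrable_real_indicator emeasure_bounded_finite) auto
    show "indicator (cball (0::'a) r) \<in> borel_measurable borel"
      by (intro borel_measurable_indicator) auto
  qed (auto simp: indicator_def)
  have half: "0 < (1 / 2 :: real)" "1 / 2 < real DIM('a) / 2" using assms by auto
  obtain B where B: "\<And>x. L1_norm (\<lambda>y. norm (x - y) powr (2 * (1 / 2) - real DIM('a)) * indicator (cball (0::'a) r) y) \<le> ennreal B"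
    by (rule nn_rpot_bounded[OF half]) blast
  show ?thesis
    by (intro integrableI_bounded) (use B[of 0] in \<open>auto intro: le_less_trans\<close>)
qed

locale c1_compact =
  fixes u :: "'a::euclidean_space \<Rightarrow> real" and du :: "'a \<Rightarrow> 'a" and R :: real
  assumes cont_u: "continuous_on UNIV u" and cont_du: "continuous_on UNIV du"
    and deriv_u: "\<And>x h. ((\<lambda>s. u (x + s *\<^sub>R h)) has_real_derivative (du x \<bullet> h)) (at 0)"
    and supp_u: "\<And>x. R < norm x \<Longrightarrow> u x = 0" and supp_du: "\<And>x. R < norm x \<Longrightarrow> du x = 0"
    and R_nonneg: "0 \<le> R" and dim: "2 \<le> DIM('a)"
begin

definition ker :: "'a \<Rightarrow> real" where "ker y = norm y powr (1 - real DIM('a))"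

text \<open>The derivative is placed on \<open>u\<close>: the gradient of the kernel has size
  \<open>norm y powr (- D)\<close> and is not locally integrable.\<close>

definition grad_pot :: "'a \<Rightarrow> 'a" where "grad_pot x = (LINT y|lborel. ker y *\<^sub>R du (x - y))"

lemma ker_measurable [measurable]: "ker \<in> borel_measurable borel"
  unfolding ker_def by measurable

lemma ker_integrable: "integrable lborel (\<lambda>y. ker y * indicator (cball 0 r) y)"
  unfolding ker_def by (rule integrable_powr_norm_cball[OF dim])

lemma compact_support_bound:
  fixes f :: "'a \<Rightarrow> 'b::real_normed_vector"
  assumes "continuous_on UNIV f" "\<And>x. R < norm x \<Longrightarrow> f x = 0"
  obtains B where "0 < B" "\<And>x. norm (f x) \<le> B * indicator (cball 0 R) x"
proof -
  have "bounded (f ` cball 0 R)"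
    using assms(1) by (intro compact_imp_bounded compact_continuous_image) (auto intro: continuous_on_subset)
  then obtain B where B: "0 < B" "\<And>x. x \<in> cball 0 R \<Longrightarrow> norm (f x) \<le> B"
    by (auto simp: bounded_pos)
  have "norm (f x) \<le> B * indicator (cball 0 R) x" for x
    using B(2)[of x] assms(2)[of x] by (cases "norm x \<le> R") auto
  with B(1) show ?thesis by (rule that)
qed

text \<open>If \<open>norm x \<le> r\<close>, then \<open>f (x - y)\<close> vanishes unless
  \<open>norm y \<le> R + r\<close>. One integrable majorant thus serves all such \<open>x\<close>,
  both for continuity and for differentiation under the integral.\<close>

lemma ker_dominated:
  fixes f :: "'a \<Rightarrow> 'b::real_normed_vector"
  assumes "\<And>x. norm (f x) \<le> B * indicator (cball 0 R) x" "0 < B" "norm x \<le> r"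
  shows "norm (ker y *\<^sub>R f (x - y)) \<le> B * (ker y * indicator (cball 0 (R + r)) y)"
proof -
  have k: "0 \<le> ker y" by (simp add: ker_def)
  have "norm y \<le> norm (x - y) + norm x"
    using norm_triangle_ineq4[of x "x - y"] by simp
  then have "indicator (cball 0 R) (x - y) \<le> (indicator (cball 0 (R + r)) y :: real)"
    using assms(3) by (auto simp: indicator_def)
  then have "norm (f (x - y)) \<le> B * indicator (cball 0 (R + r)) y"
    using assms(2) by (intro order_trans[OF assms(1)] mult_left_mono) auto
  then have "ker y * norm (f (x - y)) \<le> ker y * (B * indicator (cball 0 (R + r)) y)"
    using k by (intro mult_left_mono) auto
  then show ?thesis using k by (simp add: mult_ac)
qed

lemma ker_f_integrable:
  fixes f :: "'a \<Rightarrow> 'b::euclidean_space"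
  assumes "continuous_on UNIV f" "\<And>x. R < norm x \<Longrightarrow> f x = 0"
  shows "integrable lborel (\<lambda>y. ker y *\<^sub>R f (x - y))"
proof -
  have [measurable]: "f \<in> borel_measurable borel"
    using assms(1) by (rule borel_measurable_continuous_onI)
  obtain B where B: "0 < B" "\<And>x. norm (f x) \<le> B * indicator (cball 0 R) x"
    using compact_support_bound[OF assms] by auto
  have "integrable lborel (\<lambda>y. B * (ker y * indicator (cball 0 (R + norm x)) y))"
    by (intro integrable_mult_right ker_integrable)
  then show ?thesis
  proof (rule Bochner_Integration.integrable_bound)
    show "AE y in lborel. norm (ker y *\<^sub>R f (x - y)) \<le> norm (B * (ker y * indicator (cball 0 (R + norm x)) y))"
      by (intro AE_I2 order_trans[OF ker_dominated[OF B(2,1) order_refl]]) simp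
  qed measurable
qed

lemma ker_f_continuous:
  fixes f :: "'a \<Rightarrow> 'b::euclidean_space"
  assumes "continuous_on UNIV f" "\<And>x. R < norm x \<Longrightarrow> f x = 0"
  shows "continuous_on UNIV (\<lambda>x. LINT y|lborel. ker y *\<^sub>R f (x - y))"
proof -
  have [measurable]: "f \<in> borel_measurable borel"
    using assms(1) by (rule borel_measurable_continuous_onI)
  obtain B where B: "0 < B" "\<And>x. norm (f x) \<le> B * indicator (cball 0 R) x"
    using compact_support_bound[OF assms] by auto
  show ?thesis
    unfolding continuous_on_sequentially
  proof (intro allI ballI impI)
    fix X :: "nat \<Rightarrow> 'a" and a assume X: "(\<forall>n. X n \<in> UNIV) \<and> X \<longlonglongrightarrow> a"
    then have "Bseq X" by (intro convergent_imp_Bseq) (auto simp: convergent_def)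
    then obtain r where r: "\<And>n. norm (X n) \<le> r" by (auto simp: Bseq_def)
    have "(\<lambda>n. LINT y|lborel. ker y *\<^sub>R f (X n - y)) \<longlonglongrightarrow> (LINT y|lborel. ker y *\<^sub>R f (a - y))"
    proof (rule integral_dominated_convergence[where w="\<lambda>y. B * (ker y * indicator (cball 0 (R + r)) y)"])
      show "integrable lborel (\<lambda>y. B * (ker y * indicator (cball 0 (R + r)) y))"
        by (intro integrable_mult_right ker_integrable)
      show "AE y in lborel. (\<lambda>n. ker y *\<^sub>R f (X n - y)) \<longlonglongrightarrow> ker y *\<^sub>R f (a - y)"
      proof (intro AE_I2 tendsto_scaleR tendsto_const)
        fix y
        have "isCont f (a - y)" using assms(1) by (simp add: continuous_on_eq_continuous_at)
        then show "(\<lambda>n. f (X n - y)) \<longlonglongrightarrow> f (a - y)"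
          using X by (intro isCont_tendsto_compose[where g=f] tendsto_diff tendsto_const) auto
      qed
      show "AE y in lborel. norm (ker y *\<^sub>R f (X n - y)) \<le> B * (ker y * indicator (cball 0 (R + r)) y)" for n
        using ker_dominated[OF B(2,1) r] by auto
    qed measurable
    then show "((\<lambda>x. LINT y|lborel. ker y *\<^sub>R f (x - y)) \<circ> X) \<longlonglongrightarrow> (LINT y|lborel. ker y *\<^sub>R f (a - y))"
      by (simp add: o_def)
  qed
qed

lemma u_bounded_integrable: obtains M where "bounded_integrable u M"
proof -
  obtain B where B: "0 < B" "\<And>x. norm (u x) \<le> B * indicator (cball 0 R) x"
    using compact_support_bound[OF cont_u supp_u] by auto
  have m: "u \<in> borel_measurable borel" using cont_u by (rule borel_measurable_continuous_onI)
  have "bounded_integrable u B"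
  proof
    show "\<bar>u y\<bar> \<le> B" for y using B(2)[of y] B(1) by (cases "norm y \<le> R") auto
    have "integrable lborel (\<lambda>y. B * indicator (cball 0 R) y :: real)"
      by (intro integrable_mult_right integrable_real_indicator emeasure_bounded_finite) auto
    then show "integrable lborel u"
      by (rule Bochner_Integration.integrable_bound)
        (use m B(2) in \<open>auto intro!: AE_I2 intro: order_trans[OF _ abs_ge_self]\<close>)
  qed (use m in auto)
  then show ?thesis by (rule that)
qed

section \<open>Gradient, decay and flow of the order one potential\<close>

definition pot :: "'a \<Rightarrow> real" where "pot = bounded_integrable.rpot u (1 / 2)"

lemma pot_eq: "pot x = (LINT y|lborel. ker y *\<^sub>R u (x - y))"
proof -
  obtain M where "bounded_integrable u M" by (rule u_bounded_integrable)
  then interpret bounded_integrable u M .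
  show ?thesis
    using integral_lborel_reflect[of "\<lambda>y. ker y * u (x - y)" x]
    by (simp add: pot_def rpot_def ker_def)
qed

lemmas deriv_u_line = deriv_along_line[where f=u, OF deriv_u]

lemma pot_has_derivative: "((\<lambda>s. pot (x + s *\<^sub>R h)) has_real_derivative (grad_pot x \<bullet> h)) (at 0)"
proof -
  let ?b = "\<lambda>y. ker y * indicator (cball 0 (R + (norm x + norm h))) y"
  have [measurable]: "du \<in> borel_measurable borel"
    using cont_du by (rule borel_measurable_continuous_onI)
  obtain B where B: "0 < B" "\<And>x. norm (du x) \<le> B * indicator (cball 0 R) x"
    using compact_support_bound[OF cont_du supp_du] by auto
  have "((\<lambda>s. LINT y|lborel. ker y *\<^sub>R u (x + s *\<^sub>R h - y)) has_real_derivative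
     (LINT y|lborel. (ker y *\<^sub>R du (x + 0 *\<^sub>R h - y)) \<bullet> h)) (at 0)"
  proof (rule deriv_under_integral[where \<delta>=1 and g="\<lambda>y. B * ?b y * norm h"])
    fix s :: real and y :: 'a
    assume s: "\<bar>s - 0\<bar> < 1"
    show "integrable lborel (\<lambda>y. ker y *\<^sub>R u (x + s *\<^sub>R h - y))"
      by (intro ker_f_integrable cont_u supp_u)
    have "((\<lambda>s. u (x - y + s *\<^sub>R h)) has_real_derivative (du (x - y + s *\<^sub>R h) \<bullet> h)) (at s)"
      by (rule deriv_u_line)
    then have "((\<lambda>s. u (x + s *\<^sub>R h - y)) has_real_derivative (du (x + s *\<^sub>R h - y) \<bullet> h)) (at s)"
      by (simp add: algebra_simps)
    then show "((\<lambda>s. ker y *\<^sub>R u (x + s *\<^sub>R h - y)) has_real_derivative (ker y *\<^sub>R du (x + s *\<^sub>R h - y)) \<bullet> h) (at s)"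
      by (auto intro: DERIV_cmult)
    have "norm (x + s *\<^sub>R h) \<le> norm x + \<bar>s\<bar> * norm h"
      using norm_triangle_ineq[of x "s *\<^sub>R h"] by simp
    also have "\<dots> \<le> norm x + 1 * norm h"
      using s by (intro add_left_mono mult_right_mono) auto
    finally have "norm (ker y *\<^sub>R du (x + s *\<^sub>R h - y)) \<le> B * ?b y"
      by (intro ker_dominated B) simp
    then have "norm (ker y *\<^sub>R du (x + s *\<^sub>R h - y)) * norm h \<le> B * ?b y * norm h"
      by (rule mult_right_mono) auto
    then show "\<bar>(ker y *\<^sub>R du (x + s *\<^sub>R h - y)) \<bullet> h\<bar> \<le> B * ?b y * norm h"
      by (rule order_trans[OF Cauchy_Schwarz_ineq2])
  next
    show "integrable lborel (\<lambda>y. B * ?b y * norm h)"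
      by (intro integrable_mult_left integrable_mult_right ker_integrable)
  qed (auto simp del: inner_scaleR_left)
  moreover have "(LINT y|lborel. (ker y *\<^sub>R du (x + 0 *\<^sub>R h - y)) \<bullet> h) = grad_pot x \<bullet> h"
    unfolding grad_pot_def using ker_f_integrable[OF cont_du supp_du, of x]
    by (simp del: inner_scaleR_left)
  ultimately show ?thesis by (simp add: pot_eq)
qed

text \<open>Near the support the uniform bound on the potential suffices. For
  \<open>norm x > 2 * R\<close> every \<open>y\<close> in the support has
  \<open>norm (x - y) \<ge> norm x / 2\<close>, which leaves the \<open>L\<^sup>1\<close> norm of
  \<open>u\<close>.\<close>

lemma pot_decay: obtains L C0 where "0 < L" "\<And>x. \<bar>pot x\<bar> \<le> L" "\<And>x. \<bar>pot x\<bar> * norm x ^ (DIM('a) - 1) \<le> C0"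
proof -
  let ?D = "real DIM('a)"
  obtain M where "bounded_integrable u M" by (rule u_bounded_integrable)
  then interpret bounded_integrable u M .
  have half: "0 < (1 / 2 :: real)" "1 / 2 < ?D / 2" using dim by auto
  obtain B where B: "0 \<le> B" "\<And>x. L1_norm (\<lambda>y. norm (x - y) powr (2 * (1 / 2) - ?D) * u y) \<le> ennreal B"
    using nn_rpot_bounded[OF half] by auto
  have le: "\<bar>pot x\<bar> \<le> B" for x
    unfolding pot_def rpot_def using B by (intro abs_integral_leI)
  have "\<bar>pot x\<bar> * norm x ^ (DIM('a) - 1) \<le> max (B * (2 * R) ^ (DIM('a) - 1)) (2 ^ (DIM('a) - 1) * U)" for x
  proof (cases "norm x \<le> 2 * R")
    case True
    then have "\<bar>pot x\<bar> * norm x ^ (DIM('a) - 1) \<le> B * (2 * R) ^ (DIM('a) - 1)"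
      using B(1) by (intro mult_mono le power_mono) auto
    then show ?thesis by (rule max.coboundedI1)
  next
    case False
    then have x: "0 < norm x" "x \<noteq> 0" using R_nonneg by auto
    have "\<bar>pot x\<bar> \<le> (norm x / 2) powr (1 - ?D) * U"
      unfolding pot_def rpot_def
    proof (rule abs_integral_leI)
      have "L1_norm (\<lambda>y. norm (x - y) powr (2 * (1 / 2) - ?D) * u y) \<le>
        (\<integral>\<^sup>+y. ennreal ((norm x / 2) powr (1 - ?D)) * ennreal \<bar>u y\<bar> \<partial>lborel)"
      proof (intro nn_integral_mono)
        fix y
        show "ennreal \<bar>norm (x - y) powr (2 * (1 / 2) - ?D) * u y\<bar> \<le>
          ennreal ((norm x / 2) powr (1 - ?D)) * ennreal \<bar>u y\<bar>"
        proof (cases "norm y \<le> R")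
          case True
          have "norm x \<le> norm (x - y) + norm y"
            using norm_triangle_ineq[of "x - y" y] by simp
          then have "norm x / 2 \<le> norm (x - y)" using True False by linarith
          then have "norm (x - y) powr (1 - ?D) \<le> (norm x / 2) powr (1 - ?D)"
            using x dim by (intro powr_mono2') auto
          then show ?thesis
            by (simp add: abs_mult ennreal_mult'[symmetric] mult_right_mono ennreal_leI)
        qed (simp add: supp_u)
      qed
      also have "\<dots> = ennreal ((norm x / 2) powr (1 - ?D) * U)"
        by (simp add: nn_integral_cmult nn_integral_u ennreal_mult')
      finally show "L1_norm (\<lambda>y. norm (x - y) powr (2 * (1 / 2) - ?D) * u y) \<le> \<dots>" .
    qed (use U_nonneg in auto)
    also have "(norm x / 2) powr (1 - ?D) = 2 ^ (DIM('a) - 1) / norm x ^ (DIM('a) - 1)"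
    proof -
      have "(norm x / 2) powr (1 - ?D) = inverse ((norm x / 2) powr real (DIM('a) - 1))"
        using dim powr_minus[of "norm x / 2" "real (DIM('a) - 1)"] by (simp add: of_nat_diff)
      also have "\<dots> = inverse ((norm x / 2) ^ (DIM('a) - 1))"
        using x by (subst powr_realpow) auto
      finally show ?thesis by (simp add: power_divide)
    qed
    finally have "\<bar>pot x\<bar> * norm x ^ (DIM('a) - 1) \<le> 2 ^ (DIM('a) - 1) * U"
      using x by (simp add: field_simps)
    then show ?thesis by (rule max.coboundedI2)
  qed
  moreover have "0 < B + 1" "\<And>x. \<bar>pot x\<bar> \<le> B + 1"
    using B(1) order_trans[OF le, of "B + 1"] by auto
  ultimately show ?thesis using that by blast
qed

text \<open>The estimate for positive parts is applied to \<open>pot\<close> and to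
  \<open>- pot\<close>, each time against the full gradient norm. The factor 4 absorbs both parts:
  the power of a sum costs \<open>2 powr p\<close>, the two equal bounds add another 2, and
  \<open>2 powr p * 2 \<le> 4 powr p\<close>.\<close>

lemma flow_pot_le:
  fixes \<alpha> :: real
  defines "p \<equiv> real DIM('a) / (real DIM('a) - \<alpha>)"
  assumes \<alpha>: "0 < \<alpha>" "\<alpha> < real DIM('a)" and int: "integrable lborel (\<lambda>x. norm (grad_pot x))"
  shows "(\<integral>\<^sup>+x. epow p (flow \<alpha> pot x) \<partial>lborel) \<le>
    ennreal ((4 * flow_const TYPE('a) \<alpha> * (2 + 32 * iso_const TYPE('a)) * (LINT x|lborel. norm (grad_pot x))) powr p)"
proof -
  let ?P = "\<lambda>s y. max 0 (s * pot y)"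
  obtain L C0 where L: "0 < L" "\<And>x. \<bar>pot x\<bar> \<le> L" "\<And>x. \<bar>pot x\<bar> * norm x ^ (DIM('a) - 1) \<le> C0"
    by (rule pot_decay) blast
  define S where "S = flow_const TYPE('a) \<alpha> * (2 + 32 * iso_const TYPE('a)) * (LINT x|lborel. norm (grad_pot x))"
  have p: "1 < p" using \<alpha> by (simp add: p_def)
  have S0: "0 \<le> S"
    unfolding S_def using level_const_bounds(1)[of 1, where 'a='a] iso_const_nonneg[where 'a='a] \<alpha> dim
    by (intro mult_nonneg_nonneg) (auto simp: flow_const_def)
  have cont_pot: "continuous_on UNIV pot"
    unfolding pot_eq[abs_def] by (intro ker_f_continuous cont_u supp_u)
  have cont_grad: "continuous_on UNIV grad_pot"
    unfolding grad_pot_def[abs_def] by (intro ker_f_continuous cont_du supp_du)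
  have [measurable]: "pot \<in> borel_measurable borel"
    using cont_pot by (rule borel_measurable_continuous_onI)
  have decay: "s * pot x * norm x ^ (DIM('a) - 1) \<le> C0" if "\<bar>s\<bar> = 1" for s x
  proof -
    have "s * pot x \<le> \<bar>pot x\<bar>" using that by (auto simp: abs_if split: if_splits)
    then have "s * pot x * norm x ^ (DIM('a) - 1) \<le> \<bar>pot x\<bar> * norm x ^ (DIM('a) - 1)"
      by (intro mult_right_mono) auto
    then show ?thesis using L(3)[of x] by simp
  qed
  have c1: "c1_decaying (\<lambda>x. s * pot x) (\<lambda>x. s *\<^sub>R grad_pot x) L C0" if s: "\<bar>s\<bar> = 1" for s
  proof
    show "continuous_on UNIV (\<lambda>x. s * pot x)" "continuous_on UNIV (\<lambda>x. s *\<^sub>R grad_pot x)"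
      by (intro continuous_intros cont_pot cont_grad)+
    show "((\<lambda>r. s * pot (x + r *\<^sub>R h)) has_real_derivative s *\<^sub>R grad_pot x \<bullet> h) (at 0)" for x h
      using DERIV_cmult[OF pot_has_derivative[of x h], of s] by simp
    show "s * pot x \<le> L" for x
      using L(2)[of x] s by (auto simp: abs_if split: if_splits)
    show "integrable lborel (\<lambda>x. norm (s *\<^sub>R grad_pot x))"
      using int s by simp
  qed (use L dim decay s in auto)
  have part: "(\<integral>\<^sup>+x. epow p (flow \<alpha> (?P s) x) \<partial>lborel) \<le> ennreal (S powr p)" if s: "\<bar>s\<bar> = 1" for s
    using c1_decaying.flow_pos_part_le[OF c1[OF s] \<alpha>] s by (simp add: p_def S_def)
  have flow_le: "flow \<alpha> pot x \<le> flow \<alpha> (?P 1) x + flow \<alpha> (?P (- 1)) x" for x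
  proof -
    have "flow \<alpha> pot x \<le> (\<integral>\<^sup>+t. flow_dens \<alpha> t (?P 1) x * pos_ind t +
      flow_dens \<alpha> t (?P (- 1)) x * pos_ind t \<partial>lborel)"
      unfolding flow_def
    proof (intro nn_integral_mono)
      fix t :: real
      show "flow_dens \<alpha> t pot x * pos_ind t \<le>
        flow_dens \<alpha> t (?P 1) x * pos_ind t +
        flow_dens \<alpha> t (?P (- 1)) x * pos_ind t"
      proof (cases "0 < t")
        case True
        have i: "integrable lborel (\<lambda>y. dheat t (x - y) * max 0 (s * pot y))" if "\<bar>s\<bar> = 1" for s
        proof (rule Bochner_Integration.integrable_bound)
          show "integrable lborel (\<lambda>y. dheat t (x - y) * L)"
            using integrable_lborel_reflect[OF integrable_dheat[OF True], of x] by auto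
          have "\<bar>max 0 (s * pot y)\<bar> \<le> \<bar>L\<bar>" for y
            using L(1) L(2)[of y] that by (auto simp: abs_if max_def split: if_splits)
          then show "AE y in lborel. norm (dheat t (x - y) * max 0 (s * pot y)) \<le> norm (dheat t (x - y) * L)"
            unfolding real_norm_def abs_mult by (intro AE_I2 mult_left_mono) auto
        qed measurable
        have "conv (dheat t) pot x = (LINT y|lborel. dheat t (x - y) * max 0 (1 * pot y) - dheat t (x - y) * max 0 (- 1 * pot y))"
          unfolding conv_def by (intro Bochner_Integration.integral_cong) (auto simp: max_def)
        also have "\<dots> = conv (dheat t) (?P 1) x - conv (dheat t) (?P (- 1)) x"
          unfolding conv_def using i[of 1] i[of "- 1"] by (intro Bochner_Integration.integral_diff) auto
        finally have "\<bar>conv (dheat t) pot x\<bar> \<le> \<bar>conv (dheat t) (?P 1) x\<bar> + \<bar>conv (dheat t) (?P (- 1)) x\<bar>"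
          by simp
        then have "t powr ((\<alpha> - 1) / 2) * \<bar>conv (dheat t) pot x\<bar> \<le>
          t powr ((\<alpha> - 1) / 2) * (\<bar>conv (dheat t) (?P 1) x\<bar> + \<bar>conv (dheat t) (?P (- 1)) x\<bar>)"
          by (intro mult_left_mono) auto
        then show ?thesis
          using True by (simp add: distrib_left ennreal_leI ennreal_plus[symmetric] del: ennreal_plus)
      qed simp
    qed
    also have "\<dots> = flow \<alpha> (?P 1) x + flow \<alpha> (?P (- 1)) x"
      unfolding flow_def conv_def by (intro nn_integral_add) measurable
    finally show ?thesis .
  qed
  have "(\<integral>\<^sup>+x. epow p (flow \<alpha> pot x) \<partial>lborel) \<le>
    (\<integral>\<^sup>+x. ennreal (2 powr p) * (epow p (flow \<alpha> (?P 1) x) + epow p (flow \<alpha> (?P (- 1)) x)) \<partial>lborel)"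
    using p by (intro nn_integral_mono order_trans[OF epow_mono epow_add_le] flow_le) auto
  also have "\<dots> = ennreal (2 powr p) * ((\<integral>\<^sup>+x. epow p (flow \<alpha> (?P 1) x) \<partial>lborel) +
     (\<integral>\<^sup>+x. epow p (flow \<alpha> (?P (- 1)) x) \<partial>lborel))"
    by (subst nn_integral_cmult, measurable) (subst nn_integral_add, auto)
  also have "\<dots> \<le> ennreal (2 powr p) * (ennreal (S powr p) + ennreal (S powr p))"
    by (intro mult_left_mono add_mono part) auto
  also have "\<dots> = ennreal (2 powr p * 2 * S powr p)"
    by (simp add: ennreal_mult'[symmetric] ennreal_plus[symmetric] del: ennreal_plus)
  also have "\<dots> \<le> ennreal ((4 * S) powr p)"
  proof (intro ennreal_leI)
    have "(2::real) powr 1 \<le> 2 powr p" using p by (intro powr_mono) auto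
    then have "2 powr p * 2 * S powr p \<le> 2 powr p * 2 powr p * S powr p"
      by (intro mult_right_mono mult_left_mono) auto
    also have "\<dots> = (4 * S) powr p"
      using S0 by (simp add: powr_mult[symmetric])
    finally show "2 powr p * 2 * S powr p \<le> (4 * S) powr p" .
  qed
  finally show ?thesis by (simp add: S_def mult.assoc)
qed

end

subsection \<open>Test functions\<close>

lemma riesz_const_pos: "0 < \<alpha> \<Longrightarrow> \<alpha> < N \<Longrightarrow> 0 < riesz_const N \<alpha>"
  by (simp add: riesz_const_def Gamma_real_pos)

text \<open>The integrands agree also at \<open>y = x\<close>, where division by 0 and a power of 0
  both give 0.\<close>

lemma riesz_potential_eq_rpot:
  "riesz_potential \<alpha> u x = 1 / riesz_const (real CARD('n)) \<alpha> * bounded_integrable.rpot u (\<alpha> / 2) (x :: real ^ 'n::finite)"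
  if "bounded_integrable u M"
proof -
  have "u y / norm (x - y) powr (real CARD('n) - \<alpha>) = norm (x - y) powr (2 * (\<alpha> / 2) - real DIM(real ^ 'n)) * u y" for y
  proof -
    have e: "2 * (\<alpha> / 2) - real DIM(real ^ 'n) = - (real CARD('n) - \<alpha>)" by simp
    show ?thesis unfolding e powr_minus by (simp only: divide_inverse mult.commute)
  qed
  then show ?thesis
    unfolding riesz_potential_def bounded_integrable.rpot_def[OF that] by simp
qed

text \<open>Differentiability at \<open>x\<close> makes the derivative in direction \<open>h\<close>
  linear in \<open>h\<close>, so its values on the axes, the partial derivatives, determine
  it.\<close>

lemma C_1_has_gradient:
  fixes u :: "real ^ 'n::finite \<Rightarrow> real"
  assumes "u differentiable (at x)"
  shows "((\<lambda>s. u (x + s *\<^sub>R h)) has_real_derivative (gradient u x \<bullet> h)) (at 0)"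
proof -
  obtain D where D: "(u has_derivative D) (at x)"
    using assms by (auto simp: differentiable_def)
  then interpret D: bounded_linear D by (rule has_derivative_bounded_linear)
  have line: "((\<lambda>s. u (x + s *\<^sub>R k)) has_real_derivative D k) (at 0)" for k
  proof -
    have "((\<lambda>s. x + s *\<^sub>R k) has_derivative (\<lambda>s. s *\<^sub>R k)) (at 0)"
      by (auto intro!: derivative_eq_intros)
    moreover have "(u has_derivative D) (at (x + 0 *\<^sub>R k))" using D by simp
    ultimately have "((\<lambda>s. u (x + s *\<^sub>R k)) has_derivative (\<lambda>s. D (s *\<^sub>R k))) (at 0)"
      by (rule has_derivative_compose)
    moreover have "(\<lambda>s. D (s *\<^sub>R k)) = (*) (D k)"
      by (simp add: D.scaleR fun_eq_iff)
    ultimately show ?thesis by (simp add: has_field_derivative_def)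
  qed
  have "gradient u x \<bullet> h = (\<Sum>i\<in>UNIV. D (axis i 1) * h $ i)"
    using line by (simp add: gradient_def partial_deriv_def inner_vec_def DERIV_imp_deriv[OF line])
  also have "\<dots> = D (\<Sum>i\<in>UNIV. h $ i *\<^sub>R axis i 1)"
    by (simp add: D.sum D.scaleR mult.commute)
  also have "(\<Sum>i\<in>UNIV. h $ i *\<^sub>R axis i 1) = h"
    by (simp add: basis_expansion flip: scalar_mult_eq_scaleR)
  finally show ?thesis using line[of h] by simp
qed

lemma test_function_c1_compact:
  fixes u :: "real ^ 'n::finite \<Rightarrow> real"
  assumes "test_function u" "2 \<le> CARD('n)"
  obtains R where "c1_compact u (gradient u) R"
proof -
  have diff: "u differentiable (at x)" for x
    using assms(1) by (auto simp: test_function_def dest: spec[of _ "Suc 0"])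
  have pd: "continuous_on UNIV (partial_deriv j u)" for j
    using assms(1) by (auto simp: test_function_def dest: spec[of _ "Suc 0"])
  have cont: "continuous_on UNIV u"
    using diff by (intro continuous_at_imp_continuous_on ballI differentiable_imp_continuous_within)
  have "bounded (closure {x. u x \<noteq> 0})"
    using assms(1) by (auto simp: test_function_def intro: compact_imp_bounded)
  then obtain R where R: "0 < R" "\<And>x. x \<in> closure {x. u x \<noteq> 0} \<Longrightarrow> norm x \<le> R"
    by (auto simp: bounded_pos)
  have supp: "u x = 0" if "R < norm x" for x
    using R(2)[of x] that closure_subset[of "{x. u x \<noteq> 0}"] by fastforce
  have "c1_compact u (gradient u) R"
  proof
    show "continuous_on UNIV (gradient u)"
      unfolding gradient_def[abs_def] by (intro continuous_on_vec_lambda pd)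
    show "((\<lambda>s. u (x + s *\<^sub>R h)) has_real_derivative gradient u x \<bullet> h) (at 0)" for x h
      by (intro C_1_has_gradient diff)
    show "gradient u x = 0" if "R < norm x" for x
    proof -
      have "partial_deriv j u x = 0" for j
      proof -
        have "((\<lambda>s. u (x + s *\<^sub>R axis j 1)) has_real_derivative 0) (at 0)"
        proof (rule has_field_derivative_transform_within_open[OF DERIV_const[of 0]])
          show "open {s. R < norm (x + s *\<^sub>R axis j 1)}"
            by (intro open_Collect_less continuous_intros)
        qed (use that supp in auto)
        then show ?thesis unfolding partial_deriv_def by (rule DERIV_imp_deriv)
      qed
      then show ?thesis by (simp add: gradient_def vec_eq_iff)
    qed
  qed (use cont supp R assms(2) in auto)
  then show ?thesis by (rule that)
qed

theorem theoremA:
  fixes \<alpha> :: real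
  assumes "CARD('n::finite) \<ge> 2" and "0 < \<alpha>" and "\<alpha> < real CARD('n)"
  shows "\<exists>C>0. \<forall>u :: real ^ 'n \<Rightarrow> real.
           test_function u \<and> in_Lp 1 (riesz_transform u) \<longrightarrow>
           in_Lp (real CARD('n) / (real CARD('n) - \<alpha>)) (riesz_potential \<alpha> u) \<and>
           Lp_norm (real CARD('n) / (real CARD('n) - \<alpha>)) (riesz_potential \<alpha> u)
             \<le> C * Lp_norm 1 (riesz_transform u)"
proof -
  let ?N = "real CARD('n)" and ?T = "TYPE(real ^ 'n)"
  let ?S = "4 * flow_const ?T \<alpha> * (2 + 32 * iso_const ?T)"
  define p where "p = ?N / (?N - \<alpha>)"
  \<comment> \<open>The factor of \<open>rpot_eq_mellin_rpot\<close> at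
    \<open>\<beta> = \<alpha> / 2\<close>, combined with the normalisation of the Riesz
    potential.\<close>
  define K where "K = \<bar>mellin_heat ?T (1 / 2) /
      (\<alpha> / 2 * mellin_heat ?T (\<alpha> / 2) * heat_mass ?T * Beta (\<alpha> / 2 + 1 / 2) (1 / 2))\<bar> / riesz_const ?N \<alpha>"
  \<comment> \<open>\<open>riesz_const ?N 1\<close> converts the norm of \<open>grad_pot\<close>,
    the gradient of the unnormalised potential, into that of
    \<open>riesz_transform u\<close>.\<close>
  define C where "C = K * (?S * riesz_const ?N 1)"
  have p: "1 < p" using assms by (simp add: p_def)
  have rc: "0 < riesz_const ?N \<alpha>" "0 < riesz_const ?N 1"
    using assms by (auto intro!: riesz_const_pos)
  have K: "0 \<le> K" using rc by (simp add: K_def)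
  have C: "0 \<le> C"
    unfolding C_def flow_const_def
    using K rc level_const_bounds(1)[of 1, where 'a="real ^ 'n"] iso_const_nonneg[where 'a="real ^ 'n"] assms
    by (intro mult_nonneg_nonneg add_nonneg_nonneg divide_nonneg_nonneg) auto
  have main: "in_Lp p (riesz_potential \<alpha> u) \<and> Lp_norm p (riesz_potential \<alpha> u) \<le> C * Lp_norm 1 (riesz_transform u)"
    if u: "test_function u" and Ru: "in_Lp 1 (riesz_transform u)" for u :: "real ^ 'n \<Rightarrow> real"
  proof -
    obtain R where "c1_compact u (gradient u) R"
      using test_function_c1_compact[OF u] assms(1) by blast
    then interpret c1_compact u "gradient u" R .
    obtain M where "bounded_integrable u M" by (rule u_bounded_integrable)
    then interpret b: bounded_integrable u M .
    have pot: "riesz_potential 1 u x = 1 / riesz_const ?N 1 * pot x" for x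
      using riesz_potential_eq_rpot[OF b.bounded_integrable_axioms, of 1 x] by (simp add: pot_def)
    have Ru_eq: "riesz_transform u x = (1 / riesz_const ?N 1) *\<^sub>R grad_pot x" for x
    proof -
      have "partial_deriv j (riesz_potential 1 u) x = 1 / riesz_const ?N 1 * (grad_pot x \<bullet> axis j 1)" for j
        unfolding partial_deriv_def pot by (intro DERIV_imp_deriv DERIV_cmult pot_has_derivative)
      then show ?thesis
        by (simp add: riesz_transform_def gradient_def vec_eq_iff inner_axis)
    qed
    have norm_grad: "norm (grad_pot x) = riesz_const ?N 1 * norm (riesz_transform u x)" for x
      using rc by (simp add: Ru_eq)
    have Ru_int: "integrable lborel (\<lambda>x. norm (riesz_transform u x))"
      using Ru by (simp add: in_Lp_def)
    define A where "A = Lp_norm 1 (riesz_transform u)"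
    have A: "A = (LINT x|lborel. norm (riesz_transform u x))" "0 \<le> A"
      by (simp_all add: A_def Lp_norm_def)
    have grad_int: "integrable lborel (\<lambda>x. norm (grad_pot x))"
      unfolding norm_grad using Ru_int by simp
    have flow: "(\<integral>\<^sup>+x. epow p (flow \<alpha> pot x) \<partial>lborel) \<le>
      ennreal ((?S * (riesz_const ?N 1 * A)) powr p)"
      using flow_pot_le[of \<alpha>] assms grad_int by (simp add: p_def norm_grad A)
    have "(\<lambda>x. riesz_potential \<alpha> u x) \<in> borel_measurable borel"
      unfolding riesz_potential_def by measurable
    then have meas [measurable]: "riesz_potential \<alpha> u \<in> borel_measurable borel" by simp
    have pot_meas [measurable]: "pot \<in> borel_measurable borel"
      unfolding pot_eq[abs_def] by (intro borel_measurable_continuous_onI ker_f_continuous cont_u supp_u)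
    have pointwise: "ennreal \<bar>riesz_potential \<alpha> u x\<bar> \<le> ennreal K * flow \<alpha> pot x" for x
    proof -
      let ?I = "LINT t|lborel. pos_ind t * t powr (\<alpha> / 2 - 1 / 2) * conv (dheat t) pot x"
      have "\<bar>riesz_potential \<alpha> u x\<bar> = K * \<bar>?I\<bar>"
        using riesz_potential_eq_rpot[OF b.bounded_integrable_axioms, of \<alpha> x]
          b.rpot_eq_mellin_rpot[of "\<alpha> / 2" x] assms rc
        by (simp add: K_def pot_def abs_mult abs_divide)
      then have "ennreal \<bar>riesz_potential \<alpha> u x\<bar> = ennreal K * ennreal \<bar>?I\<bar>"
        using K by (simp add: ennreal_mult')
      also have "\<dots> \<le> ennreal K * L1_norm (\<lambda>t. pos_ind t * t powr (\<alpha> / 2 - 1 / 2) * conv (dheat t) pot x)"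
        by (intro mult_left_mono abs_integral_le_nn_integral) auto
      also have "L1_norm (\<lambda>t. pos_ind t * t powr (\<alpha> / 2 - 1 / 2) * conv (dheat t) pot x) = flow \<alpha> pot x"
        unfolding flow_def by (intro nn_integral_cong) (auto simp: indicator_def abs_mult diff_divide_distrib)
      finally show ?thesis .
    qed
    have "(\<integral>\<^sup>+x. ennreal (norm (riesz_potential \<alpha> u x) powr p) \<partial>lborel) \<le>
      (\<integral>\<^sup>+x. ennreal (K powr p) * epow p (flow \<alpha> pot x) \<partial>lborel)"
    proof (intro nn_integral_mono)
      fix x
      have "ennreal (norm (riesz_potential \<alpha> u x) powr p) = epow p (ennreal \<bar>riesz_potential \<alpha> u x\<bar>)"
        by (simp add: epow_ennreal)
      also have "\<dots> \<le> epow p (ennreal K * flow \<alpha> pot x)"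
        using p by (intro epow_mono pointwise) auto
      also have "\<dots> = ennreal (K powr p) * epow p (flow \<alpha> pot x)"
        using K by (rule epow_cmult)
      finally show "ennreal (norm (riesz_potential \<alpha> u x) powr p) \<le> ennreal (K powr p) * epow p (flow \<alpha> pot x)" .
    qed
    also have "\<dots> \<le> ennreal (K powr p) * ennreal ((?S * (riesz_const ?N 1 * A)) powr p)"
      using flow by (simp add: nn_integral_cmult mult_left_mono)
    also have "\<dots> = ennreal ((C * A) powr p)"
    proof -
      have "K powr p * (?S * (riesz_const ?N 1 * A)) powr p =
        (K * (?S * (riesz_const ?N 1 * A))) powr p"
        by (simp add: powr_mult)
      then show ?thesis
        by (simp add: C_def ennreal_mult'[symmetric] mult_ac)
    qed
    finally have fin: "(\<integral>\<^sup>+x. ennreal (norm (riesz_potential \<alpha> u x) powr p) \<partial>lborel) \<le> ennreal ((C * A) powr p)" .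
    \<comment> \<open>Integrability is derived from the extended-real bound first: without it the
      Bochner integral would be 0 by convention and a bound on \<open>Lp_norm\<close> would carry no
      information.\<close>
    then have int: "integrable lborel (\<lambda>x. norm (riesz_potential \<alpha> u x) powr p)"
      by (intro integrableI_bounded) (auto intro: le_less_trans)
    have "ennreal (LINT x|lborel. norm (riesz_potential \<alpha> u x) powr p) \<le> ennreal ((C * A) powr p)"
      using fin nn_integral_eq_integral[OF int] by simp
    then have "(LINT x|lborel. norm (riesz_potential \<alpha> u x) powr p) \<le> (C * A) powr p"
      by simp
    then have "Lp_norm p (riesz_potential \<alpha> u) \<le> ((C * A) powr p) powr (1 / p)"
      unfolding Lp_norm_def using p by (intro powr_mono2) auto
    also have "\<dots> = C * A"
      using p C A(2) by (simp add: powr_powr)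
    finally show ?thesis
      using int by (simp add: in_Lp_def A_def)
  qed
  show ?thesis
  \<comment> \<open>\<open>C\<close> has been shown to be nonnegative; adding 1 gives a strictly
    positive constant.\<close>
  proof (intro exI[of _ "C + 1"] conjI allI impI)
    show "0 < C + 1" using C by simp
    fix u :: "real ^ 'n \<Rightarrow> real"
    assume u: "test_function u \<and> in_Lp 1 (riesz_transform u)"
    show "in_Lp (?N / (?N - \<alpha>)) (riesz_potential \<alpha> u)"
      using main u by (simp add: p_def)
    have "0 \<le> Lp_norm 1 (riesz_transform u)" by (simp add: Lp_norm_def)
    then show "Lp_norm (?N / (?N - \<alpha>)) (riesz_potential \<alpha> u) \<le> (C + 1) * Lp_norm 1 (riesz_transform u)"
      using main[of u] u by (simp add: p_def distrib_right)
  qed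
qed

end
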